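(* Let $n=n_0+n_1$ with integers $n_0\ge 0$, $n_1\ge 2$. For $c,\gamma\in\mathbb{C}$ with $\operatorname{Re}c>-\frac12$ and $\operatorname{Re}\gamma\ge 0$, $$\int_{\mathbb{R}^n}\prod_{i=n_0+1}^n x_i^2\prod_{n_0+1\le i<j\le n}(x_i^2-x_j^2)^2\prod_{i=1}^n|x_i|^{2c}\prod_{1\le i<j\le n}|x_i^2-x_j^2|^{2\gamma}\,d\mu$$ $$=2^{-n_1-cn}\prod_{i=1}^{n_0}\frac{\Gamma(1+i\gamma)\Gamma(1+2c+2(i-1)\gamma)}{\Gamma(1+\gamma)\Gamma(1+c+(i-1)\gamma)}\prod_{j=1}^{n_1}\frac{j(1+\gamma)\Gamma(j+(n_0+j)\gamma)\Gamma(1+2c+2j+2(n_0+j-1)\gamma)}{\Gamma(2+\gamma)\Gamma(1+c+j+(n_0+j-1)\gamma)},$$ and $$\int_{\mathbb{R}^n}\prod_{n_0+1\le i<j\le n}(x_i^2-x_j^2)^2\prod_{i=1}^n|x_i|^{2c}\prod_{1\le i<j\le n}|x_i^2-x_j^2|^{2\gamma}\,d\mu$$ $$=2^{-cn}\prod_{i=1}^{n_0}\frac{\Gamma(1+i\gamma)\Gamma(1+2c+2(i-1)\gamma)}{\Gamma(1+\gamma)\Gamma(1+c+(i-1)\gamma)}\prod_{j=1}^{n_1}\frac{j(1+\gamma)\Gamma(j+(n_0+j)\gamma)\Gamma(1+2c+2(j-1)+2(n_0+j-1)\gamma)}{\Gamma(2+\gamma)\Gamma(c+j+(n_0+j-1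)\gamma)}.$$
   Context: $d\mu$ is the standard Gaussian measure on $\mathbb{R}^n$: $d\mu=(2\pi)^{-n/2}\prod_{i=1}^n e^{-x_i^2/2}\,dx_1\cdots dx_n$. *)

theory Defs
  imports "HOL-Probability.Probability"
begin

text \<open>
  Since the dimension is a natural number, \<open>\<real>\<^sup>n\<close> is rendered as the space of functions
  on the index set \<open>{1..n}\<close>, with Lebesgue measure the product of \<open>n\<close> copies of
  \<^const>\<open>lborel\<close>.
\<close>

definition gaussian_measure :: "nat \<Rightarrow> (nat \<Rightarrow> real) measure" where
  "gaussian_measure n =
     density (\<Pi>\<^sub>M i\<in>{1..n}. lborel)
       (\<lambda>x. ennreal ((2 * pi) powr (- real n / 2) * (\<Prod>i=1..n. exp (- (x i)\<^sup>2 / 2))))"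

text \<open>The pairs \<open>(i, j)\<close> with \<open>a \<le> i < j \<le> b\<close>.\<close>

definition index_pairs :: "nat \<Rightarrow> nat \<Rightarrow> (nat \<times> nat) set" where
  "index_pairs a b = {(i, j). a \<le> i \<and> i < j \<and> j \<le> b}"

end

(*
  Work first with real c > 0 and gamma >= 1. Put t_i = x_i^2, let f be the Vandermonde product in the
  t_i with i > n0, and E the integral against the weight. Since f is alternating of the least
  possible degree, E(s r f) = 0 for every symmetric s and every polynomial r of smaller degree.
  Integration by parts in x_i, symmetrized over the transpositions (i l), therefore moves the factors
  t_i one at a time onto f as Cherednik operators, up to terms killed by this orthogonality. What
  remains is a polynomial h with E(r h) = E(t_k ... t_n r f) for all r of degree at most deg f.
  The alternating part of such r is a multiple of f, so h = lambda f by positivity of the weight, and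
  lambda is read off from the leading monomial, on which the operators act triangularly. The first
  integral is this lambda (with k = n0 + 1) times the second one, and k = 1 evaluates the shift
  c -> c + 1 of the second one.

  By logarithmic convexity in c, as in the Bohr-Mollerup theorem, the shift determines the integral up to a
  factor independent of c. At c = 1/2 integration by parts in x_1 leaves only the boundary term at
  x_1 = 0, which is an integral of the same kind with n0 - 1 in place of n0 and c = 2 gamma + 1/2.
  For n0 = 0 the factor f^2 is absorbed by gamma -> gamma + 1. This fixes the factor.

  Complex parameters are reached by analytic continuation in gamma, then in c, and the line
  Re gamma = 0 by dominated convergence.
*)
theory Submission
  imports Defs "HOL-Complex_Analysis.Complex_Analysis"
begin

section \<open>The Gaussian product measure\<close>

text \<open>Integration by parts produces singular sums of 1 / (t_i - t_l). For gamma >= 1 the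
  weight absorbs each denominator, so every such term is integrable by itself and may be swapped and
  regrouped freely.

  The derivative also hits the test polynomial r. This lowers the degree of r, and the identity
  reached so far carries the term back to an integral against f, where it vanishes. That is why
  testing stops at degree deg f.

  The eigenvalues are read along x_j = R^j with R tending to infinity. There t_k / (t_k - t_l) tends
  to 1 for l < k and to 0 for l > k. For l < k the divided difference gives the monomial minus its
  transposed copy, and the reflection part of the Cherednik operator restores that copy, so each l <
  k contributes 2 g. With all indices in s, ..., e - 1 and f on p, ..., e - 1, the k-th factor is 1
  + 2 c + 2 (k - p) + 2 g (k - s), where k - p counts as 0 for k < p.

  At c = 1/2 the weight contains |x_1|, which is x_1 up to sign, and x_1 times the Gaussian density
  is minus the derivative of that density. The jump of the sign at 0 is the source of the boundary
  term.\<close>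

definition std_normal :: "real measure" where
  "std_normal = density lborel (\<lambda>x. ennreal (std_normal_density x))"

definition gauss :: "nat set \<Rightarrow> (nat \<Rightarrow> real) measure" where
  "gauss I = (\<Pi>\<^sub>M i\<in>I. std_normal)"

lemma prob_space_std_normal: "prob_space std_normal"
  unfolding std_normal_def by (rule prob_space_normal_density) simp

lemma space_std_normal [simp]: "space std_normal = UNIV"
  by (simp add: std_normal_def)

lemma sets_std_normal [simp, measurable_cong]: "sets std_normal = sets borel"
  by (simp add: std_normal_def)

interpretation std_normal: prob_space std_normal
  by (rule prob_space_std_normal)

interpretation gaussS: product_sigma_finite "\<lambda>_::nat. std_normal"
  by unfold_locales

lemma prob_space_gauss: "prob_space (gauss I)"
  unfolding gauss_def by (intro prob_space_PiM prob_space_std_normal)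

lemma measurable_gauss_component [measurable]:
  "i \<in> I \<Longrightarrow> (\<lambda>x. x i) \<in> borel_measurable (gauss I)"
  unfolding gauss_def by measurable

text \<open>A finite product measure is determined by its values on boxes, where the density splits
  into one-dimensional factors. The product form gives access to Fubini in one coordinate and to
  relabelling of coordinates.\<close>

lemma gaussian_measure_eq: "gaussian_measure n = gauss {1..n}"
  unfolding gauss_def
proof (rule gaussS.PiM_eqI)
  show "finite {1..n}" by simp
  interpret L: product_sigma_finite "\<lambda>_::nat. lborel :: real measure"
    by unfold_locales
  show "sets (gaussian_measure n) = sets (Pi\<^sub>M {1..n} (\<lambda>_. std_normal))"
    unfolding gaussian_measure_def by (auto intro!: sets_PiM_cong)
  fix A assume A: "\<And>i. i \<in> {1..n} \<Longrightarrow> A i \<in> sets std_normal"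
  define d where "d = (\<lambda>x::nat \<Rightarrow> real. ennreal ((2 * pi) powr (- real n / 2) * (\<Prod>i=1..n. exp (- (x i)\<^sup>2 / 2))))"
  have d: "d x = (\<Prod>i\<in>{1..n}. ennreal (std_normal_density (x i)))" for x
  proof -
    have "(\<Prod>i\<in>{1..n}. ennreal (std_normal_density (x i))) = ennreal (\<Prod>i\<in>{1..n}. std_normal_density (x i))"
      by (rule prod_ennreal) auto
    also have "(\<Prod>i\<in>{1..n}. std_normal_density (x i)) = (1 / sqrt (2 * pi)) ^ n * (\<Prod>i=1..n. exp (- (x i)\<^sup>2 / 2))"
      by (simp add: std_normal_density_def prod.distrib prod_dividef power_divide)
    also have "(1 / sqrt (2 * pi)) ^ n = (2 * pi) powr (- real n / 2)"
    proof -
      have "1 / sqrt (2*pi) = (2*pi) powr (-1/2)"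
        by (simp add: powr_minus_divide powr_half_sqrt)
      then have "(1 / sqrt (2 * pi)) ^ n = ((2*pi) powr (-1/2)) powr n"
        by (simp add: powr_realpow)
      then show ?thesis by (simp add: powr_powr)
    qed
    finally show ?thesis by (simp add: d_def)
  qed
  have meas: "d \<in> borel_measurable (Pi\<^sub>M {1..n} (\<lambda>_. lborel))"
    unfolding d_def
    by (intro measurable_compose[OF _ measurable_ennreal] borel_measurable_times borel_measurable_const borel_measurable_prod)
      (rule measurable_compose[OF measurable_component_singleton], auto)
  have sA: "(\<Pi>\<^sub>E i\<in>{1..n}. A i) \<in> sets (Pi\<^sub>M {1..n} (\<lambda>_. lborel))"
    using A by (intro sets_PiM_I_finite) auto
  have "emeasure (gaussian_measure n) (\<Pi>\<^sub>E i\<in>{1..n}. A i)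
      = (\<integral>\<^sup>+x. d x * indicator (\<Pi>\<^sub>E i\<in>{1..n}. A i) x \<partial>(Pi\<^sub>M {1..n} (\<lambda>_. lborel)))"
    unfolding gaussian_measure_def d_def[symmetric] by (rule emeasure_density[OF meas sA])
  also have "\<dots> = (\<integral>\<^sup>+x. (\<Prod>i\<in>{1..n}. ennreal (std_normal_density (x i)) * indicator (A i) (x i)) \<partial>(Pi\<^sub>M {1..n} (\<lambda>_. lborel)))"
  proof (intro nn_integral_cong)
    fix x assume x: "x \<in> space (Pi\<^sub>M {1..n} (\<lambda>_. lborel :: real measure))"
    have "(\<Prod>i\<in>{1..n}. indicator (A i) (x i)) = (indicator (\<Pi>\<^sub>E i\<in>{1..n}. A i) x :: ennreal)"
      using x by (cases "\<forall>i\<in>{1..n}. x i \<in> A i") (auto simp: PiE_def Pi_iff indicator_def space_PiM prod_zero)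
    then show "d x * indicator (\<Pi>\<^sub>E i\<in>{1..n}. A i) x = (\<Prod>i\<in>{1..n}. ennreal (std_normal_density (x i)) * indicator (A i) (x i))"
      by (simp add: d prod.distrib)
  qed
  also have "\<dots> = (\<Prod>i\<in>{1..n}. \<integral>\<^sup>+x. ennreal (std_normal_density x) * indicator (A i) x \<partial>lborel)"
    using A by (intro L.product_nn_integral_prod) (auto intro!: borel_measurable_times borel_measurable_indicator)
  also have "\<dots> = (\<Prod>i\<in>{1..n}. emeasure std_normal (A i))"
    using A by (intro prod.cong refl) (simp add: std_normal_def emeasure_density)
  finally show "emeasure (gaussian_measure n) (\<Pi>\<^sub>E i\<in>{1..n}. A i) = (\<Prod>i\<in>{1..n}. emeasure std_normal (A i))" .
qed

abbreviation swp :: "nat \<Rightarrow> nat \<Rightarrow> nat \<Rightarrow> nat" where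
  "swp \<equiv> Transposition.transpose"

lemma gauss_integral_swap:
  fixes h :: "(nat \<Rightarrow> real) \<Rightarrow> real"
  assumes "i \<in> I" "l \<in> I" and h: "h \<in> borel_measurable (gauss I)"
  shows "(\<integral>x. h (x \<circ> swp i l) \<partial>gauss I) = (\<integral>x. h x \<partial>gauss I)"
proof -
  let ?s = "swp i l"
  have s: "?s ` I \<subseteq> I" "inj_on ?s I" using assms by (auto simp: Transposition.transpose_def inj_on_def)
  have "distr (Pi\<^sub>M I (\<lambda>_. std_normal)) (Pi\<^sub>M I (\<lambda>i. std_normal)) (\<lambda>\<omega>. \<lambda>n\<in>I. \<omega> (?s n)) = Pi\<^sub>M I (\<lambda>i. std_normal)"
    using distr_PiM_reindex[of I "\<lambda>_. std_normal" ?s I] s prob_space_std_normal by auto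
  then have eq: "gauss I = distr (gauss I) (gauss I) (\<lambda>\<omega>. \<lambda>n\<in>I. \<omega> (?s n))"
    by (simp add: gauss_def)
  have m: "(\<lambda>\<omega>. \<lambda>n\<in>I. \<omega> (?s n)) \<in> measurable (gauss I) (gauss I)"
    unfolding gauss_def using s by (auto intro!: measurable_restrict measurable_component_singleton)
  have "(\<integral>x. h x \<partial>gauss I) = (\<integral>x. h (\<lambda>n\<in>I. x (?s n)) \<partial>gauss I)"
    by (subst eq) (rule integral_distr[OF m h])
  \<comment> \<open>Points of the product space are \<open>undefined\<close> off \<open>I\<close>,
    so restricting the relabelled point to \<open>I\<close> changes nothing.\<close>
  also have "\<dots> = (\<integral>x. h (x \<circ> ?s) \<partial>gauss I)"
  proof (rule Bochner_Integration.integral_cong[OF refl])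
    fix x assume "x \<in> space (gauss I)"
    then have "x \<in> extensional I" by (auto simp: gauss_def space_PiM PiE_def)
    then have "(\<lambda>n\<in>I. x (?s n)) = x \<circ> ?s"
      using assms(1,2) by (auto simp: fun_eq_iff extensional_def Transposition.transpose_def)
    then show "h (\<lambda>n\<in>I. x (?s n)) = h (x \<circ> ?s)" by simp
  qed
  finally show ?thesis ..
qed

section \<open>Functions of polynomial growth\<close>

lemma integrable_std_normal_even_power: "integrable std_normal (\<lambda>x. (1 + x\<^sup>2) ^ k)"
proof -
  have "integrable lborel (\<lambda>x. std_normal_density x * (1 + x\<^sup>2) ^ k)"
  proof -
    have "(\<lambda>x. std_normal_density x * (1 + x\<^sup>2) ^ k)
      = (\<lambda>x::real. \<Sum>j\<le>k. real (k choose j) * (std_normal_density x * x ^ (2 * j)))"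
    proof
      fix x :: real
      have "(1 + x\<^sup>2) ^ k = (x\<^sup>2 + 1) ^ k" by (simp add: add.commute)
      also have "\<dots> = (\<Sum>j\<le>k. real (k choose j) * (x\<^sup>2) ^ j * 1 ^ (k - j))" by (rule binomial_ring)
      finally show "std_normal_density x * (1 + x\<^sup>2) ^ k = (\<Sum>j\<le>k. real (k choose j) * (std_normal_density x * x ^ (2 * j)))"
        by (simp add: sum_distrib_left power_mult[symmetric] mult_ac)
    qed
    then show ?thesis
      by (auto intro!: Bochner_Integration.integrable_sum integrable_mult_right integrable_std_normal_moment)
  qed
  then show ?thesis
    unfolding std_normal_def by (subst integrable_density) (auto simp: mult.commute)
qed

text \<open>The majorant is a power of a product over the coordinates instead of a power of a norm:
  it factorizes, so its Gaussian integral is a product of one-dimensional ones.\<close>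

definition poly_bounded :: "nat set \<Rightarrow> ((nat \<Rightarrow> real) \<Rightarrow> real) \<Rightarrow> bool" where
  "poly_bounded I g \<longleftrightarrow> g \<in> borel_measurable (gauss I) \<and>
     (\<exists>C k. \<forall>x. \<bar>g x\<bar> \<le> C * (\<Prod>i\<in>I. 1 + (x i)\<^sup>2) ^ k)"

lemma prod_one_plus_sq_ge: "finite I \<Longrightarrow> 1 \<le> (\<Prod>i\<in>I. 1 + (x i)\<^sup>2)" for x :: "nat \<Rightarrow> real"
  by (rule prod_ge_1) auto

lemma poly_bounded_integrable:
  assumes "finite I" "poly_bounded I g"
  shows "integrable (gauss I) g"
proof -
  from assms obtain C k where m: "g \<in> borel_measurable (gauss I)"
    and b: "\<And>x. \<bar>g x\<bar> \<le> C * (\<Prod>i\<in>I. 1 + (x i)\<^sup>2) ^ k"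
    unfolding poly_bounded_def by blast
  have "integrable (gauss I) (\<lambda>x. \<Prod>i\<in>I. (1 + (x i)\<^sup>2) ^ k)"
    unfolding gauss_def by (rule gaussS.product_integrable_prod[OF assms(1) integrable_std_normal_even_power])
  then have "integrable (gauss I) (\<lambda>x. C * (\<Prod>i\<in>I. 1 + (x i)\<^sup>2) ^ k)"
    by (simp add: prod_power_distrib)
  then show ?thesis
  proof (rule Bochner_Integration.integrable_bound[OF _ m], intro AE_I2)
    fix x
    show "norm (g x) \<le> norm (C * (\<Prod>i\<in>I. 1 + (x i)\<^sup>2) ^ k)"
      unfolding real_norm_def by (rule order_trans[OF b abs_ge_self])
  qed
qed

lemma poly_bounded_const [intro]: "poly_bounded I (\<lambda>_. a)"
  unfolding poly_bounded_def by (auto intro!: exI[of _ "\<bar>a\<bar>"] exI[of _ "0::nat"])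

lemma poly_boundedI:
  assumes "g \<in> borel_measurable (gauss I)" "\<And>x. \<bar>g x\<bar> \<le> C * (\<Prod>i\<in>I. 1 + (x i)\<^sup>2) ^ k"
  shows "poly_bounded I g"
  using assms unfolding poly_bounded_def by blast

lemma poly_bounded_mult [intro]:
  assumes "poly_bounded I g" "poly_bounded I h"
  shows "poly_bounded I (\<lambda>x. g x * h x)"
proof -
  from assms obtain C k C' k' where m: "g \<in> borel_measurable (gauss I)" "h \<in> borel_measurable (gauss I)"
    and b: "\<And>x. \<bar>g x\<bar> \<le> C * (\<Prod>i\<in>I. 1 + (x i)\<^sup>2) ^ k" "\<And>x. \<bar>h x\<bar> \<le> C' * (\<Prod>i\<in>I. 1 + (x i)\<^sup>2) ^ k'"
    unfolding poly_bounded_def by blast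
  show ?thesis
  proof (rule poly_boundedI)
    show "(\<lambda>x. g x * h x) \<in> borel_measurable (gauss I)" using m by measurable
    fix x
    have "\<bar>g x * h x\<bar> \<le> (C * (\<Prod>i\<in>I. 1 + (x i)\<^sup>2) ^ k) * (C' * (\<Prod>i\<in>I. 1 + (x i)\<^sup>2) ^ k')"
      unfolding abs_mult by (rule mult_mono[OF b]) (auto intro: order_trans[OF abs_ge_zero b(1)])
    then show "\<bar>g x * h x\<bar> \<le> (C * C') * (\<Prod>i\<in>I. 1 + (x i)\<^sup>2) ^ (k + k')"
      by (simp add: power_add mult_ac)
  qed
qed

lemma poly_bounded_add [intro]:
  assumes "finite I" "poly_bounded I g" "poly_bounded I h"
  shows "poly_bounded I (\<lambda>x. g x + h x)"
proof -
  from assms obtain C k C' k' where m: "g \<in> borel_measurable (gauss I)" "h \<in> borel_measurable (gauss I)"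
    and b: "\<And>x. \<bar>g x\<bar> \<le> C * (\<Prod>i\<in>I. 1 + (x i)\<^sup>2) ^ k" "\<And>x. \<bar>h x\<bar> \<le> C' * (\<Prod>i\<in>I. 1 + (x i)\<^sup>2) ^ k'"
    unfolding poly_bounded_def by blast
  show ?thesis
  proof (rule poly_boundedI)
    show "(\<lambda>x. g x + h x) \<in> borel_measurable (gauss I)" using m by measurable
    fix x :: "nat \<Rightarrow> real"
    define P where "P = (\<Prod>i\<in>I. 1 + (x i)\<^sup>2)"
    note b = b[of x, folded P_def]
    have P: "1 \<le> P" unfolding P_def by (rule prod_one_plus_sq_ge[OF assms(1)])
    have "\<bar>g x\<bar> \<le> \<bar>C\<bar> * P ^ (k + k')"
    proof -
      have "\<bar>g x\<bar> \<le> \<bar>C\<bar> * P ^ k" by (rule order_trans[OF b(1)]) (use P in \<open>auto intro!: mult_right_mono\<close>)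
      also have "\<dots> \<le> \<bar>C\<bar> * P ^ (k + k')" by (rule mult_left_mono[OF power_increasing]) (use P in auto)
      finally show ?thesis .
    qed
    moreover have "\<bar>h x\<bar> \<le> \<bar>C'\<bar> * P ^ (k + k')"
    proof -
      have "\<bar>h x\<bar> \<le> \<bar>C'\<bar> * P ^ k'" by (rule order_trans[OF b(2)]) (use P in \<open>auto intro!: mult_right_mono\<close>)
      also have "\<dots> \<le> \<bar>C'\<bar> * P ^ (k + k')" by (rule mult_left_mono[OF power_increasing]) (use P in auto)
      finally show ?thesis .
    qed
    ultimately show "\<bar>g x + h x\<bar> \<le> (\<bar>C\<bar> + \<bar>C'\<bar>) * (\<Prod>i\<in>I. 1 + (x i)\<^sup>2) ^ (k + k')"
      unfolding P_def[symmetric] by (simp add: distrib_right)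
  qed
qed

lemma poly_bounded_cmult [intro]: "poly_bounded I g \<Longrightarrow> poly_bounded I (\<lambda>x. a * g x)"
  by (rule poly_bounded_mult) auto

lemma poly_bounded_diff [intro]:
  assumes "finite I" "poly_bounded I g" "poly_bounded I h"
  shows "poly_bounded I (\<lambda>x. g x - h x)"
  using poly_bounded_add[OF assms(1,2) poly_bounded_cmult[OF assms(3), of "-1"]] by simp

lemma poly_bounded_prod [intro]:
  "(\<And>j. j \<in> K \<Longrightarrow> poly_bounded I (g j)) \<Longrightarrow> poly_bounded I (\<lambda>x. \<Prod>j\<in>K. g j x)"
  by (induction K rule: infinite_finite_induct) auto

lemma poly_bounded_sum [intro]:
  "finite I \<Longrightarrow> (\<And>j. j \<in> K \<Longrightarrow> poly_bounded I (g j)) \<Longrightarrow> poly_bounded I (\<lambda>x. \<Sum>j\<in>K. g j x)"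
  by (induction K rule: infinite_finite_induct) auto

lemma poly_bounded_power [intro]: "poly_bounded I g \<Longrightarrow> poly_bounded I (\<lambda>x. g x ^ k)"
  by (induction k) auto

lemma component_bound:
  fixes x :: "nat \<Rightarrow> real"
  assumes "finite I" "i \<in> I"
  shows "1 + (x i)\<^sup>2 \<le> (\<Prod>i\<in>I. 1 + (x i)\<^sup>2)"
proof -
  have "(\<Prod>i\<in>I. 1 + (x i)\<^sup>2) = (1 + (x i)\<^sup>2) * (\<Prod>i\<in>I-{i}. 1 + (x i)\<^sup>2)"
    using assms by (simp add: prod.remove)
  moreover have "1 \<le> (\<Prod>i\<in>I-{i}. 1 + (x i)\<^sup>2)" by (rule prod_one_plus_sq_ge) (use assms in auto)
  ultimately show ?thesis using mult_left_mono[of 1 "\<Prod>i\<in>I-{i}. 1 + (x i)\<^sup>2" "1 + (x i)\<^sup>2"] by simp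
qed

lemma poly_bounded_component [intro]:
  assumes "finite I" "i \<in> I"
  shows "poly_bounded I (\<lambda>x. x i)"
proof (rule poly_boundedI)
  show "(\<lambda>x. x i) \<in> borel_measurable (gauss I)" using assms by measurable
  fix x :: "nat \<Rightarrow> real"
  have "0 \<le> (\<bar>x i\<bar> - 1)\<^sup>2" by simp
  then have "\<bar>x i\<bar> \<le> 1 + (x i)\<^sup>2" unfolding power2_eq_square by (simp add: algebra_simps)
  then show "\<bar>x i\<bar> \<le> 1 * (\<Prod>i\<in>I. 1 + (x i)\<^sup>2) ^ 1" using component_bound[OF assms, of x] by simp
qed

lemma powr_le_one_plus_power:
  fixes u :: real
  assumes "0 \<le> r" "r \<le> real k" "0 \<le> u"
  shows "u powr r \<le> 1 + u ^ k"
proof (cases "u \<le> 1")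
  case True
  then have "u powr r \<le> 1" using assms by (cases "u = 0") (auto intro: powr_le1)
  then show ?thesis using assms by (smt (verit) zero_le_power)
next
  case False
  then have "u powr r \<le> u powr real k" using assms by (intro powr_mono) auto
  then show ?thesis using False by (simp add: powr_realpow)
qed

lemma poly_bounded_powr [intro]:
  assumes "finite I" "poly_bounded I g" "0 \<le> r"
  shows "poly_bounded I (\<lambda>x. \<bar>g x\<bar> powr r)"
proof -
  define k where "k = nat \<lceil>r\<rceil>"
  have "poly_bounded I (\<lambda>x. 1 + (g x) ^ (2 * k))" using assms by auto
  then obtain C j where b: "\<And>x. \<bar>1 + (g x) ^ (2 * k)\<bar> \<le> C * (\<Prod>i\<in>I. 1 + (x i)\<^sup>2) ^ j"
    unfolding poly_bounded_def by blast
  show ?thesis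
  proof (rule poly_boundedI)
    show "(\<lambda>x. \<bar>g x\<bar> powr r) \<in> borel_measurable (gauss I)"
      using assms(2) unfolding poly_bounded_def by auto
    fix x
    have "r \<le> real (2 * k)" using assms(3) unfolding k_def by linarith
    then have "\<bar>g x\<bar> powr r \<le> 1 + \<bar>g x\<bar> ^ (2 * k)" using assms(3) by (intro powr_le_one_plus_power) auto
    also have "\<dots> = \<bar>1 + (g x) ^ (2 * k)\<bar>" by (simp add: power_mult)
    also have "\<dots> \<le> C * (\<Prod>i\<in>I. 1 + (x i)\<^sup>2) ^ j" by (rule b)
    finally show "\<bar>\<bar>g x\<bar> powr r\<bar> \<le> C * (\<Prod>i\<in>I. 1 + (x i)\<^sup>2) ^ j" by simp
  qed
qed

text \<open>The quotient has absolute value \<open>\<bar>g x\<bar> powr (r - 1)\<close>, also at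
  zeros of \<open>g\<close>, where division by zero and powers of zero both give 0.\<close>

lemma poly_bounded_powr_div [intro]:
  assumes "finite I" "poly_bounded I g" "1 \<le> r"
  shows "poly_bounded I (\<lambda>x. \<bar>g x\<bar> powr r / g x)"
proof -
  have "poly_bounded I (\<lambda>x. \<bar>g x\<bar> powr (r - 1))" using assms by auto
  then obtain C j where b: "\<And>x. \<bar>\<bar>g x\<bar> powr (r - 1)\<bar> \<le> C * (\<Prod>i\<in>I. 1 + (x i)\<^sup>2) ^ j"
    unfolding poly_bounded_def by blast
  show ?thesis
  proof (rule poly_boundedI)
    show "(\<lambda>x. \<bar>g x\<bar> powr r / g x) \<in> borel_measurable (gauss I)"
      using assms(2) unfolding poly_bounded_def by auto
    fix x
    have "\<bar>\<bar>g x\<bar> powr r / g x\<bar> = \<bar>g x\<bar> powr r / \<bar>g x\<bar>" by simp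
    also have "\<dots> = \<bar>g x\<bar> powr (r - 1)" by (cases "g x = 0") (auto simp: powr_diff)
    also have "\<dots> \<le> C * (\<Prod>i\<in>I. 1 + (x i)\<^sup>2) ^ j" using b[of x] by simp
    finally show "\<bar>\<bar>g x\<bar> powr r / g x\<bar> \<le> C * (\<Prod>i\<in>I. 1 + (x i)\<^sup>2) ^ j" by simp
  qed
qed

section \<open>The weight and integration by parts\<close>

definition pairs :: "nat set \<Rightarrow> (nat \<times> nat) set" where
  "pairs I = {(i, j). i \<in> I \<and> j \<in> I \<and> i < j}"

definition weight :: "nat set \<Rightarrow> real \<Rightarrow> real \<Rightarrow> (nat \<Rightarrow> real) \<Rightarrow> real" where
  "weight I c g x = (\<Prod>i\<in>I. \<bar>x i\<bar> powr (2 * c)) *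
     (\<Prod>(i, j)\<in>pairs I. \<bar>(x i)\<^sup>2 - (x j)\<^sup>2\<bar> powr (2 * g))"

lemma finite_pairs [simp, intro]: "finite I \<Longrightarrow> finite (pairs I)"
  unfolding pairs_def by (rule finite_subset[of _ "I \<times> I"]) auto

text \<open>Splits off a coordinate at any position of the order; symmetry of \<open>F\<close> makes
  the orientation of the new pairs irrelevant.\<close>

lemma prod_pairs_insert:
  fixes F :: "nat \<Rightarrow> nat \<Rightarrow> 'a::comm_monoid_mult"
  assumes "finite I" "i \<notin> I" and sym: "\<And>a b. F a b = F b a"
  shows "(\<Prod>(a, b)\<in>pairs (insert i I). F a b) = (\<Prod>l\<in>I. F i l) * (\<Prod>(a, b)\<in>pairs I. F a b)"
proof -
  define m where "m = (\<lambda>l. if i < l then (i, l) else (l, i))"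
  have eq: "pairs (insert i I) = m ` I \<union> pairs I"
  proof (intro set_eqI iffI)
    fix ab assume "ab \<in> pairs (insert i I)"
    then obtain a b where ab: "ab = (a, b)" "a < b" "a \<in> insert i I" "b \<in> insert i I" by (auto simp: pairs_def)
    consider "a = i" "b \<in> I" | "b = i" "a \<in> I" | "a \<in> I" "b \<in> I" using ab by auto
    then show "ab \<in> m ` I \<union> pairs I"
    proof cases
      case 1
      then have "ab = m b" using ab by (simp add: m_def)
      then show ?thesis using 1 by blast
    next
      case 2
      then have "ab = m a" using ab by (simp add: m_def)
      then show ?thesis using 2 by blast
    qed (use ab in \<open>auto simp: pairs_def\<close>)
  next
    fix ab assume "ab \<in> m ` I \<union> pairs I"
    then show "ab \<in> pairs (insert i I)"
      using assms(2) by (auto simp: pairs_def m_def split: if_splits) (metis nat_neq_iff)+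
  qed
  have disj: "m ` I \<inter> pairs I = {}"
    using assms(2) unfolding pairs_def m_def by (auto split: if_splits)
  have inj: "inj_on m I" using assms(2) unfolding m_def inj_on_def by (auto split: if_splits)
  have "(\<Prod>(a, b)\<in>pairs (insert i I). F a b) = (\<Prod>(a, b)\<in>m ` I. F a b) * (\<Prod>(a, b)\<in>pairs I. F a b)"
    unfolding eq using assms(1) disj by (intro prod.union_disjoint) auto
  also have "(\<Prod>(a, b)\<in>m ` I. F a b) = (\<Prod>l\<in>I. F i l)"
    using inj by (subst prod.reindex) (auto simp: m_def sym intro!: prod.cong)
  finally show ?thesis .
qed

lemma weight_insert:
  assumes "finite I" "i \<notin> I"
  shows "weight (insert i I) c g x = \<bar>x i\<bar> powr (2 * c) *
    (\<Prod>l\<in>I. \<bar>(x i)\<^sup>2 - (x l)\<^sup>2\<bar> powr (2 * g)) * weight I c g x"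
  unfolding weight_def using assms
  by (subst prod_pairs_insert) (auto simp: abs_minus_commute)

lemma poly_bounded_weight [intro]:
  assumes "finite I" "0 \<le> c" "0 \<le> g"
  shows "poly_bounded I (weight I c g)"
proof -
  have "poly_bounded I (\<lambda>x. \<bar>x i\<bar> powr (2 * c))" if "i \<in> I" for i
    using assms that by auto
  moreover have "poly_bounded I (\<lambda>x. case ij of (i, j) \<Rightarrow> \<bar>(x i)\<^sup>2 - (x j)\<^sup>2\<bar> powr (2 * g))" if "ij \<in> pairs I" for ij
    using assms that unfolding pairs_def by (cases ij) (auto intro!: poly_bounded_powr poly_bounded_diff)
  ultimately show ?thesis unfolding weight_def[abs_def] by (intro poly_bounded_mult poly_bounded_prod) auto
qed

text \<open>The factor of the pair \<open>i\<close>, \<open>l\<close> is isolated; its exponent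
  \<open>2 * g\<close> is at least 2, so it absorbs the denominator.\<close>

lemma poly_bounded_weight_div:
  assumes "finite I" "0 \<le> c" "1 \<le> g" "i \<in> I" "l \<in> I" "i \<noteq> l"
  shows "poly_bounded I (\<lambda>x. weight I c g x / ((x i)\<^sup>2 - (x l)\<^sup>2))"
proof -
  define K where "K = I - {i} - {l}"
  have I: "I = insert i (insert l K)" "i \<notin> insert l K" "l \<notin> K" "finite K" "I - {i} = insert l K"
    using assms unfolding K_def by auto
  have b: "poly_bounded I (\<lambda>x. \<bar>(x a)\<^sup>2 - (x b)\<^sup>2\<bar> powr (2 * g))" if "a \<in> I" "b \<in> I" for a b
    using assms that by (auto intro!: poly_bounded_powr poly_bounded_diff)
  have w: "poly_bounded I (weight (I - {i}) c g)"
  proof -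
    have "poly_bounded I (\<lambda>x. \<bar>x j\<bar> powr (2 * c))" if "j \<in> I" for j
      using assms that by auto
    then show ?thesis using assms b unfolding weight_def[abs_def]
      by (intro poly_bounded_mult poly_bounded_prod) (auto simp: pairs_def)
  qed
  have "(\<lambda>x. weight I c g x / ((x i)\<^sup>2 - (x l)\<^sup>2)) =
    (\<lambda>x. \<bar>x i\<bar> powr (2 * c) * (\<bar>(x i)\<^sup>2 - (x l)\<^sup>2\<bar> powr (2 * g) / ((x i)\<^sup>2 - (x l)\<^sup>2)) *
      (\<Prod>l\<in>K. \<bar>(x i)\<^sup>2 - (x l)\<^sup>2\<bar> powr (2 * g)) * weight (I - {i}) c g x)"
  proof
    fix x
    have "weight I c g x = \<bar>x i\<bar> powr (2 * c) *
      (\<bar>(x i)\<^sup>2 - (x l)\<^sup>2\<bar> powr (2 * g) * (\<Prod>l\<in>K. \<bar>(x i)\<^sup>2 - (x l)\<^sup>2\<bar> powr (2 * g))) * weight (I - {i}) c g x"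
      using weight_insert[of "insert l K" i c g x] I by (simp add: prod.insert)
    then show "weight I c g x / ((x i)\<^sup>2 - (x l)\<^sup>2) =
      \<bar>x i\<bar> powr (2 * c) * (\<bar>(x i)\<^sup>2 - (x l)\<^sup>2\<bar> powr (2 * g) / ((x i)\<^sup>2 - (x l)\<^sup>2)) *
      (\<Prod>l\<in>K. \<bar>(x i)\<^sup>2 - (x l)\<^sup>2\<bar> powr (2 * g)) * weight (I - {i}) c g x" by simp
  qed
  moreover have "poly_bounded I (\<lambda>x. \<bar>x i\<bar> powr (2 * c))"
    using assms by (intro poly_bounded_powr poly_bounded_component) auto
  moreover have "poly_bounded I (\<lambda>x. \<bar>(x i)\<^sup>2 - (x l)\<^sup>2\<bar> powr (2 * g) / ((x i)\<^sup>2 - (x l)\<^sup>2))"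
  proof (rule poly_bounded_powr_div[OF assms(1)])
    show "poly_bounded I (\<lambda>x. (x i)\<^sup>2 - (x l)\<^sup>2)"
      by (intro poly_bounded_diff assms(1) poly_bounded_power poly_bounded_component assms)
  qed (use assms in auto)
  moreover have "poly_bounded I (\<lambda>x. \<Prod>l\<in>K. \<bar>(x i)\<^sup>2 - (x l)\<^sup>2\<bar> powr (2 * g))"
    by (rule poly_bounded_prod, rule b) (use assms in \<open>auto simp: K_def\<close>)
  ultimately have "poly_bounded I (\<lambda>x. weight I c g x / ((x i)\<^sup>2 - (x l)\<^sup>2)) \<longleftrightarrow> True"
    using poly_bounded_mult[OF poly_bounded_mult[OF poly_bounded_mult] w] by (simp only:)
  then show ?thesis by simp
qed

section \<open>One-variable calculus and integration by parts against the Gaussian density\<close>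

lemma has_real_derivative_abs_powr:
  fixes v r :: real
  assumes "1 < r"
  shows "((\<lambda>v. \<bar>v\<bar> powr r) has_real_derivative r * (\<bar>v\<bar> powr r / v)) (at v)"
proof (cases "v = 0")
  case True
  \<comment> \<open>At 0 the claimed derivative is \<open>r * (0 / 0) = 0\<close>, so the difference
    quotient, of size \<open>\<bar>h\<bar> powr (r - 1)\<close>, has to tend to 0.\<close>
  have "((\<lambda>h. \<bar>h\<bar> powr r / h) \<longlongrightarrow> 0) (at 0)"
  proof (rule tendsto_rabs_zero_cancel)
    have "((\<lambda>h::real. \<bar>h\<bar> powr (r - 1)) \<longlongrightarrow> \<bar>0\<bar> powr (r - 1)) (at 0)"
      using assms by (intro tendsto_powr2 tendsto_intros) auto
    moreover have "eventually (\<lambda>h. \<bar>h\<bar> powr (r - 1) = \<bar>\<bar>h\<bar> powr r / h\<bar>) (at (0::real))"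
      by (auto simp: eventually_at_filter powr_diff)
    ultimately show "((\<lambda>h. \<bar>\<bar>h\<bar> powr r / h\<bar>) \<longlongrightarrow> 0) (at 0)"
      using assms by (auto simp: filterlim_cong)
  qed
  then show ?thesis using True by (simp add: DERIV_def)
next
  case False
  then show ?thesis
  proof (cases "v > 0")
    case True
    have "((\<lambda>v. v powr r) has_real_derivative r * (\<bar>v\<bar> powr r / v)) (at v)"
      using True by (auto intro!: derivative_eq_intros simp: powr_diff)
    then show ?thesis
      by (rule DERIV_cong_ev[THEN iffD1, rotated -1])
         (use True in \<open>auto intro!: eventually_mono[OF eventually_nhds_in_open[of "{0<..}"]]\<close>)
  next
    case F: False
    have "((\<lambda>v. (-v) powr r) has_real_derivative r * (\<bar>v\<bar> powr r / v)) (at v)"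
      using F False by (auto intro!: derivative_eq_intros simp: powr_diff field_simps)
    then show ?thesis
      by (rule DERIV_cong_ev[THEN iffD1, rotated -1])
         (use F False in \<open>auto intro!: eventually_mono[OF eventually_nhds_in_open[of "{..<0}"]]\<close>)
  qed
qed

text \<open>At 0 this quotient is the difference quotient of \<open>\<bar>v\<bar> powr r\<close>, so
  its continuity there is the vanishing of that derivative.\<close>

lemma isCont_abs_powr_div:
  fixes v r :: real
  assumes "1 < r"
  shows "isCont (\<lambda>v. \<bar>v\<bar> powr r / v) v"
proof (cases "v = 0")
  case True
  have "((\<lambda>h. (\<bar>0 + h\<bar> powr r - \<bar>0\<bar> powr r) / h) \<longlongrightarrow> r * (\<bar>0\<bar> powr r / 0)) (at 0)"
    using has_real_derivative_abs_powr[OF assms, of 0] unfolding DERIV_def .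
  then show ?thesis using True by (simp add: isCont_def)
qed (auto intro!: continuous_intros)

text \<open>The function equals \<open>\<bar>v\<bar> powr (a + 2) / v\<close>, which gives the
  derivative away from 0; at 0 the difference quotient is
  \<open>\<bar>h\<bar> powr a\<close>.\<close>

lemma has_real_derivative_mult_abs_powr:
  fixes v a :: real
  assumes "0 < a"
  shows "((\<lambda>v. v * \<bar>v\<bar> powr a) has_real_derivative (1 + a) * \<bar>v\<bar> powr a) (at v)"
proof (cases "v = 0")
  case True
  have "((\<lambda>h::real. \<bar>h\<bar> powr a) \<longlongrightarrow> \<bar>0\<bar> powr a) (at 0)"
    using assms by (intro tendsto_powr2 tendsto_intros) auto
  moreover have "eventually (\<lambda>h. \<bar>h\<bar> powr a = h * \<bar>h\<bar> powr a / h) (at (0::real))"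
    by (auto simp: eventually_at_filter)
  ultimately have "((\<lambda>h. h * \<bar>h\<bar> powr a / h) \<longlongrightarrow> 0) (at 0)"
    using assms by (auto simp: filterlim_cong)
  then show ?thesis using True assms by (simp add: DERIV_def)
next
  case False
  have "((\<lambda>v. \<bar>v\<bar> powr (a + 2) / v) has_real_derivative
      ((a + 2) * (\<bar>v\<bar> powr (a+2) / v) * v - \<bar>v\<bar> powr (a + 2) * 1) / (v * v)) (at v)"
    using assms False by (intro DERIV_divide has_real_derivative_abs_powr DERIV_ident) auto
  moreover have "((a + 2) * (\<bar>v\<bar> powr (a+2) / v) * v - \<bar>v\<bar> powr (a + 2) * 1) / (v * v) = (1 + a) * \<bar>v\<bar> powr a"
    using False by (simp add: powr_add power2_eq_square field_simps)
  moreover have "(\<lambda>v::real. \<bar>v\<bar> powr (a + 2) / v) = (\<lambda>v. v * \<bar>v\<bar> powr a)"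
    using assms by (auto simp: fun_eq_iff powr_add power2_eq_square)
  ultimately show ?thesis by simp
qed

text \<open>A function of one variable is read as a function on the index set \<open>{0}\<close>,
  which makes the closure rules of \<open>poly_bounded\<close> available. The two limits provide the
  vanishing boundary terms at infinity.\<close>

lemma integrable_std_normal_poly_bounded:
  fixes h :: "real \<Rightarrow> real"
  assumes "poly_bounded {0} (\<lambda>x. h (x 0))"
  shows "integrable std_normal h" "integrable lborel (\<lambda>u. h u * std_normal_density u)"
    "((\<lambda>u. h u * std_normal_density u) \<longlongrightarrow> 0) at_top"
    "((\<lambda>u. h u * std_normal_density u) \<longlongrightarrow> 0) at_bot"
proof -
  from assms obtain C k where b: "\<And>x. \<bar>h (x 0)\<bar> \<le> C * (\<Prod>i\<in>{0}. 1 + (x (i::nat))\<^sup>2) ^ k"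
    and m: "(\<lambda>x. h (x 0)) \<in> borel_measurable (gauss {0})"
    unfolding poly_bounded_def by blast
  have b: "\<bar>h u\<bar> \<le> C * (1 + u\<^sup>2) ^ k" for u using b[of "\<lambda>_. u"] by simp
  have meas: "h \<in> borel_measurable borel"
  proof -
    have "(\<lambda>u. (\<lambda>i\<in>{0::nat}. u)) \<in> measurable std_normal (gauss {0})"
      unfolding gauss_def by (intro measurable_restrict) auto
    then have "(\<lambda>u. h ((\<lambda>i\<in>{0::nat}. u) 0)) \<in> borel_measurable std_normal"
      using m by (rule measurable_compose)
    then show ?thesis by (simp cong: measurable_cong_sets)
  qed
  have "integrable std_normal (\<lambda>u. C * (1 + u\<^sup>2) ^ k)"
    by (intro integrable_mult_right integrable_std_normal_even_power)
  then show "integrable std_normal h"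
  proof (rule Bochner_Integration.integrable_bound, goal_cases)
    case 1 show ?case using meas by (simp cong: measurable_cong_sets)
  next
    case 2 
    have "norm (h u) \<le> norm (C * (1 + u\<^sup>2) ^ k)" for u
      unfolding real_norm_def by (rule order_trans[OF b abs_ge_self])
    then show ?case by simp
  qed
  show "integrable lborel (\<lambda>u. h u * std_normal_density u)"
    using \<open>integrable std_normal h\<close> meas unfolding std_normal_def by (subst (asm) integrable_density) (auto simp: mult.commute)
  have z: "((\<lambda>u. \<bar>C\<bar> * ((1 + u\<^sup>2) ^ k * std_normal_density u)) \<longlongrightarrow> 0) at_top"
  proof -
    have "((\<lambda>u::real. (1 + u\<^sup>2) ^ k * exp (- u\<^sup>2 / 2)) \<longlongrightarrow> 0) at_top" by real_asymp
    then have "((\<lambda>u::real. \<bar>C\<bar> / sqrt (2 * pi) * ((1 + u\<^sup>2) ^ k * exp (- u\<^sup>2 / 2))) \<longlongrightarrow> 0) at_top"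
      by (rule tendsto_mult_right_zero)
    then show ?thesis by (simp add: std_normal_density_def mult_ac)
  qed
  have bb: "norm (h u * std_normal_density u) \<le> \<bar>C\<bar> * ((1 + u\<^sup>2) ^ k * std_normal_density u)" for u
  proof -
    have "\<bar>h u\<bar> * std_normal_density u \<le> (\<bar>C\<bar> * (1 + u\<^sup>2) ^ k) * std_normal_density u"
      by (intro mult_right_mono order_trans[OF b]) auto
    then show ?thesis by (simp add: abs_mult mult_ac)
  qed
  show "((\<lambda>u. h u * std_normal_density u) \<longlongrightarrow> 0) at_top"
    by (rule Lim_null_comparison[OF _ z]) (use bb in auto)
  have "((\<lambda>u. h (-u) * std_normal_density (-u)) \<longlongrightarrow> 0) at_top"
  proof (rule Lim_null_comparison[OF _ z])
    have "norm (h (-u) * std_normal_density (-u)) \<le> \<bar>C\<bar> * ((1 + u\<^sup>2) ^ k * std_normal_density u)" for u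
      using bb[of "-u"] by (simp add: std_normal_density_def)
    then show "\<forall>\<^sub>F u in at_top. norm (h (-u) * std_normal_density (-u)) \<le> \<bar>C\<bar> * ((1 + u\<^sup>2) ^ k * std_normal_density u)"
      by simp
  qed
  then show "((\<lambda>u. h u * std_normal_density u) \<longlongrightarrow> 0) at_bot"
    by (simp add: filterlim_at_bot_mirror)
qed

lemma has_derivative_std_normal_density:
  "(std_normal_density has_real_derivative - u * std_normal_density u) (at u)"
  unfolding std_normal_density_def[abs_def] by (auto intro!: derivative_eq_intros simp: field_simps)

context
  fixes L :: "nat set" and b :: "nat \<Rightarrow> real" and r :: real
  assumes L: "finite L" and r: "1 < r"
begin

private definition Q :: "real \<Rightarrow> real" where
  "Q u = (\<Prod>l\<in>L. \<bar>u\<^sup>2 - b l\<bar> powr r)"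

text \<open>The quotient of \<open>Q\<close> by \<open>u\<^sup>2 - b l\<close>, arranged so that it
  is visibly continuous at the zeros of the denominator.\<close>

private definition q :: "nat \<Rightarrow> real \<Rightarrow> real" where
  "q l u = \<bar>u\<^sup>2 - b l\<bar> powr r / (u\<^sup>2 - b l) * (\<Prod>m\<in>L-{l}. \<bar>u\<^sup>2 - b m\<bar> powr r)"

private lemma Q_div: "l \<in> L \<Longrightarrow> Q u / (u\<^sup>2 - b l) = q l u"
  unfolding Q_def q_def using L by (subst prod.remove[of L l]) auto

private lemma Q_deriv: "(Q has_real_derivative (\<Sum>l\<in>L. 2 * r * u * q l u)) (at u)"
proof -
  have 1: "((\<lambda>u. \<bar>u\<^sup>2 - b l\<bar> powr r) has_real_derivative
      r * (\<bar>u\<^sup>2 - b l\<bar> powr r / (u\<^sup>2 - b l)) * (2 * u)) (at u)" for l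
    by (rule DERIV_chain'[OF _ has_real_derivative_abs_powr[OF r]]) (auto intro!: derivative_eq_intros)
  have "(Q has_real_derivative (\<Sum>l\<in>L. r * (\<bar>u\<^sup>2 - b l\<bar> powr r / (u\<^sup>2 - b l)) * (2 * u) * (\<Prod>m\<in>L-{l}. \<bar>u\<^sup>2 - b m\<bar> powr r))) (at u)"
    unfolding Q_def[abs_def] by (rule has_field_derivative_prod) (use 1 in auto)
  then show ?thesis by (simp add: q_def mult_ac)
qed

private lemma abs_powr_cont: "isCont (\<lambda>u. \<bar>u\<^sup>2 - b l\<bar> powr r) u"
  by (rule isCont_o2[of _ "\<lambda>u. u\<^sup>2 - b l" "\<lambda>v. \<bar>v\<bar> powr r"])
     (auto intro!: continuous_intros DERIV_isCont[OF has_real_derivative_abs_powr] r)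

private lemma q_cont: "isCont (q l) u"
proof -
  have "isCont (\<lambda>u. \<bar>u\<^sup>2 - b l\<bar> powr r / (u\<^sup>2 - b l)) u"
    by (rule isCont_o2[of _ "\<lambda>u. u\<^sup>2 - b l" "\<lambda>v. \<bar>v\<bar> powr r / v"])
      (auto intro!: continuous_intros isCont_abs_powr_div r)
  then show ?thesis unfolding q_def[abs_def]
    by (intro isCont_mult continuous_prod abs_powr_cont) auto
qed

private lemma Q_cont: "isCont Q u"
  using Q_deriv by (rule DERIV_isCont)

private lemma sq_bounded: "poly_bounded {0} (\<lambda>x. (x 0)\<^sup>2 - b l)"
  by (intro poly_bounded_diff poly_bounded_power poly_bounded_component poly_bounded_const) auto

private lemma Q_bounded: "poly_bounded {0} (\<lambda>x. Q (x 0))"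
  unfolding Q_def using r by (intro poly_bounded_prod poly_bounded_powr sq_bounded) auto

private lemma q_bounded: "poly_bounded {0} (\<lambda>x. q l (x 0))"
  unfolding q_def using r
  by (intro poly_bounded_mult poly_bounded_prod poly_bounded_powr poly_bounded_powr_div sq_bounded) auto

text \<open>The integrand times the density is the derivative of
  \<open>u ^ (2 * k) * (u * \<bar>u\<bar> powr a) * Q u\<close> times the density, which vanishes at
  both ends of the line. The additional factor \<open>u\<close> keeps this differentiable at 0 for
  every \<open>a > 0\<close>.\<close>

lemma integral_by_parts_1d:
  fixes a :: real
  assumes a: "0 < a"
  shows "(\<integral>u. (real (2 * k) + 1 + a - u\<^sup>2 + 2 * r * (\<Sum>l\<in>L. u\<^sup>2 / (u\<^sup>2 - b l))) *
            (u ^ (2 * k) * \<bar>u\<bar> powr a * (\<Prod>l\<in>L. \<bar>u\<^sup>2 - b l\<bar> powr r)) \<partial>std_normal) = 0"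
proof -
  define G where "G u = u ^ (2 * k) * (u * \<bar>u\<bar> powr a) * Q u * std_normal_density u" for u
  define g where "g u = (real (2 * k) + 1 + a - u\<^sup>2) * (u ^ (2 * k) * \<bar>u\<bar> powr a * Q u)
      + 2 * r * (\<Sum>l\<in>L. u ^ (2 * k) * \<bar>u\<bar> powr a * u\<^sup>2 * q l u)" for u
  have comp: "poly_bounded {0} (\<lambda>x. x 0)" by auto
  have gb: "poly_bounded {0} (\<lambda>x. g (x 0))"
    unfolding g_def using a
    by (intro poly_bounded_add poly_bounded_mult poly_bounded_sum poly_bounded_diff poly_bounded_const
        poly_bounded_power[OF comp] poly_bounded_powr comp Q_bounded q_bounded) auto
  have Gb: "poly_bounded {0} (\<lambda>x. x 0 ^ (2 * k) * (x 0 * \<bar>x 0\<bar> powr a) * Q (x 0))"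
    using a
    by (intro poly_bounded_add poly_bounded_mult 
        poly_bounded_power[OF comp] poly_bounded_powr comp Q_bounded) auto
  have deriv: "(G has_real_derivative g u * std_normal_density u) (at u)" for u
  proof -
    define S where "S = (\<Sum>l\<in>L. 2 * r * u * q l u)"
    have S: "u * S = 2 * r * (\<Sum>l\<in>L. u\<^sup>2 * q l u)"
      unfolding S_def by (simp add: sum_distrib_left mult_ac power2_eq_square)
    have gS: "g u = (real (2 * k) + 1 + a - u\<^sup>2) * (u ^ (2 * k) * \<bar>u\<bar> powr a * Q u) + u ^ (2 * k) * \<bar>u\<bar> powr a * (u * S)"
      unfolding g_def S by (simp add: sum_distrib_left mult_ac)
    \<comment> \<open>For \<open>k = 0\<close> the truncated exponent \<open>2 * k - 1\<close> is
      wrong, but its coefficient is 0.\<close>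
    have pw: "real (2 * k) * u ^ (2 * k - 1) * u = real (2 * k) * u ^ (2 * k)"
      by (cases k) auto
    have "(G has_real_derivative
       ((real (2 * k) * u ^ (2 * k - 1) * (u * \<bar>u\<bar> powr a) + u ^ (2 * k) * ((1 + a) * \<bar>u\<bar> powr a)) * Q u
         + u ^ (2 * k) * (u * \<bar>u\<bar> powr a) * S) * std_normal_density u
         + u ^ (2 * k) * (u * \<bar>u\<bar> powr a) * Q u * (- u * std_normal_density u)) (at u)"
      unfolding G_def
      apply (rule DERIV_cong[OF DERIV_mult[OF DERIV_mult[OF DERIV_mult[OF DERIV_pow[of "2*k"] has_real_derivative_mult_abs_powr[OF a]] Q_deriv] has_derivative_std_normal_density]])
      by (simp add: S_def algebra_simps)
    also have "((real (2 * k) * u ^ (2 * k - 1) * (u * \<bar>u\<bar> powr a) + u ^ (2 * k) * ((1 + a) * \<bar>u\<bar> powr a)) * Q u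
         + u ^ (2 * k) * (u * \<bar>u\<bar> powr a) * S) * std_normal_density u
         + u ^ (2 * k) * (u * \<bar>u\<bar> powr a) * Q u * (- u * std_normal_density u)
       = ((real (2 * k) * u ^ (2 * k - 1) * u) * \<bar>u\<bar> powr a * Q u + u ^ (2 * k) * ((1 + a) * \<bar>u\<bar> powr a) * Q u
         + u ^ (2 * k) * (u * \<bar>u\<bar> powr a) * S - u ^ (2 * k) * u\<^sup>2 * \<bar>u\<bar> powr a * Q u) * std_normal_density u"
      by (simp add: algebra_simps power2_eq_square)
    also have "\<dots> = g u * std_normal_density u"
      unfolding gS pw by (simp add: algebra_simps)
    finally show ?thesis .
  qed
  have cont: "isCont (\<lambda>u. g u * std_normal_density u) u" for u
  proof -
    have 1: "isCont (\<lambda>u. \<bar>u\<bar> powr a) u"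
      unfolding isCont_def using a by (intro tendsto_powr2 tendsto_intros) auto
    have 2: "isCont std_normal_density u"
      using has_derivative_std_normal_density by (rule DERIV_isCont)
    show ?thesis unfolding g_def
      by (intro continuous_intros 1 2 Q_cont q_cont)
  qed
  have "(LBINT u=-\<infinity>..\<infinity>. g u * std_normal_density u) = 0 - 0"
  proof (rule interval_integral_FTC_integrable)
    show "set_integrable lborel (einterval (-\<infinity>) \<infinity>) (\<lambda>u. g u * std_normal_density u)"
      using integrable_std_normal_poly_bounded(2)[OF gb] by (simp add: set_integrable_def einterval_def)
    show "((G \<circ> real_of_ereal) \<longlongrightarrow> 0) (at_right (-\<infinity>))"
      using integrable_std_normal_poly_bounded(4)[OF Gb] by (simp add: ereal_tendsto_simps1 G_def[abs_def])
    show "((G \<circ> real_of_ereal) \<longlongrightarrow> 0) (at_left \<infinity>)"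
      using integrable_std_normal_poly_bounded(3)[OF Gb] by (simp add: ereal_tendsto_simps1 G_def[abs_def])
  qed (use deriv cont in \<open>auto simp: has_real_derivative_iff_has_vector_derivative\<close>)
  then have "(\<integral>u. std_normal_density u * g u \<partial>lborel) = 0"
    by (simp add: interval_lebesgue_integral_def set_lebesgue_integral_def einterval_def mult.commute)
  moreover have "g \<in> borel_measurable borel"
    using integrable_std_normal_poly_bounded(1)[OF gb] by (simp add: integrable_iff_bounded cong: measurable_cong_sets)
  ultimately have "(\<integral>u. g u \<partial>std_normal) = 0"
    unfolding std_normal_def by (subst integral_density) auto
  moreover have "g u = (real (2 * k) + 1 + a - u\<^sup>2 + 2 * r * (\<Sum>l\<in>L. u\<^sup>2 / (u\<^sup>2 - b l))) *
            (u ^ (2 * k) * \<bar>u\<bar> powr a * (\<Prod>l\<in>L. \<bar>u\<^sup>2 - b l\<bar> powr r))" for u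
    unfolding g_def Q_def[symmetric] distrib_right
    by (simp add: sum_distrib_right sum_distrib_left Q_div[symmetric] mult_ac)
  ultimately show ?thesis by simp
qed

text \<open>Here the integrand is the sign of \<open>u\<close> times a derivative, so each half-line
  is integrated separately. Both contribute the value at 0, in total \<open>- 2 * G 0\<close>, and
  \<open>2 / sqrt (2 * pi) = sqrt (2 / pi)\<close>.\<close>

lemma integral_boundary_1d:
  assumes b: "\<And>l. l \<in> L \<Longrightarrow> 0 \<le> b l"
  shows "(\<integral>u. (- 1 + 2 * r * (\<Sum>l\<in>L. 1 / (u\<^sup>2 - b l))) * (\<bar>u\<bar> * (\<Prod>l\<in>L. \<bar>u\<^sup>2 - b l\<bar> powr r)) \<partial>std_normal)
     = - (sqrt (2 / pi) * (\<Prod>l\<in>L. b l powr r))"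
proof -
  define G where "G u = Q u * std_normal_density u" for u
  define h where "h u = - u * Q u + 2 * r * (\<Sum>l\<in>L. u * q l u)" for u
  have comp: "poly_bounded {0} (\<lambda>x. x 0)" by auto
  have hb: "poly_bounded {0} (\<lambda>x. h (x 0))"
  proof -
    have "poly_bounded {0} (\<lambda>x. (- 1) * (x 0 * Q (x 0)) + 2 * r * (\<Sum>l\<in>L. x 0 * q l (x 0)))"
      by (intro poly_bounded_add poly_bounded_mult poly_bounded_sum poly_bounded_const comp Q_bounded q_bounded) auto
    then show ?thesis by (simp add: h_def)
  qed
  have deriv: "(G has_real_derivative h u * std_normal_density u) (at u)" for u
    unfolding G_def
    apply (rule DERIV_cong[OF DERIV_mult[OF Q_deriv has_derivative_std_normal_density]])
    by (simp add: h_def algebra_simps sum_distrib_left)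
  have cont: "isCont (\<lambda>u. h u * std_normal_density u) u" for u
  proof -
    have 2: "isCont std_normal_density u"
      using has_derivative_std_normal_density by (rule DERIV_isCont)
    show ?thesis unfolding h_def
      by (intro continuous_intros 2 Q_cont q_cont)
  qed
  have Gc: "isCont G 0" using deriv by (rule DERIV_isCont)
  have int: "integrable lborel (\<lambda>u. h u * std_normal_density u)"
    by (rule integrable_std_normal_poly_bounded(2)[OF hb])
  have si: "set_integrable lborel A (\<lambda>u. h u * std_normal_density u)" if "A \<in> sets borel" for A
    using integrable_mult_indicator[of A lborel, OF _ int] that by (simp add: set_integrable_def)
  have A: "(LBINT u=0..\<infinity>. h u * std_normal_density u) = 0 - G 0"
  proof (rule interval_integral_FTC_integrable)
    show "((G \<circ> real_of_ereal) \<longlongrightarrow> G 0) (at_right 0)"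
      unfolding zero_ereal_def ereal_tendsto_simps1
      using Gc by (auto simp: isCont_def intro: filterlim_mono at_le)
    show "((G \<circ> real_of_ereal) \<longlongrightarrow> 0) (at_left \<infinity>)"
      using integrable_std_normal_poly_bounded(3)[OF Q_bounded] by (simp add: ereal_tendsto_simps1 G_def[abs_def])
  qed (use deriv cont si in \<open>auto simp: has_real_derivative_iff_has_vector_derivative einterval_def\<close>)
  have B: "(LBINT u=-\<infinity>..0. h u * std_normal_density u) = G 0 - 0"
  proof (rule interval_integral_FTC_integrable)
    show "((G \<circ> real_of_ereal) \<longlongrightarrow> G 0) (at_left 0)"
      unfolding zero_ereal_def ereal_tendsto_simps1
      using Gc by (auto simp: isCont_def intro: filterlim_mono at_le)
    show "((G \<circ> real_of_ereal) \<longlongrightarrow> 0) (at_right (-\<infinity>))"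
      using integrable_std_normal_poly_bounded(4)[OF Q_bounded] by (simp add: ereal_tendsto_simps1 G_def[abs_def])
  qed (use deriv cont si in \<open>auto simp: has_real_derivative_iff_has_vector_derivative einterval_def\<close>)
  have e: "einterval 0 \<infinity> = {0::real<..}" "einterval (-\<infinity>) 0 = {..<0::real}"
    by (auto simp: einterval_def)
  have sgn: "sgn u * (h u * std_normal_density u) =
     indicator {0<..} u *\<^sub>R (h u * std_normal_density u) - indicator {..<0} u *\<^sub>R (h u * std_normal_density u)" for u :: real
    by (auto simp: sgn_real_def)
  have "(\<integral>u. sgn u * (h u * std_normal_density u) \<partial>lborel) =
     (\<integral>u. indicator {0<..} u *\<^sub>R (h u * std_normal_density u) \<partial>lborel) - (\<integral>u. indicator {..<0} u *\<^sub>R (h u * std_normal_density u) \<partial>lborel)"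
    unfolding sgn using si by (intro Bochner_Integration.integral_diff) (auto simp: set_integrable_def)
  also have "\<dots> = - 2 * G 0"
    using A B by (simp add: interval_lebesgue_integral_def set_lebesgue_integral_def e)
  finally have *: "(\<integral>u. std_normal_density u * (sgn u * h u) \<partial>lborel) = - 2 * G 0"
    by (simp add: mult_ac)
  have "h \<in> borel_measurable borel"
    using integrable_std_normal_poly_bounded(1)[OF hb] by (simp add: integrable_iff_bounded cong: measurable_cong_sets)
  then have "(\<integral>u. sgn u * h u \<partial>std_normal) = - 2 * G 0"
    unfolding std_normal_def using * by (subst integral_density) auto
  moreover have "sgn u * h u = (- 1 + 2 * r * (\<Sum>l\<in>L. 1 / (u\<^sup>2 - b l))) * (\<bar>u\<bar> * (\<Prod>l\<in>L. \<bar>u\<^sup>2 - b l\<bar> powr r))" for u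
    unfolding h_def Q_def[symmetric] distrib_right
    by (simp add: sum_distrib_right sum_distrib_left Q_div[symmetric] mult_ac abs_sgn algebra_simps)
  moreover have "2 * G 0 = sqrt (2 / pi) * (\<Prod>l\<in>L. b l powr r)"
  proof -
    have "Q 0 = (\<Prod>l\<in>L. b l powr r)" unfolding Q_def using b by (intro prod.cong) auto
    moreover have "2 * (1 / sqrt (2 * pi)) = sqrt (2 / pi)"
      by (simp add: real_sqrt_mult real_sqrt_divide field_simps)
    moreover have "2 * G 0 = 2 * (1 / sqrt (2 * pi)) * Q 0"
      by (simp add: G_def std_normal_density_def)
    ultimately show ?thesis by (simp only:)
  qed
  ultimately show ?thesis by simp
qed

end

section \<open>Integration by parts in one of several variables\<close>

definition sqmonom :: "nat set \<Rightarrow> (nat \<Rightarrow> nat) \<Rightarrow> (nat \<Rightarrow> real) \<Rightarrow> real" where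
  "sqmonom I \<nu> x = (\<Prod>i\<in>I. (x i) ^ (2 * \<nu> i))"

definition wint :: "nat set \<Rightarrow> real \<Rightarrow> real \<Rightarrow> ((nat \<Rightarrow> real) \<Rightarrow> real) \<Rightarrow> real" where
  "wint I c g h = (\<integral>x. h x * weight I c g x \<partial>gauss I)"

lemma poly_bounded_sqmonom [intro]: "finite I \<Longrightarrow> poly_bounded I (sqmonom I \<nu>)"
  unfolding sqmonom_def[abs_def] by (intro poly_bounded_prod poly_bounded_power poly_bounded_component)

lemma integrable_wint:
  assumes "finite I" "0 \<le> c" "0 \<le> g" "poly_bounded I h"
  shows "integrable (gauss I) (\<lambda>x. h x * weight I c g x)"
  by (intro poly_bounded_integrable assms poly_bounded_mult poly_bounded_weight)

lemma integrable_wint_div: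
  assumes "finite I" "0 \<le> c" "1 \<le> g" "poly_bounded I h" "i \<in> I" "l \<in> I" "i \<noteq> l"
  shows "integrable (gauss I) (\<lambda>x. h x / ((x i)\<^sup>2 - (x l)\<^sup>2) * weight I c g x)"
  using poly_bounded_integrable[OF assms(1) poly_bounded_mult[OF assms(4) poly_bounded_weight_div[of I c g i l]]] assms
  by (simp add: mult_ac)

lemma gauss_integral_insert:
  fixes f :: "(nat \<Rightarrow> real) \<Rightarrow> real"
  assumes "finite I" "i \<notin> I" "integrable (gauss (insert i I)) f"
  shows "(\<integral>x. f x \<partial>gauss (insert i I)) = (\<integral>x. (\<integral>u. f (x(i := u)) \<partial>std_normal) \<partial>gauss I)"
  using gaussS.product_integral_insert[OF assms(1,2)] assms(3) unfolding gauss_def by blast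

lemma weight_upd: "i \<notin> I \<Longrightarrow> weight I c g (x(i := u)) = weight I c g x"
  unfolding weight_def by (intro arg_cong2[where f="(*)"] prod.cong) (auto simp: pairs_def)

text \<open>Fubini with \<open>x i\<close> innermost: for fixed other coordinates the inner integral
  vanishes by the one-variable identity with \<open>a = 2 * c\<close>, \<open>r = 2 * g\<close> and
  \<open>b l = (x l)\<^sup>2\<close>.\<close>

lemma wint_by_parts:
  assumes I: "finite I" "i \<in> I" and c: "0 < c" and g: "1 \<le> g"
  shows "wint I c g (\<lambda>x. (x i)\<^sup>2 * sqmonom I \<nu> x) =
    wint I c g (\<lambda>x. (2 * real (\<nu> i) + 1 + 2 * c) * sqmonom I \<nu> x) +
    4 * g * (\<Sum>l\<in>I-{i}. wint I c g (\<lambda>x. (x i)\<^sup>2 * sqmonom I \<nu> x / ((x i)\<^sup>2 - (x l)\<^sup>2)))"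
proof -
  define K where "K = I - {i}"
  have K: "I = insert i K" "i \<notin> K" "finite K" using I by (auto simp: K_def)
  have sq: "poly_bounded I (\<lambda>x. (x i)\<^sup>2 * sqmonom I \<nu> x)"
    using I by (intro poly_bounded_mult poly_bounded_power poly_bounded_component poly_bounded_sqmonom)
  have int: "integrable (gauss I) (\<lambda>x. (x i)\<^sup>2 * sqmonom I \<nu> x * weight I c g x)"
      "integrable (gauss I) (\<lambda>x. (2 * real (\<nu> i) + 1 + 2 * c) * sqmonom I \<nu> x * weight I c g x)"
      "\<And>l. l \<in> K \<Longrightarrow> integrable (gauss I) (\<lambda>x. (x i)\<^sup>2 * sqmonom I \<nu> x / ((x i)\<^sup>2 - (x l)\<^sup>2) * weight I c g x)"
    using I c g by (intro integrable_wint integrable_wint_div sq; auto simp: K_def)+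
  define Z where "Z x = (2 * real (\<nu> i) + 1 + 2 * c) * sqmonom I \<nu> x * weight I c g x
      - (x i)\<^sup>2 * sqmonom I \<nu> x * weight I c g x
      + 4 * g * (\<Sum>l\<in>K. (x i)\<^sup>2 * sqmonom I \<nu> x / ((x i)\<^sup>2 - (x l)\<^sup>2) * weight I c g x)" for x
  have intZ: "integrable (gauss I) Z"
    unfolding Z_def using int by (intro Bochner_Integration.integrable_add Bochner_Integration.integrable_diff
        integrable_mult_right Bochner_Integration.integrable_sum) auto
  have split: "(\<integral>x. Z x \<partial>gauss I) = (\<integral>x. (\<integral>u. Z (x(i := u)) \<partial>std_normal) \<partial>gauss K)"
    using gauss_integral_insert[OF K(3,2), of Z] intZ K(1) by simp
  have "(\<integral>u. Z (x(i := u)) \<partial>std_normal) = 0" for x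
  proof -
    define R where "R = sqmonom K \<nu> x * weight K c g x"
    have "Z (x(i := u)) = R * ((real (2 * \<nu> i) + 1 + 2 * c - u\<^sup>2 + 2 * (2 * g) * (\<Sum>l\<in>K. u\<^sup>2 / (u\<^sup>2 - (x l)\<^sup>2))) *
            (u ^ (2 * \<nu> i) * \<bar>u\<bar> powr (2 * c) * (\<Prod>l\<in>K. \<bar>u\<^sup>2 - (x l)\<^sup>2\<bar> powr (2 * g))))" for u
    proof -
      have "weight I c g (x(i := u)) = \<bar>u\<bar> powr (2 * c) * (\<Prod>l\<in>K. \<bar>u\<^sup>2 - (x l)\<^sup>2\<bar> powr (2 * g)) * weight K c g x"
        unfolding K(1) weight_insert[OF K(3,2)] weight_upd[OF K(2)] using K(2) by (auto intro!: prod.cong)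
      moreover have "sqmonom I \<nu> (x(i := u)) = u ^ (2 * \<nu> i) * sqmonom K \<nu> x"
      proof -
        have "(\<Prod>j\<in>K. (x(i := u)) j ^ (2 * \<nu> j)) = (\<Prod>j\<in>K. x j ^ (2 * \<nu> j))"
          using K(2) by (intro prod.cong) auto
        then show ?thesis unfolding sqmonom_def K(1) using K(2,3) by simp
      qed
      moreover have "(\<Sum>l\<in>K. ((x(i := u)) i)\<^sup>2 * sqmonom I \<nu> (x(i := u)) / (((x(i := u)) i)\<^sup>2 - ((x(i := u)) l)\<^sup>2) * weight I c g (x(i := u)))
        = sqmonom I \<nu> (x(i := u)) * weight I c g (x(i := u)) * (\<Sum>l\<in>K. u\<^sup>2 / (u\<^sup>2 - (x l)\<^sup>2))"
        unfolding sum_distrib_left using K(2) by (intro sum.cong) auto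
      ultimately show ?thesis unfolding Z_def R_def by (simp add: algebra_simps)
    qed
    then show ?thesis
      using integral_by_parts_1d[OF K(3), of "2 * g" "2 * c" "\<nu> i" "\<lambda>l. (x l)\<^sup>2"] c g by simp
  qed
  with split have "(\<integral>x. Z x \<partial>gauss I) = 0" by (simp only: Bochner_Integration.integral_zero)
  moreover have "(\<integral>x. Z x \<partial>gauss I) = wint I c g (\<lambda>x. (2 * real (\<nu> i) + 1 + 2 * c) * sqmonom I \<nu> x)
     - wint I c g (\<lambda>x. (x i)\<^sup>2 * sqmonom I \<nu> x)
     + 4 * g * (\<Sum>l\<in>K. wint I c g (\<lambda>x. (x i)\<^sup>2 * sqmonom I \<nu> x / ((x i)\<^sup>2 - (x l)\<^sup>2)))"
    unfolding Z_def wint_def using int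
    by (subst Bochner_Integration.integral_add Bochner_Integration.integral_diff Bochner_Integration.integral_sum;
       (intro Bochner_Integration.integrable_diff integrable_mult_right Bochner_Integration.integrable_sum)?; simp)+
  ultimately show ?thesis by (simp add: K_def)
qed

text \<open>At \<open>x i = 0\<close> the factors
  \<open>\<bar>(x i)\<^sup>2 - (x l)\<^sup>2\<bar> powr (2 * g)\<close> become
  \<open>\<bar>x l\<bar> powr (4 * g)\<close>. Together with \<open>\<bar>x l\<bar>\<close> from
  \<open>c = 1/2\<close> this is the weight with exponent \<open>2 * g + 1/2\<close>. Since
  \<open>h\<close> does not depend on \<open>x i\<close>, it passes through the inner
  integral.\<close>

lemma wint_boundary:
  assumes I: "finite I" "i \<notin> I" and g: "1 \<le> g"
    and h: "poly_bounded (insert i I) h" "\<And>x u. h (x(i := u)) = h x"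
  shows "wint (insert i I) (1/2) g h = sqrt (2 / pi) * wint I (2 * g + 1/2) g h
    + 4 * g * (\<Sum>l\<in>I. wint (insert i I) (1/2) g (\<lambda>x. h x / ((x i)\<^sup>2 - (x l)\<^sup>2)))"
proof -
  let ?J = "insert i I"
  have int: "integrable (gauss ?J) (\<lambda>x. h x * weight ?J (1/2) g x)"
      "\<And>l. l \<in> I \<Longrightarrow> integrable (gauss ?J) (\<lambda>x. h x / ((x i)\<^sup>2 - (x l)\<^sup>2) * weight ?J (1/2) g x)"
    using I g by (intro integrable_wint integrable_wint_div h; auto)+
  define Z where "Z x = - (h x * weight ?J (1/2) g x)
      + 4 * g * (\<Sum>l\<in>I. h x / ((x i)\<^sup>2 - (x l)\<^sup>2) * weight ?J (1/2) g x)" for x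
  have intZ: "integrable (gauss ?J) Z"
    unfolding Z_def using int by (intro Bochner_Integration.integrable_add Bochner_Integration.integrable_minus
        integrable_mult_right Bochner_Integration.integrable_sum) auto
  have split: "(\<integral>x. Z x \<partial>gauss ?J) = (\<integral>x. (\<integral>u. Z (x(i := u)) \<partial>std_normal) \<partial>gauss I)"
    by (rule gauss_integral_insert[OF I intZ])
  have "(\<integral>u. Z (x(i := u)) \<partial>std_normal) = - (sqrt (2 / pi) * (h x * weight I (2 * g + 1/2) g x))" for x
  proof -
    define R where "R = h x * weight I (1/2) g x"
    have "Z (x(i := u)) = R * ((- 1 + 2 * (2 * g) * (\<Sum>l\<in>I. 1 / (u\<^sup>2 - (x l)\<^sup>2))) *
            (\<bar>u\<bar> * (\<Prod>l\<in>I. \<bar>u\<^sup>2 - (x l)\<^sup>2\<bar> powr (2 * g))))" for u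
    proof -
      have "weight ?J (1/2) g (x(i := u)) = \<bar>u\<bar> * (\<Prod>l\<in>I. \<bar>u\<^sup>2 - (x l)\<^sup>2\<bar> powr (2 * g)) * weight I (1/2) g x"
        unfolding weight_insert[OF I] weight_upd[OF I(2)] using I(2) by (auto intro!: prod.cong)
      moreover have "(\<Sum>l\<in>I. h (x(i := u)) / (((x(i := u)) i)\<^sup>2 - ((x(i := u)) l)\<^sup>2) * weight ?J (1/2) g (x(i := u)))
        = h x * weight ?J (1/2) g (x(i := u)) * (\<Sum>l\<in>I. 1 / (u\<^sup>2 - (x l)\<^sup>2))"
        unfolding sum_distrib_left h using I(2) by (intro sum.cong) auto
      ultimately show ?thesis unfolding Z_def R_def h by (simp add: algebra_simps)
    qed
    then have "(\<integral>u. Z (x(i := u)) \<partial>std_normal) = R * (- (sqrt (2 / pi) * (\<Prod>l\<in>I. (x l)\<^sup>2 powr (2 * g))))"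
      using integral_boundary_1d[OF I(1), of "2 * g" "\<lambda>l. (x l)\<^sup>2"] g by simp
    then have "(\<integral>u. Z (x(i := u)) \<partial>std_normal) = - (sqrt (2 / pi) * (h x * (weight I (1/2) g x * (\<Prod>l\<in>I. (x l)\<^sup>2 powr (2 * g)))))"
      by (simp add: R_def)
    also have "weight I (1/2) g x * (\<Prod>l\<in>I. (x l)\<^sup>2 powr (2 * g)) = weight I (2 * g + 1/2) g x"
    proof -
      have "\<bar>v\<bar> powr (2 * (1/2)) * v\<^sup>2 powr (2 * g) = \<bar>v\<bar> powr (2 * (2 * g + 1/2))" for v :: real
      proof (cases "v = 0")
        case False
        then have "v\<^sup>2 = \<bar>v\<bar> powr 2" by simp
        then have "v\<^sup>2 powr (2 * g) = \<bar>v\<bar> powr (2 * (2 * g))" by (simp only: powr_powr)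
        then show ?thesis using False by (simp add: powr_add distrib_left)
      qed simp
      then show ?thesis unfolding weight_def by (simp add: prod.distrib[symmetric] mult_ac)
    qed
    finally show ?thesis .
  qed
  with split have "(\<integral>x. Z x \<partial>gauss ?J) = - (sqrt (2 / pi) * wint I (2 * g + 1/2) g h)"
    by (simp only: wint_def Bochner_Integration.integral_minus integral_mult_right_zero)
  moreover have "(\<integral>x. Z x \<partial>gauss ?J) = - wint ?J (1/2) g h
     + 4 * g * (\<Sum>l\<in>I. wint ?J (1/2) g (\<lambda>x. h x / ((x i)\<^sup>2 - (x l)\<^sup>2)))"
    unfolding Z_def wint_def using int
    by (subst Bochner_Integration.integral_add Bochner_Integration.integral_minus Bochner_Integration.integral_sum;
       (intro Bochner_Integration.integrable_minus integrable_mult_right Bochner_Integration.integrable_sum)?; simp)+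
  ultimately show ?thesis by simp
qed

lemma weight_swap:
  assumes I: "finite I" and "i \<in> I" "l \<in> I"
  shows "weight I c g (x \<circ> swp i l) = weight I c g x"
proof (cases "i = l")
  case False
  define K where "K = I - {i} - {l}"
  have K: "I = insert i (insert l K)" "i \<notin> insert l K" "l \<notin> K" "finite K"
    using assms False unfolding K_def by auto
  have w: "weight K c g (x \<circ> swp i l) = weight K c g x"
    unfolding weight_def using K by (intro arg_cong2[where f="(*)"] prod.cong) (auto simp: pairs_def Transposition.transpose_def)
  have e: "(\<Prod>l\<in>insert l K. F l) = F l * (\<Prod>l\<in>K. F l)" for F :: "nat \<Rightarrow> real"
    using K by simp
  have f: "finite (insert l K)" using K by simp
  have p: "(\<Prod>m\<in>K. \<bar>a - ((x \<circ> swp i l) m)\<^sup>2\<bar> powr (2 * g)) = (\<Prod>m\<in>K. \<bar>a - (x m)\<^sup>2\<bar> powr (2 * g))" for a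
    using K by (intro prod.cong) (auto simp: Transposition.transpose_def)
  show ?thesis
    unfolding K(1) weight_insert[OF f K(2)] weight_insert[OF K(4,3)] w e p
    by (simp add: abs_minus_commute mult_ac)
qed (simp add: Transposition.transpose_def)

lemma wint_swap:
  assumes I: "finite I" "i \<in> I" "l \<in> I" and h: "h \<in> borel_measurable (gauss I)"
  shows "wint I c g (\<lambda>x. h (x \<circ> swp i l)) = wint I c g h"
proof -
  have "weight I c g \<in> borel_measurable (gauss I)"
    unfolding weight_def[abs_def]
    by (intro borel_measurable_times borel_measurable_prod) (auto simp: pairs_def)
  then have "(\<lambda>x. h x * weight I c g x) \<in> borel_measurable (gauss I)" using h by simp
  from gauss_integral_swap[OF I(2,3) this] show ?thesis
    unfolding wint_def using weight_swap[OF I] by simp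
qed

section \<open>Polynomials in the squared coordinates\<close>

text \<open>A span of monomial functions as an inductive predicate: linear statements follow by
  induction over the sum, without coefficients and without uniqueness of the representation.\<close>

inductive pspan :: "nat set \<Rightarrow> (nat \<Rightarrow> nat) set \<Rightarrow> ((nat \<Rightarrow> real) \<Rightarrow> real) \<Rightarrow> bool" for I K where
  zero: "pspan I K (\<lambda>x. 0)"
| add: "\<nu> \<in> K \<Longrightarrow> pspan I K g \<Longrightarrow> pspan I K (\<lambda>x. a * sqmonom I \<nu> x + g x)"

lemma pspan_add: "pspan I K g \<Longrightarrow> pspan I K h \<Longrightarrow> pspan I K (\<lambda>x. g x + h x)"
proof (induction rule: pspan.induct)
  case (add \<nu> g a)
  have "pspan I K (\<lambda>x. a * sqmonom I \<nu> x + (g x + h x))"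
    using add by (intro pspan.add) auto
  then show ?case by (simp add: add.assoc)
qed simp

lemma pspan_cmult: "pspan I K g \<Longrightarrow> pspan I K (\<lambda>x. b * g x)"
proof (induction rule: pspan.induct)
  case (add \<nu> g a)
  have "pspan I K (\<lambda>x. (b * a) * sqmonom I \<nu> x + b * g x)"
    using add by (intro pspan.add) auto
  then show ?case by (simp add: algebra_simps)
qed (simp add: pspan.zero)

lemma pspan_diff: "pspan I K g \<Longrightarrow> pspan I K h \<Longrightarrow> pspan I K (\<lambda>x. g x - h x)"
  using pspan_add[of I K g "\<lambda>x. (-1) * h x"] pspan_cmult[of I K h "-1"] by simp

lemma pspan_sqmonom: "\<nu> \<in> K \<Longrightarrow> pspan I K (sqmonom I \<nu>)"
  using pspan.add[OF _ pspan.zero, of \<nu> K I 1] by simp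

lemma pspan_sum: "(\<And>j. j \<in> J \<Longrightarrow> pspan I K (g j)) \<Longrightarrow> pspan I K (\<lambda>x. \<Sum>j\<in>J. g j x)"
  by (induction J rule: infinite_finite_induct) (auto intro: pspan.zero pspan_add)

lemma pspan_subset: "pspan I K g \<Longrightarrow> K \<subseteq> K' \<Longrightarrow> pspan I K' g"
  by (induction rule: pspan.induct) (auto intro: pspan.intros)

lemma pspan_poly_bounded: "finite I \<Longrightarrow> pspan I K g \<Longrightarrow> poly_bounded I g"
  by (rotate_tac 1, induction rule: pspan.induct)
     (auto intro!: poly_bounded_const poly_bounded_add poly_bounded_cmult poly_bounded_sqmonom)

lemma sqmonom_mult: "sqmonom I \<nu> x * sqmonom I \<rho> x = sqmonom I (\<lambda>j. \<nu> j + \<rho> j) x"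
  unfolding sqmonom_def by (simp add: prod.distrib[symmetric] power_add[symmetric] distrib_left)

lemma sqmonom_swap:
  assumes "i \<in> I" "l \<in> I"
  shows "sqmonom I \<nu> (x \<circ> swp i l) = sqmonom I (\<nu> \<circ> swp i l) x"
proof -
  let ?s = "swp i l"
  have "bij_betw ?s I I"
    using assms by (intro bij_betwI[of _ _ _ ?s]) (auto simp: Transposition.transpose_def)
  then have "(\<Prod>j\<in>I. x (?s j) ^ (2 * \<nu> (?s (?s j)))) = (\<Prod>j\<in>I. x j ^ (2 * \<nu> (?s j)))"
    by (rule prod.reindex_bij_betw)
  then show ?thesis by (simp add: sqmonom_def)
qed

lemma sqmonom_two:
  assumes "finite I" "i \<in> I" "l \<in> I" "i \<noteq> l"
  shows "sqmonom I \<nu> x = ((x i)\<^sup>2) ^ \<nu> i * ((x l)\<^sup>2) ^ \<nu> l * (\<Prod>j\<in>I-{i}-{l}. x j ^ (2 * \<nu> j))"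
  using assms by (simp add: sqmonom_def prod.remove[of I i] prod.remove[of "I - {i}" l] power_mult mult.assoc)

text \<open>Written out as a geometric sum, so that it makes sense on the diagonal and shows its
  exponents.\<close>

definition divdiff :: "nat set \<Rightarrow> nat \<Rightarrow> nat \<Rightarrow> (nat \<Rightarrow> nat) \<Rightarrow> (nat \<Rightarrow> real) \<Rightarrow> real" where
  "divdiff I i l \<nu> x = (if \<nu> l \<le> \<nu> i
     then \<Sum>k<\<nu> i - \<nu> l. sqmonom I (\<nu>(i := \<nu> l + k, l := \<nu> i - Suc k)) x
     else - (\<Sum>k<\<nu> l - \<nu> i. sqmonom I (\<nu>(i := \<nu> i + k, l := \<nu> l - Suc k)) x))"

text \<open>The exponents that occur in a divided difference. Both entries stay strictly below the
  larger original one, so raising either by 1 restores the degree with a pair that is no more spread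
  out than before.\<close>

definition squeezed :: "nat \<Rightarrow> nat \<Rightarrow> (nat \<Rightarrow> nat) \<Rightarrow> (nat \<Rightarrow> nat) set" where
  "squeezed i l \<nu> = {\<rho>. (\<forall>j. j \<noteq> i \<longrightarrow> j \<noteq> l \<longrightarrow> \<rho> j = \<nu> j) \<and> \<rho> i + \<rho> l + 1 = \<nu> i + \<nu> l
      \<and> \<rho> i < max (\<nu> i) (\<nu> l) \<and> \<rho> l < max (\<nu> i) (\<nu> l)}"

lemma pspan_divdiff: "i \<noteq> l \<Longrightarrow> pspan I (squeezed i l \<nu>) (divdiff I i l \<nu>)"
proof (cases "\<nu> l \<le> \<nu> i")
  case True
  assume "i \<noteq> l"
  then have "pspan I (squeezed i l \<nu>) (\<lambda>x. \<Sum>k<\<nu> i - \<nu> l. sqmonom I (\<nu>(i := \<nu> l + k, l := \<nu> i - Suc k)) x)"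
    by (intro pspan_sum pspan_sqmonom) (auto simp: squeezed_def)
  then show ?thesis using True by (simp add: divdiff_def[abs_def])
next
  case False
  assume "i \<noteq> l"
  then have "pspan I (squeezed i l \<nu>) (\<lambda>x. (-1) * (\<Sum>k<\<nu> l - \<nu> i. sqmonom I (\<nu>(i := \<nu> i + k, l := \<nu> l - Suc k)) x))"
    using False by (intro pspan_cmult pspan_sum pspan_sqmonom) (auto simp: squeezed_def)
  then show ?thesis using False by (simp add: divdiff_def[abs_def])
qed

lemma sum_squeezed:
  assumes "finite I" "i \<in> I" "l \<in> I" "i \<noteq> l" "\<rho> \<in> squeezed i l \<nu>"
  shows "Suc (sum \<rho> I) = sum \<nu> I"
proof -
  have "sum \<rho> (I - {i} - {l}) = sum \<nu> (I - {i} - {l})"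
    using assms(5) by (intro sum.cong) (auto simp: squeezed_def)
  moreover have "sum h I = h i + (h l + sum h (I - {i} - {l}))" for h :: "nat \<Rightarrow> nat"
    using assms(1-4) by (simp add: sum.remove[of I i] sum.remove[of "I - {i}" l])
  ultimately show ?thesis using assms(5) by (simp add: squeezed_def)
qed

lemma power_diff_telescope:
  fixes u v :: real
  assumes "b \<le> a"
  shows "u ^ a * v ^ b - v ^ a * u ^ b = (u - v) * (\<Sum>k<a - b. u ^ (b + k) * v ^ (a - Suc k))"
proof -
  have "u ^ a * v ^ b - v ^ a * u ^ b = (u * v) ^ b * (u ^ (a - b) - v ^ (a - b))"
    using assms by (simp add: power_mult_distrib right_diff_distrib mult_ac flip: power_add)
  also have "u ^ (a - b) - v ^ (a - b) = (u - v) * (\<Sum>k<a - b. v ^ (a - b - Suc k) * u ^ k)"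
    by (rule power_diff_sumr2)
  also have "(u * v) ^ b * ((u - v) * (\<Sum>k<a - b. v ^ (a - b - Suc k) * u ^ k)) =
     (u - v) * (\<Sum>k<a - b. (u * v) ^ b * (v ^ (a - b - Suc k) * u ^ k))"
    by (simp add: sum_distrib_left mult_ac)
  also have "(\<Sum>k<a - b. (u * v) ^ b * (v ^ (a - b - Suc k) * u ^ k)) = (\<Sum>k<a - b. u ^ (b + k) * v ^ (a - Suc k))"
  proof (rule sum.cong)
    fix k assume "k \<in> {..<a - b}"
    then have "b + (a - b - Suc k) = a - Suc k" by auto
    then have "v ^ (a - Suc k) = v ^ b * v ^ (a - b - Suc k)" by (metis power_add)
    then show "(u * v) ^ b * (v ^ (a - b - Suc k) * u ^ k) = u ^ (b + k) * v ^ (a - Suc k)"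
      by (simp add: power_mult_distrib power_add mult_ac)
  qed simp
  finally show ?thesis .
qed

lemma divdiff:
  assumes I: "finite I" "i \<in> I" "l \<in> I" "i \<noteq> l"
  shows "sqmonom I \<nu> x - sqmonom I \<nu> (x \<circ> swp i l) = ((x i)\<^sup>2 - (x l)\<^sup>2) * divdiff I i l \<nu> x"
proof -
  define R where "R = (\<Prod>j\<in>I-{i}-{l}. x j ^ (2 * \<nu> j))"
  define u where "u = (x i)\<^sup>2"
  define v where "v = (x l)\<^sup>2"
  have m: "sqmonom I (\<nu>(i := a, l := b)) x = u ^ a * v ^ b * R" for a b
    unfolding sqmonom_two[OF I] u_def v_def R_def using I by simp
  have 1: "sqmonom I \<nu> x = u ^ \<nu> i * v ^ \<nu> l * R"
    using m[of "\<nu> i" "\<nu> l"] by simp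
  have 2: "sqmonom I \<nu> (x \<circ> swp i l) = v ^ \<nu> i * u ^ \<nu> l * R"
  proof -
    have "\<nu> \<circ> swp i l = \<nu>(i := \<nu> l, l := \<nu> i)"
      using I(4) by (auto simp: fun_eq_iff Transposition.transpose_def)
    then show ?thesis using m[of "\<nu> l" "\<nu> i"] by (simp add: sqmonom_swap[OF I(2,3)] mult_ac)
  qed
  show ?thesis
  proof (cases "\<nu> l \<le> \<nu> i")
    case True
    have "sqmonom I \<nu> x - sqmonom I \<nu> (x \<circ> swp i l) = (u ^ \<nu> i * v ^ \<nu> l - v ^ \<nu> i * u ^ \<nu> l) * R"
      unfolding 1 2 by (simp add: left_diff_distrib)
    also have "\<dots> = (u - v) * divdiff I i l \<nu> x"
      unfolding power_diff_telescope[OF True] divdiff_def using True by (simp add: m sum_distrib_left mult_ac)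
    finally show ?thesis by (simp add: u_def v_def)
  next
    case False
    then have le: "\<nu> i \<le> \<nu> l" by simp
    \<comment> \<open>Reversing the summation index exchanges the roles of \<open>u\<close> and
      \<open>v\<close>.\<close>
    have e: "(\<Sum>k<\<nu> l - \<nu> i. v ^ (\<nu> i + k) * u ^ (\<nu> l - Suc k)) = (\<Sum>k<\<nu> l - \<nu> i. u ^ (\<nu> i + k) * v ^ (\<nu> l - Suc k))"
      by (rule sum.reindex_bij_witness[of _ "\<lambda>k. \<nu> l - \<nu> i - Suc k" "\<lambda>k. \<nu> l - \<nu> i - Suc k"])
         (use le in \<open>auto simp: mult.commute algebra_simps Suc_diff_Suc\<close>)
    have "sqmonom I \<nu> x - sqmonom I \<nu> (x \<circ> swp i l) = (v ^ \<nu> l * u ^ \<nu> i - u ^ \<nu> l * v ^ \<nu> i) * R"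
      unfolding 1 2 by (simp add: algebra_simps)
    also have "\<dots> = (u - v) * divdiff I i l \<nu> x"
      unfolding power_diff_telescope[OF le] e divdiff_def using False
      by (simp add: m sum_distrib_left sum_subtractf algebra_simps)
    finally show ?thesis by (simp add: u_def v_def)
  qed
qed

lemma poly_bounded_divdiff:
  assumes "finite I" "i \<noteq> l"
  shows "poly_bounded I (divdiff I i l \<nu>)"
  using pspan_poly_bounded[OF assms(1) pspan_divdiff[OF assms(2)]] .

text \<open>Where two squared coordinates coincide the weight is 0, because \<open>g > 0\<close>.
  Identities under the integral may therefore divide by differences of squares.\<close>

lemma wint_cong:
  assumes g: "0 < g" and eq: "\<And>x. (\<And>i l. i \<in> I \<Longrightarrow> l \<in> I \<Longrightarrow> i \<noteq> l \<Longrightarrow> (x i)\<^sup>2 \<noteq> (x l)\<^sup>2) \<Longrightarrow> h x = h' x"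
    and I: "finite I"
  shows "wint I c g h = wint I c g h'"
proof -
  have "h x * weight I c g x = h' x * weight I c g x" for x
  proof (cases "\<exists>i\<in>I. \<exists>l\<in>I. i \<noteq> l \<and> (x i)\<^sup>2 = (x l)\<^sup>2")
    case True
    then obtain i l where "i \<in> I" "l \<in> I" "i < l" "(x i)\<^sup>2 = (x l)\<^sup>2" by (metis nat_neq_iff)
    then have "(i, l) \<in> pairs I" "(case (i, l) of (i, j) \<Rightarrow> \<bar>(x i)\<^sup>2 - (x j)\<^sup>2\<bar> powr (2 * g)) = 0"
      by (auto simp: pairs_def)
    then have "(\<Prod>(i, j)\<in>pairs I. \<bar>(x i)\<^sup>2 - (x j)\<^sup>2\<bar> powr (2 * g)) = 0"
      by (intro prod_zero finite_pairs I bexI)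
    then have "weight I c g x = 0" by (simp add: weight_def)
    then show ?thesis by simp
  next
    case False
    then show ?thesis using eq[of x] by metis
  qed
  then show ?thesis unfolding wint_def by (simp only:)
qed

lemma wint_add:
  assumes "finite I" "0 \<le> c" "0 \<le> g" "poly_bounded I h" "poly_bounded I h'"
  shows "wint I c g (\<lambda>x. h x + h' x) = wint I c g h + wint I c g h'"
  unfolding wint_def distrib_right using assms by (intro Bochner_Integration.integral_add integrable_wint)

lemma wint_cmult: "wint I c g (\<lambda>x. a * h x) = a * wint I c g h"
  unfolding wint_def by (simp add: mult.assoc)

lemma wint_diff:
  assumes "finite I" "0 \<le> c" "0 \<le> g" "poly_bounded I h" "poly_bounded I h'"
  shows "wint I c g (\<lambda>x. h x - h' x) = wint I c g h - wint I c g h'"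
  unfolding wint_def left_diff_distrib using assms by (intro Bochner_Integration.integral_diff integrable_wint)

lemma wint_sum:
  assumes "finite I" "0 \<le> c" "0 \<le> g" "\<And>j. j \<in> J \<Longrightarrow> poly_bounded I (h j)"
  shows "wint I c g (\<lambda>x. \<Sum>j\<in>J. h j x) = (\<Sum>j\<in>J. wint I c g (h j))"
  unfolding wint_def sum_distrib_right using assms by (intro Bochner_Integration.integral_sum integrable_wint)

section \<open>Abel summation and the dominance order on exponents\<close>

lemma weighted_sum_tails:
  fixes a :: "nat \<Rightarrow> nat"
  assumes "s \<le> e"
  shows "(\<Sum>j=s..<e. j * a j) = s * (\<Sum>j=s..<e. a j) + (\<Sum>k=Suc s..<e. \<Sum>j=k..<e. a j)"
  using assms
proof (induction e rule: dec_induct)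
  case (step e)
  have "(\<Sum>k=Suc s..<Suc e. \<Sum>j=k..<Suc e. a j) = (e - s) * a e + (\<Sum>k=Suc s..<e. \<Sum>j=k..<e. a j)"
  proof -
    have "(\<Sum>k=Suc s..<Suc e. \<Sum>j=k..<Suc e. a j) = (\<Sum>k=Suc s..<Suc e. (\<Sum>j=k..<e. a j) + a e)"
      by (intro sum.cong) auto
    also have "\<dots> = (\<Sum>k=Suc s..<Suc e. (\<Sum>j=k..<e. a j)) + (e - s) * a e"
      by (simp add: sum.distrib del: sum.op_ivl_Suc)
    also have "(\<Sum>k=Suc s..<Suc e. (\<Sum>j=k..<e. a j)) = (\<Sum>k=Suc s..<e. (\<Sum>j=k..<e. a j))"
      by (cases "s = e") auto
    finally show ?thesis by simp
  qed
  then have A: "(\<Sum>k=Suc s..<Suc e. \<Sum>j=k..<Suc e. a j) = (e - s) * a e + (\<Sum>k=Suc s..<e. \<Sum>j=k..<e. a j)" .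
  have B: "e * a e = s * a e + (e - s) * a e"
    using step by (simp flip: distrib_right)
  have C: "(\<Sum>j=s..<Suc e. j * a j) = (\<Sum>j=s..<e. j * a j) + e * a e"
    "(\<Sum>j=s..<Suc e. a j) = (\<Sum>j=s..<e. a j) + a e" using step by simp_all
  show ?case unfolding A C B step.IH distrib_left by (simp only: ac_simps)
qed simp

text \<open>The weights \<open>j\<close> grow, so by Abel summation the weighted sum is a sum of
  tails. If no tail were strictly smaller, all tails and hence all entries would agree.\<close>

lemma weighted_sum_strict:
  fixes a b :: "nat \<Rightarrow> nat"
  assumes "s \<le> e" and tot: "(\<Sum>j=s..<e. a j) = (\<Sum>j=s..<e. b j)"
    and le: "\<And>k. s \<le> k \<Longrightarrow> k < e \<Longrightarrow> (\<Sum>j=k..<e. a j) \<le> (\<Sum>j=k..<e. b j)"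
    and ne: "j0 \<in> {s..<e}" "a j0 \<noteq> b j0"
  shows "(\<Sum>j=s..<e. j * a j) < (\<Sum>j=s..<e. j * b j)"
proof -
  have "\<exists>k\<in>{Suc s..<e}. (\<Sum>j=k..<e. a j) < (\<Sum>j=k..<e. b j)"
  proof (rule ccontr)
    assume neg: "\<not> ?thesis"
    have eq: "(\<Sum>j=k..<e. a j) = (\<Sum>j=k..<e. b j)" if "s \<le> k" "k \<le> e" for k
    proof -
      have ks: "s \<le> k" "k \<le> e" using that by auto
      consider "k = s" | "k = e" | "Suc s \<le> k" "k < e" using ks by linarith
      then show ?thesis
      proof cases
        case 3
        then have "k \<in> {Suc s..<e}" by simp
        with neg have "\<not> (\<Sum>j=k..<e. a j) < (\<Sum>j=k..<e. b j)" by blast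
        then show ?thesis using le[of k] 3 by simp
      qed (use tot in auto)
    qed
    have "a j0 + (\<Sum>j=Suc j0..<e. a j) = b j0 + (\<Sum>j=Suc j0..<e. b j)"
      using eq[of j0] ne(1) by (simp add: sum.atLeast_Suc_lessThan)
    then show False using eq[of "Suc j0"] ne by simp
  qed
  then have "(\<Sum>k=Suc s..<e. \<Sum>j=k..<e. a j) < (\<Sum>k=Suc s..<e. \<Sum>j=k..<e. b j)"
    by (intro sum_strict_mono_ex1) (auto intro: le)
  then show ?thesis unfolding weighted_sum_tails[OF assms(1)] tot by simp
qed

text \<open>
  With \<open>G k\<close> the sum of the \<open>k\<close> largest entries of a partition of \<open>d\<close>, these are the exponents
  whose rearrangement is below that partition in the dominance order.
\<close>

definition dominated :: "nat set \<Rightarrow> (nat \<Rightarrow> nat) \<Rightarrow> nat \<Rightarrow> (nat \<Rightarrow> nat) set" where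
  "dominated I G d = {\<nu>. sum \<nu> I = d \<and> (\<forall>S\<subseteq>I. sum \<nu> S \<le> G (card S))}"

text \<open>A set containing both or neither of \<open>i\<close>, \<open>l\<close> keeps its sum. A
  set containing one of them, \<open>a\<close>, is compared with itself or with the set in which
  \<open>a\<close> is replaced by the other one, which has the same cardinality. Transpositions are
  a special case.\<close>

lemma dominated_squeeze:
  assumes I: "finite I" and il: "i \<in> I" "l \<in> I" "i \<noteq> l" and \<nu>: "\<nu> \<in> dominated I G d"
    and out: "\<And>j. j \<noteq> i \<Longrightarrow> j \<noteq> l \<Longrightarrow> \<nu>' j = \<nu> j" and sm: "\<nu>' i + \<nu>' l = \<nu> i + \<nu> l"
    and mx: "\<nu>' i \<le> max (\<nu> i) (\<nu> l)" "\<nu>' l \<le> max (\<nu> i) (\<nu> l)"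
  shows "\<nu>' \<in> dominated I G d"
proof -
  have both: "sum \<nu>' S = sum \<nu> S" if "S \<subseteq> I" "i \<in> S" "l \<in> S" for S
  proof -
    have "finite S" using that I finite_subset by blast
    then show ?thesis using that il sm out
      by (simp add: sum.remove[of S i] sum.remove[of "S - {i}" l])
  qed
  have one: "sum \<nu>' S \<le> G (card S)"
    if S: "S \<subseteq> I" and ab: "a \<in> S" "b \<notin> S" "(a = i \<and> b = l) \<or> (a = l \<and> b = i)" for S a b
  proof -
    have fS: "finite S" using S I finite_subset by blast
    have e: "sum \<nu>' (S - {a}) = sum \<nu> (S - {a})" using ab by (intro sum.cong) (auto intro!: out)
    have s': "sum \<nu>' S = \<nu>' a + sum \<nu> (S - {a})" using ab fS e by (simp add: sum.remove[of S a])
    consider "\<nu>' a \<le> \<nu> a" | "\<nu>' a \<le> \<nu> b" using mx ab(3) by (auto simp: max_def split: if_splits)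
    then show ?thesis
    proof cases
      case 1
      then have "sum \<nu>' S \<le> sum \<nu> S" using s' ab fS by (simp add: sum.remove[of S a])
      moreover have "sum \<nu> S \<le> G (card S)" using \<nu> S unfolding dominated_def by blast
      ultimately show ?thesis by simp
    next
      case 2
      then have "sum \<nu>' S \<le> sum \<nu> (insert b (S - {a}))" using s' ab fS by simp
      also have "\<dots> \<le> G (card (insert b (S - {a})))"
      proof -
        have "insert b (S - {a}) \<subseteq> I" using S il ab(3) by blast
        then show ?thesis using \<nu> unfolding dominated_def by blast
      qed
      also have "card (insert b (S - {a})) = card S"
        using card_Suc_Diff1[OF fS ab(1)] fS ab(2) by (simp del: card_Diff_insert)
      finally show ?thesis .
    qed
  qed
  have "sum \<nu>' S \<le> G (card S)" if S: "S \<subseteq> I" for S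
  proof (cases "i \<in> S"; cases "l \<in> S")
    assume "i \<in> S" "l \<in> S"
    then show ?thesis using both[OF S] \<nu> S unfolding dominated_def by auto
  next
    assume "i \<notin> S" "l \<notin> S"
    then have "sum \<nu>' S = sum \<nu> S" by (intro sum.cong) (auto intro!: out)
    then show ?thesis using \<nu> S unfolding dominated_def by auto
  qed (use one[OF S] in auto)
  moreover have "sum \<nu>' I = d" using both[of I] il \<nu> unfolding dominated_def by auto
  ultimately show ?thesis unfolding dominated_def by auto
qed

section \<open>Integration by parts in symmetrized form\<close>

definition sqprod :: "nat set \<Rightarrow> (nat \<Rightarrow> real) \<Rightarrow> real" where
  "sqprod S x = (\<Prod>j\<in>S. (x j)\<^sup>2)"

lemma poly_bounded_sqprod [intro]: "finite I \<Longrightarrow> S \<subseteq> I \<Longrightarrow> poly_bounded I (sqprod S)"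
  unfolding sqprod_def[abs_def] by (intro poly_bounded_prod poly_bounded_power poly_bounded_component) auto

lemma sqprod_sqmonom:
  assumes "finite I" "S \<subseteq> I"
  shows "sqprod S x = sqmonom I (\<lambda>j. if j \<in> S then 1 else 0) x"
proof -
  have "sqmonom I (\<lambda>j. if j \<in> S then 1 else 0) x = (\<Prod>j\<in>I. if j \<in> S then (x j)\<^sup>2 else 1)"
    unfolding sqmonom_def by (intro prod.cong) auto
  also have "\<dots> = (\<Prod>j\<in>I \<inter> S. (x j)\<^sup>2)" using assms by (simp add: prod.inter_restrict)
  finally show ?thesis using assms by (simp add: sqprod_def Int_absorb1)
qed

lemma sqprod_swap_both:
  assumes "finite S" "(i \<in> S \<and> l \<in> S) \<or> (i \<notin> S \<and> l \<notin> S)"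
  shows "sqprod S (x \<circ> swp i l) = sqprod S x"
proof -
  let ?s = "swp i l"
  have "bij_betw ?s S S"
    using assms by (intro bij_betwI[of _ _ _ ?s]) (auto simp: Transposition.transpose_def)
  then have "(\<Prod>j\<in>S. (x (?s j))\<^sup>2) = (\<Prod>j\<in>S. (x j)\<^sup>2)"
    by (rule prod.reindex_bij_betw)
  then show ?thesis by (simp add: sqprod_def)
qed

text \<open>
  \<open>raise_op\<close> is \<open>1 + 2 * c + 2 * Y\<close> on a monomial, where \<open>Y\<close> is the Cherednik operator
  \<open>t\<^sub>i D\<^sub>i + g * (\<Sum>l\<in>I-S. s\<^sub>i\<^sub>l)\<close>; \<open>lower_op\<close> is twice the Dunkl operator \<open>D\<^sub>i\<close> in the variables
  \<open>t\<^sub>i = (x i)\<^sup>2\<close>, with the value at \<open>\<rho> i = 0\<close> harmless because of the factor \<open>\<rho> i\<close>.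
\<close>

definition raise_op :: "nat set \<Rightarrow> real \<Rightarrow> real \<Rightarrow> nat set \<Rightarrow> nat \<Rightarrow> (nat \<Rightarrow> nat) \<Rightarrow> (nat \<Rightarrow> real) \<Rightarrow> real" where
  "raise_op I c g S i \<nu> x = (1 + 2 * c + 2 * real (\<nu> i)) * sqmonom I \<nu> x
     + 2 * g * (\<Sum>l\<in>I-{i}. (x i)\<^sup>2 * divdiff I i l \<nu> x)
     + 2 * g * (\<Sum>l\<in>I-S. sqmonom I \<nu> (x \<circ> swp i l))"

definition lower_op :: "nat set \<Rightarrow> real \<Rightarrow> nat \<Rightarrow> (nat \<Rightarrow> nat) \<Rightarrow> (nat \<Rightarrow> real) \<Rightarrow> real" where
  "lower_op I g i \<rho> x = 2 * real (\<rho> i) * sqmonom I (\<rho>(i := \<rho> i - 1)) x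
     + 2 * g * (\<Sum>l\<in>I-{i}. divdiff I i l \<rho> x)"

lemma measurable_poly_bounded: "poly_bounded I h \<Longrightarrow> h \<in> borel_measurable (gauss I)"
  unfolding poly_bounded_def by blast

text \<open>The transposition reverses the sign of the denominator and preserves the weight.\<close>

lemma wint_div_swap:
  assumes I: "finite I" "i \<in> I" "l \<in> I" and F: "poly_bounded I F"
  shows "wint I c g (\<lambda>x. F (x \<circ> swp i l) / ((x i)\<^sup>2 - (x l)\<^sup>2))
    = - wint I c g (\<lambda>x. F x / ((x i)\<^sup>2 - (x l)\<^sup>2))"
proof -
  have "(\<lambda>x. F x / ((x i)\<^sup>2 - (x l)\<^sup>2)) \<in> borel_measurable (gauss I)"
    using measurable_poly_bounded[OF F] I by simp
  from wint_swap[OF I this]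
  have "wint I c g (\<lambda>x. F (x \<circ> swp i l) / ((x l)\<^sup>2 - (x i)\<^sup>2))
    = wint I c g (\<lambda>x. F x / ((x i)\<^sup>2 - (x l)\<^sup>2))" by simp
  moreover have "F (x \<circ> swp i l) / ((x l)\<^sup>2 - (x i)\<^sup>2)
     = (-1) * (F (x \<circ> swp i l) / ((x i)\<^sup>2 - (x l)\<^sup>2))" for x
    by (metis minus_diff_eq minus_divide_right mult_minus1)
  ultimately show ?thesis by (simp only: wint_cmult)
qed

lemma poly_bounded_swap:
  assumes "finite I" "i \<in> I" "l \<in> I"
  shows "poly_bounded I (\<lambda>x. sqmonom I \<nu> (x \<circ> swp i l))"
  unfolding sqmonom_swap[OF assms(2,3)] using assms by auto

lemma wint_divdiff:
  assumes I: "finite I" "i \<in> I" "l \<in> I" "i \<noteq> l" and c: "0 \<le> c" and g: "1 \<le> g" and F: "poly_bounded I F"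
  shows "wint I c g (\<lambda>x. F x * divdiff I i l \<nu> x) =
    wint I c g (\<lambda>x. F x * sqmonom I \<nu> x / ((x i)\<^sup>2 - (x l)\<^sup>2))
    - wint I c g (\<lambda>x. F x * sqmonom I \<nu> (x \<circ> swp i l) / ((x i)\<^sup>2 - (x l)\<^sup>2))"
proof -
  have "wint I c g (\<lambda>x. F x * divdiff I i l \<nu> x) =
     wint I c g (\<lambda>x. F x * sqmonom I \<nu> x / ((x i)\<^sup>2 - (x l)\<^sup>2) - F x * sqmonom I \<nu> (x \<circ> swp i l) / ((x i)\<^sup>2 - (x l)\<^sup>2))"
  proof (rule wint_cong)
    fix x :: "nat \<Rightarrow> real" assume "\<And>i l. i \<in> I \<Longrightarrow> l \<in> I \<Longrightarrow> i \<noteq> l \<Longrightarrow> (x i)\<^sup>2 \<noteq> (x l)\<^sup>2"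
    then have ne: "(x i)\<^sup>2 - (x l)\<^sup>2 \<noteq> 0" using I by auto
    have "divdiff I i l \<nu> x = (sqmonom I \<nu> x - sqmonom I \<nu> (x \<circ> swp i l)) / ((x i)\<^sup>2 - (x l)\<^sup>2)"
      using divdiff[OF I, of \<nu> x] ne by (simp add: field_simps)
    then show "F x * divdiff I i l \<nu> x = F x * sqmonom I \<nu> x / ((x i)\<^sup>2 - (x l)\<^sup>2) - F x * sqmonom I \<nu> (x \<circ> swp i l) / ((x i)\<^sup>2 - (x l)\<^sup>2)"
      by (simp add: right_diff_distrib diff_divide_distrib)
  qed (use g I in auto)
  also have "\<dots> = wint I c g (\<lambda>x. F x * sqmonom I \<nu> x / ((x i)\<^sup>2 - (x l)\<^sup>2))
    - wint I c g (\<lambda>x. F x * sqmonom I \<nu> (x \<circ> swp i l) / ((x i)\<^sup>2 - (x l)\<^sup>2))"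
    unfolding wint_def left_diff_distrib using I c g F
    by (intro Bochner_Integration.integral_diff integrable_wint_div poly_bounded_mult poly_bounded_sqmonom poly_bounded_swap) auto
  finally show ?thesis .
qed

text \<open>With \<open>p\<close>, \<open>q\<close> the two monomials, the divided differences on
  the right contain \<open>2 * p * q\<close> minus two mixed terms in which one factor is
  transposed. If \<open>l \<in> S\<close>, the mixed terms cancel under the transposition. If
  \<open>l \<notin> S\<close>, the transposition replaces the factor \<open>(x i)\<^sup>2\<close> of
  \<open>sqprod S\<close> by \<open>(x l)\<^sup>2\<close>; the difference cancels the denominator
  and leaves the reflection term.\<close>

lemma wint_symmetrize:
  assumes I: "finite I" "i \<in> I" "l \<in> I" "i \<noteq> l" and c: "0 \<le> c" and g: "1 \<le> g"
    and S: "S \<subseteq> I" "i \<in> S"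
  shows "2 * wint I c g (\<lambda>x. sqprod S x * sqmonom I \<rho> x * sqmonom I \<nu> x / ((x i)\<^sup>2 - (x l)\<^sup>2)) =
     wint I c g (\<lambda>x. sqprod S x * sqmonom I \<nu> x * divdiff I i l \<rho> x)
   + wint I c g (\<lambda>x. sqprod S x * sqmonom I \<rho> x * divdiff I i l \<nu> x)
   + (if l \<in> S then 0 else wint I c g (\<lambda>x. sqprod (S - {i}) x * sqmonom I \<rho> x * sqmonom I \<nu> (x \<circ> swp i l)))"
proof -
  let ?s = "swp i l"
  have fS: "finite S" using S I finite_subset by blast
  define d where "d x = (x i)\<^sup>2 - (x l)\<^sup>2" for x :: "nat \<Rightarrow> real"
  note [simp] = sqmonom_swap[OF I(2,3)]
  define p where "p = sqmonom I \<rho>"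
  define q where "q = sqmonom I \<nu>"
  define ps where "ps = sqmonom I (\<rho> \<circ> ?s)"
  define qs where "qs = sqmonom I (\<nu> \<circ> ?s)"
  have ss: "?s \<circ> ?s = id" by (simp add: fun_eq_iff)
  have sw: "p (x \<circ> ?s) = ps x" "q (x \<circ> ?s) = qs x" "ps (x \<circ> ?s) = p x" "qs (x \<circ> ?s) = q x" for x
    by (simp_all add: p_def q_def ps_def qs_def comp_assoc ss)
  have pb: "poly_bounded I p" "poly_bounded I q" "poly_bounded I ps" "poly_bounded I qs"
      "poly_bounded I (sqprod S)" "poly_bounded I (sqprod (S - {i}))"
    unfolding p_def q_def ps_def qs_def using I S by auto
  have 1: "wint I c g (\<lambda>x. sqprod S x * q x * divdiff I i l \<rho> x)
      = wint I c g (\<lambda>x. sqprod S x * p x * q x / d x) - wint I c g (\<lambda>x. sqprod S x * ps x * q x / d x)"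
    using wint_divdiff[OF I c g poly_bounded_mult[OF pb(5,2)], of \<rho>] by (simp add: p_def ps_def d_def mult_ac)
  have 2: "wint I c g (\<lambda>x. sqprod S x * p x * divdiff I i l \<nu> x)
      = wint I c g (\<lambda>x. sqprod S x * p x * q x / d x) - wint I c g (\<lambda>x. sqprod S x * p x * qs x / d x)"
    using wint_divdiff[OF I c g poly_bounded_mult[OF pb(5,1)], of \<nu>] by (simp add: q_def qs_def d_def mult_ac)
  have 3: "wint I c g (\<lambda>x. sqprod S (x \<circ> ?s) * ps x * q x / d x) = - wint I c g (\<lambda>x. sqprod S x * p x * qs x / d x)"
    using wint_div_swap[OF I(1-3) poly_bounded_mult[OF poly_bounded_mult[OF pb(5,1)] pb(4)], of c g] by (simp add: sw d_def)
  have main: "wint I c g (\<lambda>x. sqprod S x * ps x * q x / d x) + wint I c g (\<lambda>x. sqprod S x * p x * qs x / d x)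
     = (if l \<in> S then 0 else wint I c g (\<lambda>x. sqprod (S - {i}) x * p x * qs x))"
  proof (cases "l \<in> S")
    case True
    then show ?thesis using 3 S sqprod_swap_both[OF fS, of i l] by simp
  next
    case False
    have sp: "sqprod S x = (x i)\<^sup>2 * sqprod (S - {i}) x" for x
      unfolding sqprod_def using fS S by (simp add: prod.remove)
    have inv: "sqprod (S - {i}) (x \<circ> ?s) = sqprod (S - {i}) x" for x
      using False fS by (intro sqprod_swap_both) auto
    have sp': "sqprod S (x \<circ> ?s) = (x l)\<^sup>2 * sqprod (S - {i}) x" for x
      unfolding sp inv by simp
    have "wint I c g (\<lambda>x. sqprod (S - {i}) x * p x * qs x) = wint I c g (\<lambda>x. sqprod (S - {i}) x * ps x * q x)"
      using wint_swap[OF I(1-3) measurable_poly_bounded[OF poly_bounded_mult[OF poly_bounded_mult[OF pb(6,1)] pb(4)]], of c g]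
      by (simp add: inv sw)
    also have "\<dots> = wint I c g (\<lambda>x. sqprod S x * ps x * q x / d x - sqprod S (x \<circ> ?s) * ps x * q x / d x)"
    proof (rule wint_cong)
      fix x :: "nat \<Rightarrow> real" assume "\<And>i l. i \<in> I \<Longrightarrow> l \<in> I \<Longrightarrow> i \<noteq> l \<Longrightarrow> (x i)\<^sup>2 \<noteq> (x l)\<^sup>2"
      then have "d x \<noteq> 0" using I by (auto simp: d_def)
      moreover have "sqprod S x * ps x * q x / d x - sqprod S (x \<circ> ?s) * ps x * q x / d x = d x * (sqprod (S - {i}) x * ps x * q x) / d x"
        unfolding sp' unfolding sp d_def diff_divide_distrib[symmetric] by (simp add: algebra_simps)
      ultimately show "sqprod (S - {i}) x * ps x * q x = sqprod S x * ps x * q x / d x - sqprod S (x \<circ> ?s) * ps x * q x / d x"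
        by simp
    qed (use g I in auto)
    also have "\<dots> = wint I c g (\<lambda>x. sqprod S x * ps x * q x / d x) - wint I c g (\<lambda>x. sqprod S (x \<circ> ?s) * ps x * q x / d x)"
    proof -
      have "poly_bounded I (\<lambda>x. sqprod S (x \<circ> ?s))"
        unfolding sp' by (intro poly_bounded_mult poly_bounded_power poly_bounded_component pb I)
      then show ?thesis
        unfolding wint_def left_diff_distrib d_def using I c g pb
        by (intro Bochner_Integration.integral_diff integrable_wint_div poly_bounded_mult) auto
    qed
    finally show ?thesis using 3 False by simp
  qed
  show ?thesis
    unfolding p_def[symmetric] q_def[symmetric] d_def[symmetric] sw(2)
    using 1 2 main by (auto split: if_splits)
qed

text \<open>The factor \<open>(x i)\<^sup>2\<close> of \<open>sqprod S\<close> is spent on one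
  integration by parts. By the product rule the result splits into a part acting on
  \<open>\<nu>\<close>, collected in \<open>raise_op\<close>, and a part acting on
  \<open>\<rho>\<close>, collected in \<open>lower_op\<close>; the reflections go to
  \<open>\<nu>\<close>.\<close>

lemma wint_step:
  assumes I: "finite I" and c: "0 < c" and g: "1 \<le> g" and S: "S \<subseteq> I" "i \<in> S"
  shows "wint I c g (\<lambda>x. sqprod S x * sqmonom I \<rho> x * sqmonom I \<nu> x) =
    wint I c g (\<lambda>x. sqprod (S - {i}) x * sqmonom I \<rho> x * raise_op I c g S i \<nu> x)
    + wint I c g (\<lambda>x. sqprod S x * lower_op I g i \<rho> x * sqmonom I \<nu> x)"
proof -
  let ?s = "\<lambda>l. swp i l"
  have iI: "i \<in> I" using S by auto
  have fS: "finite S" using S I finite_subset by blast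
  define p where "p = sqmonom I \<rho>"
  define q where "q = sqmonom I \<nu>"
  define t where "t = sqprod (S - {i})"
  have sp: "sqprod S x = (x i)\<^sup>2 * t x" for x
    unfolding sqprod_def t_def using fS S by (simp add: prod.remove)
  have pb: "poly_bounded I p" "poly_bounded I q" "poly_bounded I t" "poly_bounded I (sqprod S)"
      "\<And>l \<nu>. l \<in> I - {i} \<Longrightarrow> poly_bounded I (divdiff I i l \<nu>)" "poly_bounded I (\<lambda>x. (x i)\<^sup>2)"
      "\<And>l. l \<in> I \<Longrightarrow> poly_bounded I (\<lambda>x. q (x \<circ> ?s l))"
      "poly_bounded I (sqmonom I (\<rho>(i := \<rho> i - 1)))"
    unfolding p_def q_def t_def using I S iI by (auto intro!: poly_bounded_divdiff poly_bounded_swap poly_bounded_sqprod)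
  \<comment> \<open>The exponent of everything except the factor to be integrated away. Since
    \<open>i \<notin> S - {i}\<close>, its value at \<open>i\<close> is just
    \<open>\<rho> i + \<nu> i\<close>.\<close>
  define \<kappa> where "\<kappa> = (\<lambda>j. (if j \<in> S - {i} then 1 else 0) + (\<rho> j + \<nu> j))"
  have h: "sqmonom I \<kappa> x = t x * p x * q x" for x
  proof -
    have "S - {i} \<subseteq> I" using S by auto
    then have "t x = sqmonom I (\<lambda>j. if j \<in> S - {i} then 1 else 0) x"
      unfolding t_def by (rule sqprod_sqmonom[OF I])
    then show ?thesis unfolding p_def q_def \<kappa>_def by (simp only: sqmonom_mult add.assoc)
  qed
  have \<kappa>: "\<kappa> i = \<rho> i + \<nu> i" by (simp add: \<kappa>_def)
  define X where "X l = wint I c g (\<lambda>x. sqprod S x * q x * divdiff I i l \<rho> x)" for l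
  define Y where "Y l = wint I c g (\<lambda>x. sqprod S x * p x * divdiff I i l \<nu> x)" for l
  define V where "V l = wint I c g (\<lambda>x. t x * p x * q (x \<circ> ?s l))" for l
  define W where "W = wint I c g (\<lambda>x. t x * p x * q x)"
  have "wint I c g (\<lambda>x. sqprod S x * p x * q x) =
    (2 * real (\<rho> i + \<nu> i) + 1 + 2 * c) * W
    + 4 * g * (\<Sum>l\<in>I-{i}. wint I c g (\<lambda>x. sqprod S x * p x * q x / ((x i)\<^sup>2 - (x l)\<^sup>2)))"
    using wint_by_parts[OF I iI c g, of \<kappa>] unfolding wint_cmult h \<kappa> by (simp add: sp W_def mult.assoc)
  also have "4 * g * (\<Sum>l\<in>I-{i}. wint I c g (\<lambda>x. sqprod S x * p x * q x / ((x i)\<^sup>2 - (x l)\<^sup>2))) =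
     2 * g * (\<Sum>l\<in>I-{i}. 2 * wint I c g (\<lambda>x. sqprod S x * p x * q x / ((x i)\<^sup>2 - (x l)\<^sup>2)))"
    by (simp add: sum_distrib_left mult.assoc)
  also have "(\<Sum>l\<in>I-{i}. 2 * wint I c g (\<lambda>x. sqprod S x * p x * q x / ((x i)\<^sup>2 - (x l)\<^sup>2)))
     = (\<Sum>l\<in>I-{i}. X l + Y l + (if l \<in> S then 0 else V l))"
    unfolding X_def Y_def V_def p_def q_def t_def
    by (intro sum.cong refl wint_symmetrize) (use I iI c g S in auto)
  also have "\<dots> = (\<Sum>l\<in>I-{i}. X l) + (\<Sum>l\<in>I-{i}. Y l) + (\<Sum>l\<in>I-S. V l)"
  proof -
    have "(\<Sum>l\<in>I-{i}. if l \<in> S then 0 else V l) = (\<Sum>l\<in>I-S. V l)"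
      using I S by (intro sum.mono_neutral_cong_right) auto
    then show ?thesis by (simp add: sum.distrib)
  qed
  finally have main: "wint I c g (\<lambda>x. sqprod S x * p x * q x) = (2 * real (\<rho> i + \<nu> i) + 1 + 2 * c) * W
     + 2 * g * ((\<Sum>l\<in>I-{i}. X l) + (\<Sum>l\<in>I-{i}. Y l) + (\<Sum>l\<in>I-S. V l))" .
  have R: "wint I c g (\<lambda>x. t x * p x * raise_op I c g S i \<nu> x) =
     (1 + 2 * c + 2 * real (\<nu> i)) * W + 2 * g * (\<Sum>l\<in>I-{i}. Y l) + 2 * g * (\<Sum>l\<in>I-S. V l)"
  proof -
    have "wint I c g (\<lambda>x. t x * p x * raise_op I c g S i \<nu> x) =
      wint I c g (\<lambda>x. ((1 + 2 * c + 2 * real (\<nu> i)) * (t x * p x * q x)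
        + 2 * g * (\<Sum>l\<in>I-{i}. sqprod S x * p x * divdiff I i l \<nu> x))
        + 2 * g * (\<Sum>l\<in>I-S. t x * p x * q (x \<circ> ?s l)))"
      by (rule arg_cong[where f="wint I c g"])
         (simp add: fun_eq_iff raise_op_def q_def sp sum_distrib_left algebra_simps)
    also have "\<dots> = (1 + 2 * c + 2 * real (\<nu> i)) * W + 2 * g * (\<Sum>l\<in>I-{i}. Y l) + 2 * g * (\<Sum>l\<in>I-S. V l)"
      unfolding W_def Y_def V_def using I c g pb
      by (subst wint_add wint_cmult wint_sum;
          (intro poly_bounded_mult poly_bounded_add poly_bounded_sum poly_bounded_const)?; simp?)+
    finally show ?thesis .
  qed
  have Lo: "wint I c g (\<lambda>x. sqprod S x * lower_op I g i \<rho> x * q x) = 2 * real (\<rho> i) * W + 2 * g * (\<Sum>l\<in>I-{i}. X l)"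
  proof -
    have pi: "real (\<rho> i) * ((x i)\<^sup>2 * sqmonom I (\<rho>(i := \<rho> i - 1)) x) = real (\<rho> i) * p x" for x
    proof (cases "\<rho> i")
      case (Suc m)
      have "(x i)\<^sup>2 * (\<Prod>j\<in>I. x j ^ (2 * (\<rho>(i := m)) j)) = (\<Prod>j\<in>I. x j ^ (2 * \<rho> j))"
        using I iI Suc by (simp add: prod.remove[of I i] power2_eq_square)
      then show ?thesis using Suc by (simp add: p_def sqmonom_def)
    qed simp
    have "wint I c g (\<lambda>x. sqprod S x * lower_op I g i \<rho> x * q x) =
      wint I c g (\<lambda>x. 2 * real (\<rho> i) * (t x * p x * q x)
        + 2 * g * (\<Sum>l\<in>I-{i}. sqprod S x * q x * divdiff I i l \<rho> x))"
    proof (rule arg_cong[where f="wint I c g"], rule ext)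
      fix x
      have "sqprod S x * lower_op I g i \<rho> x * q x = 2 * (real (\<rho> i) * ((x i)\<^sup>2 * sqmonom I (\<rho>(i := \<rho> i - 1)) x)) * t x * q x
        + 2 * g * (\<Sum>l\<in>I-{i}. sqprod S x * q x * divdiff I i l \<rho> x)"
        unfolding lower_op_def by (simp add: sp sum_distrib_left algebra_simps)
      then show "sqprod S x * lower_op I g i \<rho> x * q x = 2 * real (\<rho> i) * (t x * p x * q x)
        + 2 * g * (\<Sum>l\<in>I-{i}. sqprod S x * q x * divdiff I i l \<rho> x)"
        unfolding pi by (simp add: mult_ac)
    qed
    also have "\<dots> = 2 * real (\<rho> i) * W + 2 * g * (\<Sum>l\<in>I-{i}. X l)"
      unfolding W_def X_def using I c g pb
      by (subst wint_add wint_cmult wint_sum;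
          (intro poly_bounded_mult poly_bounded_add poly_bounded_sum poly_bounded_const)?; simp?)+
    finally show ?thesis .
  qed
  show ?thesis
    using main R Lo unfolding p_def[symmetric] q_def[symmetric] t_def[symmetric]
    by (simp add: algebra_simps)
qed

section \<open>The Vandermonde product\<close>

definition vand :: "nat \<Rightarrow> nat \<Rightarrow> (nat \<Rightarrow> real) \<Rightarrow> real" where
  "vand p e x = (\<Prod>j\<in>{p..<e}. \<Prod>i\<in>{p..<j}. (x j)\<^sup>2 - (x i)\<^sup>2)"

lemma vand_Suc: "p \<le> e \<Longrightarrow> vand p (Suc e) x = vand p e x * (\<Prod>i\<in>{p..<e}. (x e)\<^sup>2 - (x i)\<^sup>2)"
  by (simp add: vand_def prod.op_ivl_Suc)

lemma vand_cong: "(\<And>i. i \<in> {p..<e} \<Longrightarrow> x i = y i) \<Longrightarrow> vand p e x = vand p e y"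
  unfolding vand_def by (intro prod.cong) auto

text \<open>Induction on \<open>e\<close>. A transposition below the last index permutes the new
  factors, and one of the last two indices reverses a single factor. Any other transposition with
  the last index is conjugate to the latter by one of the former, which gives three signs.\<close>

lemma vand_swap_aux:
  assumes "a < b" "b < e" "p \<le> a"
  shows "vand p e (x \<circ> swp a b) = - vand p e x"
  using assms
proof (induction e arbitrary: a b x)
  case (Suc e)
  let ?s = "swp"
  have pe: "p \<le> e" using Suc.prems by auto
  have within: "vand p (Suc e) (x \<circ> ?s a b) = - vand p (Suc e) x" if "p \<le> a" "a < b" "b < e" for a b x
  proof -
    have "vand p e (x \<circ> ?s a b) = - vand p e x" by (intro Suc.IH that)
    moreover have "(\<Prod>i\<in>{p..<e}. ((x \<circ> ?s a b) e)\<^sup>2 - ((x \<circ> ?s a b) i)\<^sup>2) = (\<Prod>i\<in>{p..<e}. (x e)\<^sup>2 - (x i)\<^sup>2)"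
    proof -
      have "bij_betw (?s a b) {p..<e} {p..<e}"
        using that by (intro bij_betwI[of _ _ _ "?s a b"]) (auto simp: Transposition.transpose_def)
      then have "(\<Prod>i\<in>{p..<e}. (x e)\<^sup>2 - (x (?s a b i))\<^sup>2) = (\<Prod>i\<in>{p..<e}. (x e)\<^sup>2 - (x i)\<^sup>2)"
        by (rule prod.reindex_bij_betw)
      moreover have "?s a b e = e" using that by (auto simp: Transposition.transpose_def)
      ultimately show ?thesis by simp
    qed
    ultimately show ?thesis unfolding vand_Suc[OF pe] by simp
  qed
  have last: "vand p (Suc (Suc m)) (x \<circ> ?s m (Suc m)) = - vand p (Suc (Suc m)) x" if "p \<le> m" for m x
  proof -
    have le: "p \<le> Suc m" using that by simp
    have e1: "(\<Prod>i\<in>{p..<Suc m}. F i) = F m * (\<Prod>i\<in>{p..<m}. F i)" for F :: "nat \<Rightarrow> real"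
      using that by (simp add: prod.op_ivl_Suc mult.commute)
    have v: "vand p m (x \<circ> ?s m (Suc m)) = vand p m x"
      by (rule vand_cong) (auto simp: Transposition.transpose_def)
    have q: "(\<Prod>i\<in>{p..<m}. a - ((x \<circ> ?s m (Suc m)) i)\<^sup>2) = (\<Prod>i\<in>{p..<m}. a - (x i)\<^sup>2)" for a
      by (rule prod.cong) (auto simp: Transposition.transpose_def)
    show ?thesis
      unfolding vand_Suc[OF le] vand_Suc[OF that] e1 v q by (simp add: algebra_simps)
  qed
  show ?case
  proof (cases "b < e")
    case True
    then show ?thesis using Suc.prems by (intro within) auto
  next
    case False
    then have b: "b = e" using Suc.prems by simp
    then obtain m where m: "e = Suc m" using Suc.prems by (cases e) auto
    show ?thesis
    proof (cases "a = m")
      case True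
      then show ?thesis unfolding b m True by (intro last) (use Suc.prems True in simp)
    next
      case ne: False
      then have am: "a < m" using Suc.prems b m by simp
      have "?s a b = ?s a m \<circ> (?s m (Suc m) \<circ> ?s a m)"
        using am b m by (auto simp: fun_eq_iff Transposition.transpose_def)
      then have "vand p (Suc e) (x \<circ> ?s a b) = vand p (Suc e) (x \<circ> ?s a m \<circ> ?s m (Suc m) \<circ> ?s a m)"
        by (simp add: comp_assoc)
      also have "\<dots> = - vand p (Suc e) (x \<circ> ?s a m \<circ> ?s m (Suc m))"
        using am m Suc.prems by (intro within) auto
      also have "\<dots> = vand p (Suc e) (x \<circ> ?s a m)"
        using last[of m "x \<circ> ?s a m"] am m Suc.prems by simp
      also have "\<dots> = - vand p (Suc e) x"
        using am m Suc.prems by (intro within) auto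
      finally show ?thesis .
    qed
  qed
qed simp

lemma vand_swap:
  assumes "a \<in> {p..<e}" "b \<in> {p..<e}" "a \<noteq> b"
  shows "vand p e (x \<circ> swp a b) = - vand p e x"
proof (cases "a < b")
  case True
  then show ?thesis using vand_swap_aux[of a b e p x] assms by auto
next
  case False
  then show ?thesis using vand_swap_aux[of b a e p x] assms by (auto simp: transpose_commute)
qed

lemma pspan_times_sq:
  assumes "finite I" "i \<in> I" "pspan I K g" "\<And>\<rho>. \<rho> \<in> K \<Longrightarrow> \<rho>(i := Suc (\<rho> i)) \<in> K'"
  shows "pspan I K' (\<lambda>x. (x i)\<^sup>2 * g x)"
  using assms(3)
proof (induction rule: pspan.induct)
  case (add \<nu> g a)
  have "(x i)\<^sup>2 * sqmonom I \<nu> x = sqmonom I (\<nu>(i := Suc (\<nu> i))) x" for x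
  proof -
    have "(\<Prod>j\<in>I - {i}. x j ^ (2 * \<nu> j)) = (\<Prod>j\<in>I - {i}. x j ^ (2 * (\<nu>(i := Suc (\<nu> i))) j))"
      by (intro prod.cong) auto
    then show ?thesis using assms(1,2) by (simp add: sqmonom_def prod.remove[of I i] power2_eq_square)
  qed
  then have "(\<lambda>x. (x i)\<^sup>2 * (a * sqmonom I \<nu> x + g x)) = (\<lambda>x. a * sqmonom I (\<nu>(i := Suc (\<nu> i))) x + (x i)\<^sup>2 * g x)"
    by (simp add: fun_eq_iff distrib_left mult.left_commute)
  then show ?case using add assms(4) by (simp add: pspan.add)
qed (simp add: pspan.zero)

definition vdeg :: "nat \<Rightarrow> nat \<Rightarrow> nat" where
  "vdeg p e = card (pairs {p..<e})"

text \<open>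
  The sum of the \<open>k\<close> largest exponents of the leading monomial \<open>\<Prod>j=p..<e. t\<^sub>j ^ (j - p)\<close> of \<open>vand p e\<close>.
\<close>

definition gbound :: "nat \<Rightarrow> nat \<Rightarrow> nat \<Rightarrow> nat" where
  "gbound p e k = (\<Sum>i<k. e - 1 - i - p)"

lemma vand_pairs: "vand p e x = (\<Prod>(i, j)\<in>pairs {p..<e}. (x j)\<^sup>2 - (x i)\<^sup>2)"
proof -
  have "vand p e x = (\<Prod>(j, i)\<in>(SIGMA j:{p..<e}. {p..<j}). (x j)\<^sup>2 - (x i)\<^sup>2)"
    unfolding vand_def by (rule prod.Sigma) auto
  also have "\<dots> = (\<Prod>(i, j)\<in>pairs {p..<e}. (x j)\<^sup>2 - (x i)\<^sup>2)"
    by (rule prod.reindex_bij_witness[of _ "\<lambda>(i, j). (j, i)" "\<lambda>(j, i). (i, j)"]) (auto simp: pairs_def)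
  finally show ?thesis .
qed

lemma vdeg_eq: "vdeg p e = (\<Sum>j\<in>{p..<e}. j - p)"
proof -
  have "card (pairs {p..<e}) = card (SIGMA j:{p..<e}. {p..<j})"
    by (rule bij_betw_same_card[of "\<lambda>(i, j). (j, i)"], rule bij_betwI[of _ _ _ "\<lambda>(j, i). (i, j)"])
      (auto simp: pairs_def)
  then show ?thesis by (simp add: vdeg_def)
qed

definition meet :: "(nat \<times> nat) set \<Rightarrow> nat set \<Rightarrow> (nat \<times> nat) set" where
  "meet P S = {(i, j). (i, j) \<in> P \<and> (i \<in> S \<or> j \<in> S)}"

lemma finite_meet [simp]: "finite P \<Longrightarrow> finite (meet P S)"
  by (rule finite_subset[of _ P]) (auto simp: meet_def)

text \<open>Expanding the product, every pair gives one exponent to one of its endpoints. Hence the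
  exponents inside \<open>S\<close> add up to at most the number of pairs with an endpoint in
  \<open>S\<close>.\<close>

lemma pspan_prod_pairs:
  assumes I: "finite I" and P: "finite P" "\<And>i j. (i, j) \<in> P \<Longrightarrow> i \<in> I \<and> j \<in> I"
  shows "pspan I {\<nu>. sum \<nu> I = card P \<and> (\<forall>S\<subseteq>I. sum \<nu> S \<le> card (meet P S))}
    (\<lambda>x. \<Prod>(i, j)\<in>P. (x j)\<^sup>2 - (x i)\<^sup>2)"
  using P
proof (induction P rule: finite_induct)
  case empty
  have "sqmonom I (\<lambda>_. 0) x = 1" for x by (simp add: sqmonom_def)
  then have "(\<lambda>x. \<Prod>(i, j)\<in>{}. (x j)\<^sup>2 - (x i)\<^sup>2) = sqmonom I (\<lambda>_. 0)" by (simp add: fun_eq_iff)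
  moreover have "pspan I {\<nu>. sum \<nu> I = card {} \<and> (\<forall>S\<subseteq>I. sum \<nu> S \<le> card (meet {} S))} (sqmonom I (\<lambda>_. 0))"
    by (rule pspan_sqmonom) auto
  ultimately show ?case by simp
next
  case (insert ab P)
  obtain a b where ab: "ab = (a, b)" by (cases ab)
  have abI: "a \<in> I" "b \<in> I" using insert.prems[of a b] ab by auto
  let ?K = "{\<nu>. sum \<nu> I = card P \<and> (\<forall>S\<subseteq>I. sum \<nu> S \<le> card (meet P S))}"
  let ?K' = "{\<nu>. sum \<nu> I = card (insert ab P) \<and> (\<forall>S\<subseteq>I. sum \<nu> S \<le> card (meet (insert ab P) S))}"
  have IH: "pspan I ?K (\<lambda>x. \<Prod>(i, j)\<in>P. (x j)\<^sup>2 - (x i)\<^sup>2)"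
    by (rule insert.IH) (use insert.prems in auto)
  have up: "\<nu>(d := Suc (\<nu> d)) \<in> ?K'" if \<nu>: "\<nu> \<in> ?K" and d: "d = a \<or> d = b" for \<nu> d
  proof -
    have s: "sum (\<nu>(d := Suc (\<nu> d))) S = (if d \<in> S then Suc (sum \<nu> S) else sum \<nu> S)" if "S \<subseteq> I" for S
    proof -
      have fS: "finite S" using that I finite_subset by blast
      have r: "sum (\<nu>(d := Suc (\<nu> d))) (S - {d}) = sum \<nu> (S - {d})" by (intro sum.cong) auto
      show ?thesis using fS r by (cases "d \<in> S") (auto simp: sum.remove[of S d])
    qed
    have "sum (\<nu>(d := Suc (\<nu> d))) S \<le> card (meet (insert ab P) S)" if S: "S \<subseteq> I" for S
    proof -
      have fm: "finite (meet P S)" using insert.hyps by simp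
      have le: "sum \<nu> S \<le> card (meet P S)" using \<nu> S by auto
      show ?thesis
      proof (cases "d \<in> S")
        case True
        then have "meet (insert ab P) S = insert ab (meet P S)" using ab d by (auto simp: meet_def)
        moreover have "ab \<notin> meet P S" using insert.hyps by (auto simp: meet_def)
        ultimately have "card (meet (insert ab P) S) = Suc (card (meet P S))" using fm by simp
        then show ?thesis using s[OF S] True le by simp
      next
        case False
        have "card (meet P S) \<le> card (meet (insert ab P) S)"
          using insert.hyps by (intro card_mono finite_meet) (auto simp: meet_def)
        then show ?thesis using s[OF S] False le by simp
      qed
    qed
    moreover have "sum (\<nu>(d := Suc (\<nu> d))) I = card (insert ab P)"
    proof -
      have "d \<in> I" using d abI by auto
      moreover have "sum \<nu> I = card P" using \<nu> by simp
      ultimately show ?thesis using s[of I] insert.hyps by simp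
    qed
    ultimately show ?thesis by simp
  qed
  have "pspan I ?K' (\<lambda>x. (x b)\<^sup>2 * (\<Prod>(i, j)\<in>P. (x j)\<^sup>2 - (x i)\<^sup>2) - (x a)\<^sup>2 * (\<Prod>(i, j)\<in>P. (x j)\<^sup>2 - (x i)\<^sup>2))"
    by (intro pspan_diff pspan_times_sq[OF I _ IH] abI) (use up in blast)+
  then show ?case using insert.hyps by (simp add: ab left_diff_distrib)
qed

text \<open>Viewing pairs as edges of a complete graph, a new vertex \<open>a\<close> adds only the
  edges to the vertices not yet chosen, and of those there are
  \<open>e - 1 - card S - p\<close>.\<close>

lemma card_meet_le:
  assumes "finite S" "S \<subseteq> {p..<e}"
  shows "card (meet (pairs {p..<e}) S) \<le> gbound p e (card S)"
  using assms
proof (induction S rule: finite_induct)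
  case empty
  then show ?case by (simp add: meet_def gbound_def)
next
  case (insert a S)
  let ?A = "{p..<e}"
  have sub: "meet (pairs ?A) (insert a S) \<subseteq> meet (pairs ?A) S \<union> (\<lambda>b. (min a b, max a b)) ` (?A - insert a S)"
  proof
    fix z assume "z \<in> meet (pairs ?A) (insert a S)"
    then obtain i j where z: "z = (i, j)" "i < j" "i \<in> ?A" "j \<in> ?A" "i \<in> insert a S \<or> j \<in> insert a S"
      by (auto simp: meet_def pairs_def)
    show "z \<in> meet (pairs ?A) S \<union> (\<lambda>b. (min a b, max a b)) ` (?A - insert a S)"
    proof (cases "i \<in> S \<or> j \<in> S")
      case True
      then show ?thesis using z by (auto simp: meet_def pairs_def)
    next
      case False
      then consider "i = a" | "j = a" using z by auto
      then show ?thesis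
      proof cases
        case 1
        then show ?thesis using z False by (intro UnI2 image_eqI[of _ _ j]) auto
      next
        case 2
        then show ?thesis using z False by (intro UnI2 image_eqI[of _ _ i]) auto
      qed
    qed
  qed
  have fin: "finite (meet (pairs ?A) S)" by simp
  have "card (meet (pairs ?A) (insert a S)) \<le> card (meet (pairs ?A) S \<union> (\<lambda>b. (min a b, max a b)) ` (?A - insert a S))"
    using sub fin by (intro card_mono) auto
  also have "\<dots> \<le> card (meet (pairs ?A) S) + card ((\<lambda>b. (min a b, max a b)) ` (?A - insert a S))"
    by (rule card_Un_le)
  also have "\<dots> \<le> gbound p e (card S) + card (?A - insert a S)"
    using insert by (intro add_mono card_image_le) auto
  also have "card (?A - insert a S) = e - 1 - card S - p"
    using insert.hyps insert.prems by (subst card_Diff_subset) auto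
  finally show ?case using insert.hyps by (simp add: gbound_def)
qed

text \<open>Indices below \<open>p\<close> lie in no pair, so only the part of \<open>S\<close>
  inside \<open>{p..<e}\<close> counts, and \<open>gbound\<close> is monotone in the
  cardinality.\<close>

lemma vand_pspan:
  assumes "s \<le> p" "p \<le> e"
  shows "pspan {s..<e} (dominated {s..<e} (gbound p e) (vdeg p e)) (vand p e)"
proof -
  have "card (meet (pairs {p..<e}) S) \<le> gbound p e (card S)" if S: "S \<subseteq> {s..<e}" for S
  proof -
    have fS: "finite S" using S finite_subset by blast
    have "meet (pairs {p..<e}) S = meet (pairs {p..<e}) (S \<inter> {p..<e})" by (auto simp: meet_def pairs_def)
    then have "card (meet (pairs {p..<e}) S) \<le> gbound p e (card (S \<inter> {p..<e}))"
      using card_meet_le[of "S \<inter> {p..<e}" p e] fS by simp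
    also have "\<dots> \<le> gbound p e (card S)"
      unfolding gbound_def using card_mono[OF fS Int_lower1, of "{p..<e}"] by (intro sum_mono2) auto
    finally show ?thesis .
  qed
  then have "{\<nu>. sum \<nu> {s..<e} = card (pairs {p..<e}) \<and> (\<forall>S\<subseteq>{s..<e}. sum \<nu> S \<le> card (meet (pairs {p..<e}) S))}
     \<subseteq> dominated {s..<e} (gbound p e) (vdeg p e)"
    unfolding dominated_def vdeg_def by (auto intro: order_trans)
  moreover have "pspan {s..<e} {\<nu>. sum \<nu> {s..<e} = card (pairs {p..<e}) \<and> (\<forall>S\<subseteq>{s..<e}. sum \<nu> S \<le> card (meet (pairs {p..<e}) S))}
     (\<lambda>x. \<Prod>(i, j)\<in>pairs {p..<e}. (x j)\<^sup>2 - (x i)\<^sup>2)"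
    using assms by (intro pspan_prod_pairs finite_pairs) (auto simp: pairs_def)
  ultimately show ?thesis
    using pspan_subset by (simp add: vand_pairs[abs_def])
qed

text \<open>Remove the maximum, which is at least \<open>card X - 1\<close>; equality of the sums
  forces it to be exactly that. Applied to exponents that are pairwise distinct, this bounds the
  degree of alternating polynomials from below.\<close>

lemma card_sum_le_aux:
  assumes "finite (X :: nat set)"
  shows "\<Sum>{..<card X} \<le> \<Sum>X" "\<Sum>X \<le> \<Sum>{..<card X} \<Longrightarrow> X = {..<card X}"
proof -
  have "\<Sum>{..<card X} \<le> \<Sum>X \<and> (\<Sum>X \<le> \<Sum>{..<card X} \<longrightarrow> X = {..<card X})"
    using assms
  proof (induction "card X" arbitrary: X)
    case (Suc n)
    then have ne: "X \<noteq> {}" by auto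
    define M where "M = Max X"
    have M: "M \<in> X" unfolding M_def using Suc ne by simp
    have le: "X \<subseteq> {..M}" unfolding M_def using Suc by auto
    have cM: "Suc n \<le> Suc M" using card_mono[OF _ le] Suc(2) by simp
    have IH: "\<Sum>{..<n} \<le> \<Sum>(X - {M})" "\<Sum>(X - {M}) \<le> \<Sum>{..<n} \<longrightarrow> X - {M} = {..<n}"
    proof -
      have cn: "n = card (X - {M})" using Suc(2,3) M by simp
      have "finite (X - {M})" using Suc(3) by simp
      from Suc(1)[OF cn this] show "\<Sum>{..<n} \<le> \<Sum>(X - {M})" "\<Sum>(X - {M}) \<le> \<Sum>{..<n} \<longrightarrow> X - {M} = {..<n}"
        unfolding cn[symmetric] by blast+
    qed
    have sX: "\<Sum>X = M + \<Sum>(X - {M})" using M Suc(3) by (simp add: sum.remove)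
    have sN: "\<Sum>{..<card X} = n + \<Sum>{..<n}" unfolding Suc(2)[symmetric] by simp
    show ?case
    proof (intro conjI impI)
      show "\<Sum>{..<card X} \<le> \<Sum>X" using sX sN IH(1) cM by linarith
      assume "\<Sum>X \<le> \<Sum>{..<card X}"
      then have "M = n" "\<Sum>(X - {M}) \<le> \<Sum>{..<n}" using sX sN IH(1) cM by linarith+
      then have "X - {n} = {..<n}" "n \<in> X" using IH(2) M by auto
      then have "X = insert n {..<n}" by auto
      then show "X = {..<card X}" unfolding Suc(2)[symmetric] by (simp add: lessThan_Suc)
    qed
  qed simp
  then show "\<Sum>{..<card X} \<le> \<Sum>X" "\<Sum>X \<le> \<Sum>{..<card X} \<Longrightarrow> X = {..<card X}" by auto
qed

lemma vdeg_lessThan: "vdeg p e = \<Sum>{..<e - p}"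
proof -
  have "(\<Sum>j\<in>{p..<e}. j - p) = (\<Sum>j<e - p. j)"
    by (rule sum.reindex_bij_witness[of _ "\<lambda>j. j + p" "\<lambda>j. j - p"]) auto
  then show ?thesis by (simp add: vdeg_eq)
qed

section \<open>The shift of the exponent\<close>

lemma pspan_tendsto:
  "pspan I K h \<Longrightarrow> (\<And>i. i \<in> I \<Longrightarrow> (\<lambda>n. X n i) \<longlonglongrightarrow> y i) \<Longrightarrow> (\<lambda>n. h (X n)) \<longlonglongrightarrow> h y"
proof (induction rule: pspan.induct)
  case (add \<nu> g a)
  have "(\<lambda>n. sqmonom I \<nu> (X n)) \<longlonglongrightarrow> sqmonom I \<nu> y"
    unfolding sqmonom_def using add by (intro tendsto_intros) auto
  then show ?case using add by (intro tendsto_intros) auto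
qed simp

lemma weight_tendsto:
  assumes "0 < c" "0 < g" and X: "\<And>i. i \<in> I \<Longrightarrow> (\<lambda>n. X n i) \<longlonglongrightarrow> y i"
  shows "(\<lambda>n. weight I c g (X n)) \<longlonglongrightarrow> weight I c g y"
  unfolding weight_def
proof (intro tendsto_mult tendsto_prod)
  show "(\<lambda>n. \<bar>X n i\<bar> powr (2 * c)) \<longlonglongrightarrow> \<bar>y i\<bar> powr (2 * c)" if "i \<in> I" for i
    using X[OF that] assms(1) by (intro tendsto_powr2 tendsto_intros) auto
  show "(\<lambda>n. case ij of (i, j) \<Rightarrow> \<bar>(X n i)\<^sup>2 - (X n j)\<^sup>2\<bar> powr (2 * g)) \<longlonglongrightarrow> (case ij of (i, j) \<Rightarrow> \<bar>(y i)\<^sup>2 - (y j)\<^sup>2\<bar> powr (2 * g))"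
    if "ij \<in> pairs I" for ij
    using that X assms(2) by (cases ij) (auto simp: pairs_def intro!: tendsto_powr2 tendsto_intros)
qed

lemma weight_nonneg: "0 \<le> weight I c g x"
  unfolding weight_def by (intro mult_nonneg_nonneg prod_nonneg) auto

lemma emeasure_std_normal_pos:
  assumes "a < b" shows "emeasure std_normal {a<..<b} \<noteq> 0"
proof
  assume "emeasure std_normal {a<..<b} = 0"
  then have "{a<..<b} \<in> null_sets std_normal" by (auto intro: null_setsI)
  then have "AE x in lborel. x \<in> {a<..<b} \<longrightarrow> ennreal (std_normal_density x) = 0"
    unfolding std_normal_def by (subst (asm) null_sets_density_iff) auto
  moreover have "std_normal_density x > 0" for x by (rule normal_density_pos) simp
  ultimately have "AE x in lborel. x \<notin> {a<..<b}"
    by (elim AE_mp) (auto intro!: AE_I2 simp: ennreal_eq_0_iff dest: leD)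
  then have "{a<..<b} \<in> null_sets lborel" by (subst (asm) AE_iff_null_sets[symmetric]) auto
  then show False using assms by (auto simp: null_sets_def)
qed

text \<open>Every box around \<open>y\<close> has positive Gaussian measure and therefore contains a
  point with \<open>P\<close>. The property may fail at \<open>y\<close> itself; continuity has to
  carry the conclusion there.\<close>

lemma AE_gauss_dense:
  assumes I: "finite I" and ae: "AE x in gauss I. P x"
  shows "\<exists>X. (\<forall>n. P (X n)) \<and> (\<forall>i\<in>I. (\<lambda>n. X n i) \<longlonglongrightarrow> y i)"
proof -
  have "\<exists>x. P x \<and> (\<forall>i\<in>I. \<bar>x i - y i\<bar> < inverse (real (Suc n)))" for n
  proof (rule ccontr)
    define \<delta> where "\<delta> = inverse (real (Suc n))"
    have \<delta>: "0 < \<delta>" by (simp add: \<delta>_def)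
    assume "\<not> ?thesis"
    then have neg: "\<not> P x" if "\<forall>i\<in>I. \<bar>x i - y i\<bar> < \<delta>" for x using that unfolding \<delta>_def by blast
    define B where "B = (\<Pi>\<^sub>E i\<in>I. {y i - \<delta> <..< y i + \<delta>})"
    have B: "B \<in> sets (gauss I)" unfolding B_def gauss_def using I by (intro sets_PiM_I_finite) auto
    have "AE x in gauss I. x \<notin> B"
      using ae
    proof (rule AE_mp, intro AE_I2 impI notI)
      fix x assume "P x" "x \<in> B"
      moreover have "\<forall>i\<in>I. \<bar>x i - y i\<bar> < \<delta>"
      proof
        fix i assume "i \<in> I"
        then have "x i \<in> {y i - \<delta> <..< y i + \<delta>}" using \<open>x \<in> B\<close> unfolding B_def by (rule PiE_mem[rotated])
        then show "\<bar>x i - y i\<bar> < \<delta>" by (auto simp: abs_less_iff)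
      qed
      ultimately show False using neg by blast
    qed
    then have "emeasure (gauss I) B = 0" using B by (subst (asm) AE_iff_null_sets[symmetric]) auto
    moreover have "emeasure (gauss I) B = (\<Prod>i\<in>I. emeasure std_normal {y i - \<delta> <..< y i + \<delta>})"
      unfolding B_def gauss_def using I by (intro gaussS.emeasure_PiM) auto
    ultimately have "\<exists>i\<in>I. emeasure std_normal {y i - \<delta> <..< y i + \<delta>} = 0" using I by simp
    then show False using emeasure_std_normal_pos \<delta> by fastforce
  qed
  then obtain X where X: "\<And>n. P (X n)" "\<And>n i. i \<in> I \<Longrightarrow> \<bar>X n i - y i\<bar> < inverse (real (Suc n))" by metis
  have "(\<lambda>n. X n i) \<longlonglongrightarrow> y i" if "i \<in> I" for i
  proof (rule LIM_zero_cancel, rule Lim_null_comparison[OF _ LIMSEQ_inverse_real_of_nat])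
    show "\<forall>\<^sub>F n in sequentially. norm (X n i - y i) \<le> inverse (real (Suc n))"
      using X(2)[OF that] by (auto intro!: always_eventually less_imp_le)
  qed
  then show ?thesis using X(1) by blast
qed

text \<open>The square of \<open>h\<close> times the weight is 0 almost everywhere, hence everywhere
  by continuity. At \<open>x j = R ^ j\<close> the coordinates are nonzero with distinct squares, so
  the weight is positive there.\<close>

lemma pspan_eq_0_of_wint_eq_0:
  assumes I: "finite I" and c: "0 < c" and g: "1 \<le> g" and h: "pspan I K h"
    and z: "wint I c g (\<lambda>x. h x * h x) = 0" and R: "1 < R"
  shows "h (\<lambda>j. R ^ j) = 0"
proof -
  let ?y = "\<lambda>j. R ^ j"
  define F where "F x = h x * h x * weight I c g x" for x
  have pb: "poly_bounded I h" by (rule pspan_poly_bounded[OF I h])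
  have "integrable (gauss I) F"
    unfolding F_def using I c g pb by (intro integrable_wint poly_bounded_mult) auto
  then have "AE x in gauss I. F x = 0"
    using z integral_nonneg_eq_0_iff_AE[of "gauss I" F] by (simp add: wint_def F_def[abs_def] weight_nonneg)
  from AE_gauss_dense[OF I this, of ?y] obtain X where X: "\<And>n. F (X n) = 0"
    "\<And>i. i \<in> I \<Longrightarrow> (\<lambda>n. X n i) \<longlonglongrightarrow> R ^ i" by blast
  have "(\<lambda>n. F (X n)) \<longlonglongrightarrow> F ?y"
    unfolding F_def using X(2) c g h by (intro tendsto_mult pspan_tendsto[OF h] weight_tendsto) auto
  then have "F ?y = 0" using X(1) by (simp add: LIMSEQ_const_iff)
  moreover have "weight I c g ?y \<noteq> 0"
  proof -
    have "R ^ i \<noteq> 0" for i using R by simp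
    moreover have "(R ^ i)\<^sup>2 \<noteq> (R ^ j)\<^sup>2" if "i < j" for i j
      using that R by (simp add: power_mult[symmetric] power_inject_exp)
    ultimately have "0 < weight I c g ?y"
      unfolding weight_def by (intro mult_pos_pos prod_pos) (auto simp: pairs_def)
    then show ?thesis by simp
  qed
  ultimately show ?thesis by (simp add: F_def)
qed

section \<open>Orthogonality of the Vandermonde product, leading coefficients and the shift
  factor\<close>

context
  fixes s p e :: nat and c g :: real
  assumes sp: "s \<le> p" and pe: "p \<le> e" and c: "0 < c" and g: "1 \<le> g"
begin

private definition I where "I = {s..<e}"
private definition A where "A = {p..<e}"
text \<open>Truncated subtraction gives exponent 0 to the indices below \<open>p\<close>, so this is
  the leading exponent of \<open>vand p e\<close> on all of \<open>I\<close>.\<close>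

private definition \<mu> :: "nat \<Rightarrow> nat" where "\<mu> j = j - p"
private definition C where "C = dominated I (gbound p e) (vdeg p e)"

private lemma fin: "finite I" "finite A" "A \<subseteq> I"
  using sp by (auto simp: I_def A_def)

text \<open>Symmetry is demanded on \<open>A\<close> only, where \<open>vand p e\<close> alternates.
  Both the constant 1 and \<open>sqprod {k0..<e}\<close> with \<open>k0 \<le> p\<close>
  qualify.\<close>

private definition sym where
  "sym q \<longleftrightarrow> poly_bounded I q \<and> (\<forall>a\<in>A. \<forall>b\<in>A. \<forall>x. q (x \<circ> swp a b) = q x)"

private lemma f_pspan: "pspan I C (vand p e)"
  unfolding I_def C_def by (rule vand_pspan[OF sp pe])

private lemma f_bounded: "poly_bounded I (vand p e)"
  by (rule pspan_poly_bounded[OF fin(1) f_pspan])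

private lemma wint_antisym:
  assumes ab: "a \<in> A" "b \<in> A" "a \<noteq> b" and q: "sym q"
  shows "wint I c g (\<lambda>x. q x * sqmonom I (\<rho> \<circ> swp a b) x * vand p e x) =
     - wint I c g (\<lambda>x. q x * sqmonom I \<rho> x * vand p e x)"
proof -
  have abI: "a \<in> I" "b \<in> I" using ab fin by auto
  have "(\<lambda>x. q x * sqmonom I \<rho> x * vand p e x) \<in> borel_measurable (gauss I)"
    using q f_bounded fin by (intro measurable_poly_bounded poly_bounded_mult poly_bounded_sqmonom) (auto simp: sym_def)
  from wint_swap[OF fin(1) abI this, of c g]
  have "wint I c g (\<lambda>x. (-1) * (q x * sqmonom I (\<rho> \<circ> swp a b) x * vand p e x)) =
      wint I c g (\<lambda>x. q x * sqmonom I \<rho> x * vand p e x)"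
    using q ab vand_swap[of a p e b] by (simp add: sqmonom_swap[OF abI] sym_def A_def)
  then show ?thesis unfolding wint_cmult by simp
qed

private lemma wint_repeated:
  assumes "a \<in> A" "b \<in> A" "a \<noteq> b" "\<rho> a = \<rho> b" "sym q"
  shows "wint I c g (\<lambda>x. q x * sqmonom I \<rho> x * vand p e x) = 0"
proof -
  have "\<rho> \<circ> swp a b = \<rho>" using assms(4) by (auto simp: fun_eq_iff Transposition.transpose_def)
  then show ?thesis using wint_antisym[OF assms(1-3,5), of \<rho>] by simp
qed

private lemma inj_sum:
  assumes "inj_on \<rho> A"
  shows "vdeg p e \<le> sum \<rho> A" "sum \<rho> A \<le> vdeg p e \<Longrightarrow> \<rho> ` A = {..<e - p}"
proof -
  have "card (\<rho> ` A) = e - p" using assms by (simp add: card_image A_def)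
  moreover have "\<Sum>(\<rho> ` A) = sum \<rho> A" using assms by (simp add: sum.reindex)
  ultimately show "vdeg p e \<le> sum \<rho> A" "sum \<rho> A \<le> vdeg p e \<Longrightarrow> \<rho> ` A = {..<e - p}"
    using card_sum_le_aux[of "\<rho> ` A"] fin unfolding vdeg_lessThan by auto
qed

private lemma sumAI: "sum \<rho> A \<le> sum \<rho> I" for \<rho> :: "nat \<Rightarrow> nat"
  using fin by (intro sum_mono2) auto

text \<open>Below the degree of \<open>vand p e\<close> two exponents on \<open>A\<close> must
  coincide, and then the integrand changes sign under the transposition of those two
  indices.\<close>

private lemma wint_low_degree:
  assumes "sum \<rho> I < vdeg p e" "sym q"
  shows "wint I c g (\<lambda>x. q x * sqmonom I \<rho> x * vand p e x) = 0"
proof -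
  have "\<not> inj_on \<rho> A" using inj_sum(1)[of \<rho>] sumAI[of \<rho>] assms by linarith
  then obtain a b where "a \<in> A" "b \<in> A" "a \<noteq> b" "\<rho> a = \<rho> b" unfolding inj_on_def by blast
  then show ?thesis by (rule wint_repeated) (rule assms)
qed

text \<open>The factor is the sign of \<open>\<sigma>\<close>. The quantifier over \<open>q\<close>
  stands inside the existential because one factor has to serve several \<open>q\<close>, whose
  integrals are compared later.\<close>

private lemma wint_permuted:
  assumes "\<sigma> permutes A"
  shows "\<exists>\<epsilon>. \<forall>q. sym q \<longrightarrow> wint I c g (\<lambda>x. q x * sqmonom I (\<mu> \<circ> \<sigma>) x * vand p e x)
    = \<epsilon> * wint I c g (\<lambda>x. q x * sqmonom I \<mu> x * vand p e x)"
  using fin(2) assms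
proof (induction rule: permutes_rev_induct)
  case id
  show ?case by (rule exI[of _ 1]) simp
next
  case (swap a b \<sigma>)
  then obtain \<epsilon> where "\<And>q. sym q \<Longrightarrow> wint I c g (\<lambda>x. q x * sqmonom I (\<mu> \<circ> \<sigma>) x * vand p e x)
    = \<epsilon> * wint I c g (\<lambda>x. q x * sqmonom I \<mu> x * vand p e x)" by blast
  then have "wint I c g (\<lambda>x. q x * sqmonom I (\<mu> \<circ> (\<sigma> \<circ> swp a b)) x * vand p e x)
    = - \<epsilon> * wint I c g (\<lambda>x. q x * sqmonom I \<mu> x * vand p e x)" if "sym q" for q
    using wint_antisym[OF swap(1-3) that, of "\<mu> \<circ> \<sigma>"] that unfolding comp_assoc by simp
  then show ?case by blast
qed

text \<open>In the least possible degree, distinct exponents on \<open>A\<close> must be 0, ...,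
  \<open>e - p - 1\<close> in some order and leave exponent 0 elsewhere, so the monomial is a
  permutation of the leading one. Coinciding exponents give the factor 0.\<close>

private lemma wint_top_degree:
  assumes "sum \<rho> I = vdeg p e"
  shows "\<exists>\<epsilon>. \<forall>q. sym q \<longrightarrow> wint I c g (\<lambda>x. q x * sqmonom I \<rho> x * vand p e x)
    = \<epsilon> * wint I c g (\<lambda>x. q x * sqmonom I \<mu> x * vand p e x)"
proof (cases "inj_on \<rho> A")
  case False
  then obtain a b where "a \<in> A" "b \<in> A" "a \<noteq> b" "\<rho> a = \<rho> b" unfolding inj_on_def by blast
  then show ?thesis using wint_repeated by (intro exI[of _ 0]) simp
next
  case True
  have img: "\<rho> ` A = {..<e - p}" using inj_sum(2)[OF True] sumAI[of \<rho>] assms by simp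
  have z: "\<rho> j = 0" if "j \<in> I - A" for j
  proof -
    have "sum \<rho> I = sum \<rho> A + sum \<rho> (I - A)" using fin by (simp add: sum.subset_diff[of A I])
    then have "sum \<rho> (I - A) = 0" using inj_sum(1)[OF True] assms by simp
    then show ?thesis using that fin by simp
  qed
  define \<sigma> where "\<sigma> j = (if j \<in> A then p + \<rho> j else j)" for j
  have bij: "bij_betw \<sigma> A A"
  proof (rule bij_betw_imageI)
    show "inj_on \<sigma> A" using True by (auto simp: \<sigma>_def inj_on_def)
    have "\<sigma> ` A = (\<lambda>k. p + k) ` (\<rho> ` A)" by (auto simp: \<sigma>_def)
    also have "\<dots> = (+) p ` {0..<e - p}" unfolding img by (simp add: lessThan_atLeast0)
    also have "\<dots> = A" using pe unfolding A_def by (simp add: image_add_atLeastLessThan)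
    finally show "\<sigma> ` A = A" .
  qed
  then have perm: "\<sigma> permutes A"
    by (rule bij_imp_permutes) (simp add: \<sigma>_def)
  have "sqmonom I \<rho> x = sqmonom I (\<mu> \<circ> \<sigma>) x" for x
  proof -
    have "\<rho> j = (\<mu> \<circ> \<sigma>) j" if "j \<in> I" for j
      using z[of j] that by (auto simp: \<sigma>_def \<mu>_def A_def I_def)
    then show ?thesis by (simp add: sqmonom_def)
  qed
  then show ?thesis using wint_permuted[OF perm] by simp
qed

private definition top :: nat where "top = (\<Sum>j\<in>I. j * (2 * \<mu> j))"

text \<open>
  Along \<open>x j = R ^ j\<close> the leading monomial strictly dominates every other monomial in \<open>C\<close>, so \<open>lead\<close>
  reads off its coefficient, and no uniqueness of polynomial coefficients is needed.
\<close>

private definition lead where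
  "lead h v \<longleftrightarrow> ((\<lambda>R. h (\<lambda>j. R ^ j) / R ^ top) \<longlongrightarrow> (v::real)) at_top"

private lemma lead_add: "lead h v \<Longrightarrow> lead h' v' \<Longrightarrow> lead (\<lambda>x. h x + h' x) (v + v')"
  unfolding lead_def by (simp add: add_divide_distrib tendsto_add)

private lemma lead_cmult: "lead h v \<Longrightarrow> lead (\<lambda>x. a * h x) (a * v)"
  unfolding lead_def using tendsto_mult_left[of "\<lambda>R. h (\<lambda>j. R ^ j) / R ^ top" v at_top a] by simp

private lemma lead_unique: "lead h v \<Longrightarrow> lead h v' \<Longrightarrow> v = v'"
  unfolding lead_def by (rule tendsto_unique[OF trivial_limit_at_top_linorder])

private lemma gbound_tail: "s \<le> k \<Longrightarrow> k \<le> e \<Longrightarrow> gbound p e (card {k..<e}) = (\<Sum>j=k..<e. \<mu> j)"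
  unfolding gbound_def \<mu>_def
  by (rule sum.reindex_bij_witness[of _ "\<lambda>j. e - 1 - j" "\<lambda>j. e - 1 - j"]) auto

private lemma power_ratio_0: "a < b \<Longrightarrow> ((\<lambda>R::real. R ^ a / R ^ b) \<longlongrightarrow> 0) at_top"
proof -
  assume "a < b"
  have "((\<lambda>R::real. inverse (R ^ (b - a))) \<longlongrightarrow> 0) at_top"
    using \<open>a < b\<close> by (intro tendsto_inverse_0_at_top filterlim_pow_at_top filterlim_ident) auto
  moreover have "eventually (\<lambda>R::real. inverse (R ^ (b - a)) = R ^ a / R ^ b) at_top"
    using eventually_gt_at_top[of 0] by eventually_elim (use \<open>a < b\<close> in \<open>simp add: power_diff field_simps\<close>)
  ultimately show ?thesis by (simp add: filterlim_cong)
qed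

text \<open>At \<open>x j = R ^ j\<close> a monomial is a power of \<open>R\<close> with exponent a
  weighted sum of \<open>\<nu>\<close>. Membership in \<open>C\<close> bounds all tails of
  \<open>\<nu>\<close> by those of \<open>\<mu>\<close>, so the power is strictly smaller unless
  both agree on \<open>I\<close>.\<close>

private lemma lead_sqmonom:
  assumes "\<nu> \<in> C"
  shows "lead (sqmonom I \<nu>) (if \<forall>j\<in>I. \<nu> j = \<mu> j then 1 else 0)"
proof -
  have sq: "sqmonom I \<nu> (\<lambda>j. R ^ j) = R ^ (\<Sum>j\<in>I. j * (2 * \<nu> j))" for R :: real
    by (simp add: sqmonom_def power_sum power_mult)
  show ?thesis
  proof (cases "\<forall>j\<in>I. \<nu> j = \<mu> j")
    case True
    then have "(\<Sum>j\<in>I. j * (2 * \<nu> j)) = top" by (simp add: top_def)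
    moreover have "((\<lambda>R::real. R ^ top / R ^ top) \<longlongrightarrow> 1) at_top"
    proof -
      have "eventually (\<lambda>R::real. 1 = R ^ top / R ^ top) at_top"
        using eventually_gt_at_top[of 0] by eventually_elim simp
      then show ?thesis using tendsto_cong[of "\<lambda>_. 1" "\<lambda>R::real. R ^ top / R ^ top" at_top 1] by simp
    qed
    ultimately show ?thesis using True by (simp add: lead_def sq)
  next
    case False
    then obtain j0 where j0: "j0 \<in> {s..<e}" "\<nu> j0 \<noteq> \<mu> j0" by (auto simp: I_def)
    have tot: "(\<Sum>j=s..<e. \<nu> j) = (\<Sum>j=s..<e. \<mu> j)"
    proof -
      have "(\<Sum>j=s..<e. \<mu> j) = (\<Sum>j=p..<e. \<mu> j)"
        using sp by (intro sum.mono_neutral_right) (auto simp: \<mu>_def)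
      then show ?thesis using assms by (simp add: C_def dominated_def I_def vdeg_eq \<mu>_def)
    qed
    have "(\<Sum>j=s..<e. j * \<nu> j) < (\<Sum>j=s..<e. j * \<mu> j)"
    proof (rule weighted_sum_strict[OF _ tot _ j0])
      fix k assume k: "s \<le> k" "k < e"
      then have "{k..<e} \<subseteq> I" by (auto simp: I_def)
      then have "sum \<nu> {k..<e} \<le> gbound p e (card {k..<e})"
        using assms unfolding C_def dominated_def by blast
      then show "(\<Sum>j=k..<e. \<nu> j) \<le> (\<Sum>j=k..<e. \<mu> j)" using gbound_tail[of k] k by simp
    qed (use sp pe in simp)
    then have "(\<Sum>j\<in>I. j * (2 * \<nu> j)) < top"
      by (simp add: top_def I_def mult.left_commute[of _ 2] flip: sum_distrib_left)
    then show ?thesis using False power_ratio_0 by (auto simp: lead_def sq)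
  qed
qed

private lemma C_swap:
  assumes "\<nu> \<in> C" "i \<in> I" "l \<in> I"
  shows "\<nu> \<circ> swp i l \<in> C"
proof (cases "i = l")
  case False
  show ?thesis unfolding C_def
    by (rule dominated_squeeze[OF fin(1) assms(2,3) False assms(1)[unfolded C_def]])
       (auto simp: Transposition.transpose_def)
qed (use assms in simp)

private definition ev where "ev k = 1 + 2 * c + 2 * real (\<mu> k) + 2 * g * real (k - s)"

text \<open>The coefficient \<open>\<tau> l R\<close> of the divided difference tends to 1 for
  \<open>l < k\<close> and to 0 for \<open>l > k\<close>. For \<open>l < k\<close> the transposed
  copy it subtracts is returned by the reflection over \<open>I - {k..<e}\<close>, so each such
  \<open>l\<close> contributes \<open>2 * g * v\<close> and larger \<open>l\<close> contribute
  nothing.\<close>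

private lemma lead_raise:
  assumes \<nu>: "\<nu> \<in> C" and k: "k \<in> I" and v: "lead (sqmonom I \<nu>) v"
  shows "lead (raise_op I c g {k..<e} k \<nu>) (ev k * v)"
proof -
  have v01: "v = (if \<forall>j\<in>I. \<nu> j = \<mu> j then 1 else 0)" by (rule lead_unique[OF v lead_sqmonom[OF \<nu>]])
  define m where "m R = sqmonom I \<nu> (\<lambda>j. R ^ j) / R ^ top" for R :: real
  define ms where "ms l R = sqmonom I \<nu> ((\<lambda>j. R ^ j) \<circ> swp k l) / R ^ top" for l and R :: real
  define w where "w l = (if \<forall>j\<in>I. (\<nu> \<circ> swp k l) j = \<mu> j then 1 else 0 :: real)" for l
  have m: "(m \<longlongrightarrow> v) at_top" using v unfolding lead_def m_def[abs_def] .
  have ms: "(ms l \<longlongrightarrow> w l) at_top" if "l \<in> I" for l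
    using lead_sqmonom[OF C_swap[OF \<nu> k that]] sqmonom_swap[OF k that, of \<nu>]
    by (simp add: lead_def ms_def[abs_def] w_def)
  define \<tau> where "\<tau> l R = (R ^ k)\<^sup>2 / ((R ^ k)\<^sup>2 - (R ^ l)\<^sup>2)" for l and R :: real
  have \<tau>_less: "(\<tau> l \<longlongrightarrow> 1) at_top" if "l < k" for l
  proof -
    have "((\<lambda>R::real. 1 / (1 - R ^ (2 * l) / R ^ (2 * k))) \<longlongrightarrow> 1 / (1 - 0)) at_top"
      using that by (intro tendsto_intros power_ratio_0) auto
    moreover have "eventually (\<lambda>R. 1 / (1 - R ^ (2 * l) / R ^ (2 * k)) = \<tau> l R) at_top"
      using eventually_gt_at_top[of 0]
      by eventually_elim (simp add: \<tau>_def power_mult[symmetric] mult.commute divide_simps)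
    ultimately show ?thesis by (simp add: filterlim_cong)
  qed
  have \<tau>_greater: "(\<tau> l \<longlongrightarrow> 0) at_top" if "k < l" for l
  proof -
    have "((\<lambda>R::real. (R ^ (2 * k) / R ^ (2 * l)) / (R ^ (2 * k) / R ^ (2 * l) - 1)) \<longlongrightarrow> 0 / (0 - 1)) at_top"
      using that by (intro tendsto_intros power_ratio_0) auto
    moreover have "eventually (\<lambda>R. (R ^ (2 * k) / R ^ (2 * l)) / (R ^ (2 * k) / R ^ (2 * l) - 1) = \<tau> l R) at_top"
      using eventually_gt_at_top[of 0]
      by eventually_elim (simp add: \<tau>_def power_mult[symmetric] mult.commute divide_simps)
    ultimately show ?thesis by (simp add: filterlim_cong)
  qed
  have IS: "I - {k..<e} = {s..<k}" "I - {k} = {s..<k} \<union> {k<..<e}" using k by (auto simp: I_def)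
  have eq: "eventually (\<lambda>R. (1 + 2 * c + 2 * real (\<nu> k)) * m R
       + 2 * g * ((\<Sum>l\<in>{s..<k}. \<tau> l R * (m R - ms l R) + ms l R) + (\<Sum>l\<in>{k<..<e}. \<tau> l R * (m R - ms l R)))
      = raise_op I c g {k..<e} k \<nu> (\<lambda>j. R ^ j) / R ^ top) at_top"
    using eventually_gt_at_top[of 1]
  proof eventually_elim
    case (elim R)
    have dd: "(R ^ k)\<^sup>2 * divdiff I k l \<nu> (\<lambda>j. R ^ j) / R ^ top = \<tau> l R * (m R - ms l R)" if l: "l \<in> I - {k}" for l
    proof -
      have kl: "k \<noteq> l" "l \<in> I" using l by auto
      have "R ^ (2 * k) \<noteq> R ^ (2 * l)" using kl elim by (simp add: power_inject_exp)
      then have ne: "(R ^ k)\<^sup>2 - (R ^ l)\<^sup>2 \<noteq> 0" by (simp add: power_mult[symmetric] mult.commute)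
      have "m R - ms l R = ((R ^ k)\<^sup>2 - (R ^ l)\<^sup>2) * (divdiff I k l \<nu> (\<lambda>j. R ^ j) / R ^ top)"
        unfolding m_def ms_def diff_divide_distrib[symmetric] divdiff[OF fin(1) k kl(2) kl(1)] by simp
      then show ?thesis using ne by (simp add: \<tau>_def)
    qed
    have "raise_op I c g {k..<e} k \<nu> (\<lambda>j. R ^ j) / R ^ top = (1 + 2 * c + 2 * real (\<nu> k)) * m R
       + 2 * g * (\<Sum>l\<in>I-{k}. (R ^ k)\<^sup>2 * divdiff I k l \<nu> (\<lambda>j. R ^ j) / R ^ top) + 2 * g * (\<Sum>l\<in>{s..<k}. ms l R)"
      unfolding raise_op_def IS(1) m_def ms_def
      by (simp add: add_divide_distrib sum_divide_distrib flip: times_divide_eq_right)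
    also have "(\<Sum>l\<in>I-{k}. (R ^ k)\<^sup>2 * divdiff I k l \<nu> (\<lambda>j. R ^ j) / R ^ top) = (\<Sum>l\<in>I-{k}. \<tau> l R * (m R - ms l R))"
      by (intro sum.cong refl dd)
    also have "\<dots> = (\<Sum>l\<in>{s..<k}. \<tau> l R * (m R - ms l R)) + (\<Sum>l\<in>{k<..<e}. \<tau> l R * (m R - ms l R))"
      unfolding IS(2) by (rule sum.union_disjoint) auto
    finally show ?case by (simp only: sum.distrib distrib_left ac_simps)
  qed
  have "((\<lambda>R. (1 + 2 * c + 2 * real (\<nu> k)) * m R
       + 2 * g * ((\<Sum>l\<in>{s..<k}. \<tau> l R * (m R - ms l R) + ms l R) + (\<Sum>l\<in>{k<..<e}. \<tau> l R * (m R - ms l R))))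
     \<longlongrightarrow> (1 + 2 * c + 2 * real (\<nu> k)) * v
       + 2 * g * ((\<Sum>l\<in>{s..<k}. 1 * (v - w l) + w l) + (\<Sum>l\<in>{k<..<e}. 0 * (v - w l)))) at_top"
    using k by (intro tendsto_intros m ms \<tau>_less \<tau>_greater) (auto simp: I_def)
  then have "((\<lambda>R. raise_op I c g {k..<e} k \<nu> (\<lambda>j. R ^ j) / R ^ top)
     \<longlongrightarrow> (1 + 2 * c + 2 * real (\<nu> k)) * v + 2 * g * (real (k - s) * v)) at_top"
    using filterlim_cong[OF refl refl eq] by simp
  \<comment> \<open>The value \<open>v\<close> is 0 unless \<open>\<nu>\<close> agrees with
    \<open>\<mu>\<close> on \<open>I\<close>, which permits replacing \<open>\<nu> k\<close> by
    \<open>\<mu> k\<close>.\<close>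
  moreover have "(1 + 2 * c + 2 * real (\<nu> k)) * v + 2 * g * (real (k - s) * v) = ev k * v"
    using k unfolding v01 ev_def by auto
  ultimately show ?thesis by (simp add: lead_def)
qed

text \<open>A squeezed pair is strictly below the larger original entry, so the raised entry does
  not exceed it and the dominance bounds survive.\<close>

private lemma C_raise:
  assumes "\<nu> \<in> C" "i \<in> I" "l \<in> I" "i \<noteq> l" "\<rho> \<in> squeezed i l \<nu>"
  shows "\<rho>(i := Suc (\<rho> i)) \<in> C"
  unfolding C_def
  by (rule dominated_squeeze[OF fin(1) assms(2-4) assms(1)[unfolded C_def]])
     (use assms(4,5) in \<open>auto simp: squeezed_def\<close>)

private lemma pspan_raise:
  assumes "\<nu> \<in> C" "k \<in> I"
  shows "pspan I C (raise_op I c g {k..<e} k \<nu>)"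
  unfolding raise_op_def[abs_def]
proof (intro pspan_add pspan_cmult pspan_sum)
  show "pspan I C (sqmonom I \<nu>)" by (rule pspan_sqmonom[OF assms(1)])
  show "pspan I C (\<lambda>x. (x k)\<^sup>2 * divdiff I k l \<nu> x)" if "l \<in> I - {k}" for l
    by (rule pspan_times_sq[OF fin(1) assms(2) pspan_divdiff])
      (use that C_raise[OF assms] in auto)
  show "pspan I C (\<lambda>x. sqmonom I \<nu> (x \<circ> swp k l))" if "l \<in> I - {k..<e}" for l
    using that assms by (auto simp: sqmonom_swap intro!: pspan_sqmonom C_swap)
qed

private lemma pspan_lower:
  assumes "k \<in> I"
  shows "pspan I {\<nu>. sum \<nu> I < sum \<rho> I} (lower_op I g k \<rho>)"
proof -
  have 1: "pspan I {\<nu>. sum \<nu> I < sum \<rho> I} (\<lambda>x. real (\<rho> k) * sqmonom I (\<rho>(k := \<rho> k - 1)) x)"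
  proof (cases "\<rho> k")
    case 0
    then show ?thesis by (simp add: pspan.zero)
  next
    case (Suc m)
    have "sum (\<rho>(k := \<rho> k - 1)) (I - {k}) = sum \<rho> (I - {k})" by (intro sum.cong) auto
    then have "sum (\<rho>(k := \<rho> k - 1)) I < sum \<rho> I" using Suc assms fin by (simp add: sum.remove[of I k])
    then show ?thesis by (intro pspan_cmult pspan_sqmonom) simp
  qed
  have "squeezed k l \<rho> \<subseteq> {\<nu>. sum \<nu> I < sum \<rho> I}" if "l \<in> I - {k}" for l
    using sum_squeezed[OF fin(1) assms, of l _ \<rho>] that by fastforce
  then have 2: "pspan I {\<nu>. sum \<nu> I < sum \<rho> I} (\<lambda>x. 2 * g * (\<Sum>l\<in>I-{k}. divdiff I k l \<rho> x))"
    by (intro pspan_cmult pspan_sum pspan_subset[OF pspan_divdiff]) auto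
  show ?thesis using pspan_add[OF pspan_cmult[OF 1, of 2] 2]
    by (simp add: lower_op_def[abs_def] mult.assoc)
qed

private lemma raise_pspan:
  assumes "k \<in> I" "pspan I C h"
  shows "\<exists>h'. pspan I C h' \<and> (\<forall>v. lead h v \<longrightarrow> lead h' (ev k * v)) \<and>
    (\<forall>\<rho>. wint I c g (\<lambda>x. sqprod {k..<e} x * sqmonom I \<rho> x * h x) =
       wint I c g (\<lambda>x. sqprod {Suc k..<e} x * sqmonom I \<rho> x * h' x)
     + wint I c g (\<lambda>x. sqprod {k..<e} x * lower_op I g k \<rho> x * h x))"
proof -
  \<comment> \<open>The induction carries one leading value of \<open>h\<close>, since a given value
    of a sum does not determine values of its summands. Uniqueness of limits extends the claim to
    every \<open>v\<close> afterwards.\<close>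
  have "\<exists>h' v. pspan I C h' \<and> lead h v \<and> lead h' (ev k * v) \<and>
    (\<forall>\<rho>. wint I c g (\<lambda>x. sqprod {k..<e} x * sqmonom I \<rho> x * h x) =
       wint I c g (\<lambda>x. sqprod {Suc k..<e} x * sqmonom I \<rho> x * h' x)
     + wint I c g (\<lambda>x. sqprod {k..<e} x * lower_op I g k \<rho> x * h x))"
    using assms(2)
  proof (induction rule: pspan.induct)
    case zero
    show ?case by (rule exI[of _ "\<lambda>_. 0"], rule exI[of _ 0]) (auto simp: wint_def lead_def pspan.zero)
  next
    case (add \<nu> h a)
    then obtain h' v where IH: "pspan I C h'" "lead h v" "lead h' (ev k * v)"
      "\<And>\<rho>. wint I c g (\<lambda>x. sqprod {k..<e} x * sqmonom I \<rho> x * h x) =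
       wint I c g (\<lambda>x. sqprod {Suc k..<e} x * sqmonom I \<rho> x * h' x)
     + wint I c g (\<lambda>x. sqprod {k..<e} x * lower_op I g k \<rho> x * h x)" by blast
    define T where "T = raise_op I c g {k..<e} k \<nu>"
    define u where "u = (if \<forall>j\<in>I. \<nu> j = \<mu> j then 1 else 0 :: real)"
    have u: "lead (sqmonom I \<nu>) u" unfolding u_def by (rule lead_sqmonom[OF add(1)])
    have T: "pspan I C T" "lead T (ev k * u)"
      unfolding T_def using pspan_raise lead_raise[OF _ _ u] add(1) assms(1) by auto
    have sub: "{k..<e} \<subseteq> I" "k \<in> {k..<e}" "{k..<e} - {k} = {Suc k..<e}" "{Suc k..<e} \<subseteq> I" using assms(1) by (auto simp: I_def)
    have lin: "wint I c g (\<lambda>x. q x * r x * (a * h1 x + h2 x)) = a * wint I c g (\<lambda>x. q x * r x * h1 x) + wint I c g (\<lambda>x. q x * r x * h2 x)"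
      if "poly_bounded I q" "poly_bounded I r" "poly_bounded I h1" "poly_bounded I h2" for q r h1 h2
    proof -
      have "wint I c g (\<lambda>x. q x * r x * (a * h1 x + h2 x)) = wint I c g (\<lambda>x. a * (q x * r x * h1 x) + q x * r x * h2 x)"
        by (simp add: algebra_simps)
      also have "\<dots> = wint I c g (\<lambda>x. a * (q x * r x * h1 x)) + wint I c g (\<lambda>x. q x * r x * h2 x)"
        using that fin c g by (intro wint_add poly_bounded_cmult poly_bounded_mult) auto
      finally show ?thesis by (simp add: wint_cmult)
    qed
    note pb = pspan_poly_bounded[OF fin(1)]
    have pbs: "poly_bounded I (sqprod {k..<e})" "poly_bounded I (sqprod {Suc k..<e})"
        "poly_bounded I (lower_op I g k \<rho>)" "poly_bounded I (sqmonom I \<nu>')" for \<rho> \<nu>'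
      using pb[OF pspan_lower[OF assms(1)]] fin sub by auto
    have "wint I c g (\<lambda>x. sqprod {k..<e} x * sqmonom I \<rho> x * (a * sqmonom I \<nu> x + h x)) =
       wint I c g (\<lambda>x. sqprod {Suc k..<e} x * sqmonom I \<rho> x * (a * T x + h' x))
     + wint I c g (\<lambda>x. sqprod {k..<e} x * lower_op I g k \<rho> x * (a * sqmonom I \<nu> x + h x))" for \<rho>
      using wint_step[OF fin(1) c g sub(1,2), of \<rho> \<nu>] IH(4)[of \<rho>]
      unfolding sub(3) T_def[symmetric] lin[OF pbs(1,4) pbs(4) pb[OF add(2)]]
        lin[OF pbs(2,4) pb[OF T(1)] pb[OF IH(1)]] lin[OF pbs(1,3,4) pb[OF add(2)]]
      by (simp only: distrib_left ac_simps)
    moreover have "pspan I C (\<lambda>x. a * T x + h' x)" by (intro pspan_add pspan_cmult T IH)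
    moreover have "lead (\<lambda>x. a * sqmonom I \<nu> x + h x) (a * u + v)" by (intro lead_add lead_cmult u IH)
    moreover have "lead (\<lambda>x. a * T x + h' x) (ev k * (a * u + v))"
      using lead_add[OF lead_cmult[OF T(2), of a] IH(3)] by (simp add: algebra_simps)
    ultimately show ?case
      by (intro exI[of _ "\<lambda>x. a * T x + h' x"] exI[of _ "a * u + v"] conjI allI)
  qed
  then obtain h' v where h': "pspan I C h'" "lead h v" "lead h' (ev k * v)"
    "\<forall>\<rho>. wint I c g (\<lambda>x. sqprod {k..<e} x * sqmonom I \<rho> x * h x) =
       wint I c g (\<lambda>x. sqprod {Suc k..<e} x * sqmonom I \<rho> x * h' x)
     + wint I c g (\<lambda>x. sqprod {k..<e} x * lower_op I g k \<rho> x * h x)" by (elim exE conjE)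
  have "lead h' (ev k * v')" if "lead h v'" for v'
    using h'(3) lead_unique[OF h'(2) that] by simp
  then show ?thesis using h'(1,4) by (intro exI[of _ h'] conjI allI impI) auto
qed

private lemma sym_sqprod: "s \<le> k0 \<Longrightarrow> k0 \<le> p \<Longrightarrow> sym (sqprod {k0..<e})"
  unfolding sym_def using fin by (auto simp: I_def A_def intro!: poly_bounded_sqprod sqprod_swap_both)

private lemma sym_one: "sym (\<lambda>_. 1)"
  by (auto simp: sym_def)

private lemma wint_lin:
  assumes "poly_bounded I q" "poly_bounded I h1" "poly_bounded I h2" "poly_bounded I h"
  shows "wint I c g (\<lambda>x. q x * (a * h1 x + h2 x) * h x) =
     a * wint I c g (\<lambda>x. q x * h1 x * h x) + wint I c g (\<lambda>x. q x * h2 x * h x)"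
proof -
  have "wint I c g (\<lambda>x. q x * (a * h1 x + h2 x) * h x) = wint I c g (\<lambda>x. a * (q x * h1 x * h x) + q x * h2 x * h x)"
    by (simp add: algebra_simps)
  also have "\<dots> = wint I c g (\<lambda>x. a * (q x * h1 x * h x)) + wint I c g (\<lambda>x. q x * h2 x * h x)"
    using assms fin c g by (intro wint_add poly_bounded_cmult poly_bounded_mult) auto
  finally show ?thesis by (simp add: wint_cmult)
qed

private lemma lead_vand: "lead (vand p e) 1"
proof -
  have "top = (\<Sum>j\<in>A. j * (2 * \<mu> j))"
    unfolding top_def using fin by (intro sum.mono_neutral_right) (auto simp: \<mu>_def A_def I_def)
  then have top: "R ^ top = (\<Prod>j\<in>A. \<Prod>i\<in>{p..<j}. R ^ (2 * j))" for R :: real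
    by (simp add: power_sum power_mult[symmetric] \<mu>_def mult_ac)
  have "((\<lambda>R::real. \<Prod>j\<in>A. \<Prod>i\<in>{p..<j}. 1 - R ^ (2 * i) / R ^ (2 * j)) \<longlongrightarrow> (\<Prod>j\<in>A. \<Prod>i\<in>{p..<j}. 1 - 0)) at_top"
    by (intro tendsto_prod tendsto_diff tendsto_const power_ratio_0) auto
  moreover have "eventually (\<lambda>R. (\<Prod>j\<in>A. \<Prod>i\<in>{p..<j}. 1 - R ^ (2 * i) / R ^ (2 * j)) = vand p e (\<lambda>j. R ^ j) / R ^ top) at_top"
    using eventually_gt_at_top[of 0]
  proof eventually_elim
    case (elim R)
    have "(1 - R ^ (2 * i) / R ^ (2 * j)) = ((R ^ j)\<^sup>2 - (R ^ i)\<^sup>2) / R ^ (2 * j)" for i j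
      using elim by (simp add: diff_divide_distrib power_mult[symmetric] mult.commute)
    then show ?case unfolding top vand_def A_def by (simp add: prod_dividef)
  qed
  ultimately show ?thesis by (simp add: lead_def filterlim_cong)
qed

text \<open>The factors are removed in increasing order of the index, so that at stage
  \<open>k\<close> the reflections of \<open>raise_op\<close> run over the indices below
  \<open>k\<close>, exactly those whose transposed copies must cancel. The condition
  \<open>k0 \<le> p\<close> makes the initial product symmetric on \<open>A\<close>.\<close>

private lemma chain:
  assumes k0: "s \<le> k0" "k0 \<le> p" and k: "k0 \<le> k" "k \<le> e"
  shows "\<exists>h. pspan I C h \<and> lead h (\<Prod>j\<in>{k0..<k}. ev j) \<and> (\<forall>\<rho>. sum \<rho> I \<le> vdeg p e \<longrightarrow>
    wint I c g (\<lambda>x. sqprod {k..<e} x * sqmonom I \<rho> x * h x) = wint I c g (\<lambda>x. sqprod {k0..<e} x * sqmonom I \<rho> x * vand p e x))"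
  using k
proof (induction k rule: dec_induct)
  case base
  show ?case using f_pspan lead_vand by (intro exI[of _ "vand p e"]) simp
next
  case (step k)
  have ke: "k \<le> e" using step.prems by simp
  from step.IH[OF ke] obtain h where h: "pspan I C h" "lead h (\<Prod>j\<in>{k0..<k}. ev j)"
    and E: "\<And>\<rho>. sum \<rho> I \<le> vdeg p e \<Longrightarrow>
    wint I c g (\<lambda>x. sqprod {k..<e} x * sqmonom I \<rho> x * h x) = wint I c g (\<lambda>x. sqprod {k0..<e} x * sqmonom I \<rho> x * vand p e x)"
    by blast
  have kI: "k \<in> I" using step k0 by (auto simp: I_def)
  obtain h' where h': "pspan I C h'" "\<And>v. lead h v \<Longrightarrow> lead h' (ev k * v)"
    "\<And>\<rho>. wint I c g (\<lambda>x. sqprod {k..<e} x * sqmonom I \<rho> x * h x) =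
       wint I c g (\<lambda>x. sqprod {Suc k..<e} x * sqmonom I \<rho> x * h' x)
     + wint I c g (\<lambda>x. sqprod {k..<e} x * lower_op I g k \<rho> x * h x)"
    using raise_pspan[OF kI h(1)] by blast
  have pbk: "poly_bounded I (sqprod {k..<e})" "poly_bounded I h"
    using fin kI pspan_poly_bounded[OF fin(1) h(1)] by (auto simp: I_def)
  \<comment> \<open>A test polynomial of too low a degree is carried back by \<open>E\<close> to an
    integral against \<open>vand p e\<close>, where antisymmetry kills it. This disposes of the
    terms with \<open>lower_op\<close>.\<close>
  have zero: "wint I c g (\<lambda>x. sqprod {k..<e} x * r x * h x) = 0"
    if "pspan I {\<nu>. sum \<nu> I < d} r" "d \<le> vdeg p e" for r d
    using that(1)
  proof (induction rule: pspan.induct)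
    case (add \<nu> r a)
    have "wint I c g (\<lambda>x. sqprod {k..<e} x * sqmonom I \<nu> x * h x) = 0"
      using E[of \<nu>] wint_low_degree[OF _ sym_sqprod[OF k0], of \<nu>] add(1) that(2) by simp
    then show ?case
      using add wint_lin[OF pbk(1) poly_bounded_sqmonom[OF fin(1)] pspan_poly_bounded[OF fin(1) add(2)] pbk(2)] by simp
  qed (simp add: wint_def)
  have "wint I c g (\<lambda>x. sqprod {Suc k..<e} x * sqmonom I \<rho> x * h' x) = wint I c g (\<lambda>x. sqprod {k0..<e} x * sqmonom I \<rho> x * vand p e x)"
    if "sum \<rho> I \<le> vdeg p e" for \<rho>
    using E[OF that] h'(3)[of \<rho>] zero[OF pspan_lower[OF kI] that] by simp
  moreover have "lead h' (\<Prod>j\<in>{k0..<Suc k}. ev j)"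
    using h'(2)[OF h(2)] step by (simp add: prod.op_ivl_Suc mult.commute)
  ultimately show ?case using h'(1) by blast
qed

text \<open>The factor depends on \<open>r\<close> alone. Hence the ratio between the integrals for
  two symmetric multipliers \<open>q\<close> is the same for all \<open>r\<close>, which replaces a
  projection onto alternating polynomials.\<close>

private lemma wint_pspan_ratio:
  assumes "pspan I C r"
  shows "\<exists>\<epsilon>. \<forall>q. sym q \<longrightarrow> wint I c g (\<lambda>x. q x * r x * vand p e x)
    = \<epsilon> * wint I c g (\<lambda>x. q x * sqmonom I \<mu> x * vand p e x)"
  using assms
proof (induction rule: pspan.induct)
  case zero
  then show ?case by (intro exI[of _ 0]) (simp add: wint_def)
next
  case (add \<nu> r a)
  have deg: "sum \<nu> I = vdeg p e" using add(1) by (simp add: C_def dominated_def)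
  obtain \<epsilon> where \<epsilon>: "\<And>q. sym q \<Longrightarrow> wint I c g (\<lambda>x. q x * sqmonom I \<nu> x * vand p e x)
    = \<epsilon> * wint I c g (\<lambda>x. q x * sqmonom I \<mu> x * vand p e x)" using wint_top_degree[OF deg] by blast
  obtain \<epsilon>' where \<epsilon>': "\<And>q. sym q \<Longrightarrow> wint I c g (\<lambda>x. q x * r x * vand p e x)
    = \<epsilon>' * wint I c g (\<lambda>x. q x * sqmonom I \<mu> x * vand p e x)" using add.IH by blast
  have "wint I c g (\<lambda>x. q x * (a * sqmonom I \<nu> x + r x) * vand p e x) =
      (a * \<epsilon> + \<epsilon>') * wint I c g (\<lambda>x. q x * sqmonom I \<mu> x * vand p e x)" if "sym q" for q
    using wint_lin[of q "sqmonom I \<nu>" r "vand p e" a] that fin f_bounded pspan_poly_bounded[OF fin(1) add(2)]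
      \<epsilon>[OF that] \<epsilon>'[OF that]
    by (simp add: sym_def poly_bounded_sqmonom distrib_right)
  then show ?case by blast
qed

private lemma wint_vand_pos: "0 < wint I c g (\<lambda>x. vand p e x * vand p e x)"
proof -
  have "0 \<le> wint I c g (\<lambda>x. vand p e x * vand p e x)"
    unfolding wint_def by (intro integral_nonneg_AE AE_I2 mult_nonneg_nonneg[OF zero_le_square weight_nonneg])
  moreover have "wint I c g (\<lambda>x. vand p e x * vand p e x) \<noteq> 0"
  proof
    assume "wint I c g (\<lambda>x. vand p e x * vand p e x) = 0"
    then have "vand p e (\<lambda>j. 2 ^ j) = 0"
      using pspan_eq_0_of_wint_eq_0[OF fin(1) c g f_pspan, of 2] by simp
    moreover have "(((2::real) ^ j)\<^sup>2 - (2 ^ i)\<^sup>2) \<noteq> 0" if "i < j" for i j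
    proof -
      have "(2::real) ^ i < 2 ^ j" using that by simp
      then have "((2::real) ^ i)\<^sup>2 < (2 ^ j)\<^sup>2" by (intro power_strict_mono) auto
      then have "((2::real) ^ j)\<^sup>2 - (2 ^ i)\<^sup>2 > 0" by linarith
      then show ?thesis by linarith
    qed
    then have "vand p e (\<lambda>j. 2 ^ j) \<noteq> 0"
      unfolding vand_def by (simp add: prod_zero_iff)
    ultimately show False by simp
  qed
  ultimately show ?thesis by simp
qed

text \<open>With \<open>\<Lambda>\<close> the common ratio of the integrals with and without
  \<open>sqprod {k0..<e}\<close>, the difference \<open>h - \<Lambda> * vand p e\<close> lies in the
  span of \<open>C\<close> and is orthogonal to all of it, itself included. So it vanishes along
  \<open>x j = R ^ j\<close>, and comparing leading values gives \<open>\<Lambda>\<close>.\<close>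

private lemma wint_sqprod_vand_aux:
  assumes k0: "s \<le> k0" "k0 \<le> p"
  shows "wint I c g (\<lambda>x. sqprod {k0..<e} x * (vand p e x)\<^sup>2) = (\<Prod>j\<in>{k0..<e}. ev j) * wint I c g (\<lambda>x. (vand p e x)\<^sup>2)"
proof -
  let ?t = "sqprod {k0..<e}"
  define m1 where "m1 = wint I c g (\<lambda>x. ?t x * sqmonom I \<mu> x * vand p e x)"
  define m2 where "m2 = wint I c g (\<lambda>x. sqmonom I \<mu> x * vand p e x)"
  define \<Lambda> where "\<Lambda> = m1 / m2"
  have st: "sym ?t" by (rule sym_sqprod[OF k0])
  have \<epsilon>: "\<exists>\<epsilon>. wint I c g (\<lambda>x. ?t x * r x * vand p e x) = \<epsilon> * m1 \<and> wint I c g (\<lambda>x. r x * vand p e x) = \<epsilon> * m2"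
    if "pspan I C r" for r
  proof -
    from wint_pspan_ratio[OF that] obtain \<epsilon> where \<epsilon>: "\<And>q. sym q \<Longrightarrow> wint I c g (\<lambda>x. q x * r x * vand p e x)
      = \<epsilon> * wint I c g (\<lambda>x. q x * sqmonom I \<mu> x * vand p e x)"
      by blast
    show ?thesis using \<epsilon>[OF st] \<epsilon>[OF sym_one] by (intro exI[of _ \<epsilon>]) (simp add: m1_def m2_def)
  qed
  \<comment> \<open>The positive integral of the squared Vandermonde product is a multiple of
    \<open>m2\<close>.\<close>
  have "m2 \<noteq> 0" using \<epsilon>[OF f_pspan] wint_vand_pos by auto
  then have \<Lambda>: "wint I c g (\<lambda>x. ?t x * r x * vand p e x) = \<Lambda> * wint I c g (\<lambda>x. r x * vand p e x)" if "pspan I C r" for r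
    using \<epsilon>[OF that] by (auto simp: \<Lambda>_def)
  obtain h where h: "pspan I C h" "lead h (\<Prod>j\<in>{k0..<e}. ev j)"
    and E: "\<And>\<rho>. sum \<rho> I \<le> vdeg p e \<Longrightarrow>
    wint I c g (\<lambda>x. sqprod {e..<e} x * sqmonom I \<rho> x * h x) = wint I c g (\<lambda>x. ?t x * sqmonom I \<rho> x * vand p e x)"
    using chain[OF k0, of e] k0 pe by auto
  have hb: "poly_bounded I h" by (rule pspan_poly_bounded[OF fin(1) h(1)])
  have tb: "poly_bounded I ?t" using st by (simp add: sym_def)
  have E': "wint I c g (\<lambda>x. r x * h x) = wint I c g (\<lambda>x. ?t x * r x * vand p e x)" if "pspan I C r" for r
    using that
  proof (induction rule: pspan.induct)
    case (add \<nu> r a)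
    have "sum \<nu> I \<le> vdeg p e" using add(1) by (simp add: C_def dominated_def)
    then have "wint I c g (\<lambda>x. sqmonom I \<nu> x * h x) = wint I c g (\<lambda>x. ?t x * sqmonom I \<nu> x * vand p e x)"
      using E[of \<nu>] by (simp add: sqprod_def)
    moreover have rb: "poly_bounded I r" by (rule pspan_poly_bounded[OF fin(1) add(2)])
    ultimately show ?case
      using add wint_lin[OF poly_bounded_const[of I 1] poly_bounded_sqmonom[OF fin(1)] rb hb, of a \<nu>]
        wint_lin[OF tb poly_bounded_sqmonom[OF fin(1)] rb f_bounded, of a \<nu>] by simp
  qed (simp add: wint_def)
  define r where "r x = h x - \<Lambda> * vand p e x" for x
  have r: "pspan I C r" unfolding r_def by (intro pspan_diff pspan_cmult h f_pspan)
  have rb: "poly_bounded I r" by (rule pspan_poly_bounded[OF fin(1) r])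
  have "wint I c g (\<lambda>x. r x * r x) = wint I c g (\<lambda>x. r x * h x - \<Lambda> * (r x * vand p e x))"
    by (simp add: r_def algebra_simps)
  also have "\<dots> = wint I c g (\<lambda>x. r x * h x) - wint I c g (\<lambda>x. \<Lambda> * (r x * vand p e x))"
    using fin c g rb hb f_bounded by (intro wint_diff poly_bounded_cmult poly_bounded_mult) auto
  also have "\<dots> = 0" using E'[OF r] \<Lambda>[OF r] by (simp add: wint_cmult)
  finally have "r (\<lambda>j. R ^ j) = 0" if "1 < R" for R
    using pspan_eq_0_of_wint_eq_0[OF fin(1) c g r _ that] by simp
  then have "eventually (\<lambda>R. r (\<lambda>j. R ^ j) / R ^ top = 0) at_top"
    by (intro eventually_mono[OF eventually_gt_at_top[of 1]]) simp
  then have "lead r 0" unfolding lead_def by (rule tendsto_eventually)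
  moreover have "lead r ((\<Prod>j\<in>{k0..<e}. ev j) - \<Lambda>)"
    using lead_add[OF h(2) lead_cmult[OF lead_vand, of "- \<Lambda>"]] by (simp add: r_def[abs_def])
  ultimately have "\<Lambda> = (\<Prod>j\<in>{k0..<e}. ev j)" using lead_unique by fastforce
  then show ?thesis using \<Lambda>[OF f_pspan] by (simp add: power2_eq_square mult_ac)
qed

lemmas wint_sqprod_vand = wint_sqprod_vand_aux[unfolded I_def ev_def \<mu>_def]
lemmas wint_vand_positive = wint_vand_pos[unfolded I_def]

text \<open>The product of \<open>vand p e\<close> with its transposed copy, divided by the
  difference of squares, is antisymmetric and integrates to 0. Subtracting it turns the sum into an
  integral of \<open>vand p e\<close> against a sum of divided differences of itself, whose degree
  is too low.\<close>

lemma wint_vand_boundary_term: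
  assumes "i \<in> {s..<p}"
  shows "(\<Sum>l\<in>{s..<e}-{i}. wint {s..<e} c g (\<lambda>x. (vand p e x)\<^sup>2 / ((x i)\<^sup>2 - (x l)\<^sup>2))) = 0"
proof -
  have iI: "i \<in> I" "i \<notin> A" using assms pe by (auto simp: I_def A_def)
  define DD where "DD r x = (\<Sum>l\<in>I-{i}. (r x - r (x \<circ> swp i l)) / ((x i)\<^sup>2 - (x l)\<^sup>2))"
    for r :: "(nat \<Rightarrow> real) \<Rightarrow> real" and x
  have DDz: "wint I c g (\<lambda>x. vand p e x * DD r x) = 0" if "pspan I C r" for r
  proof -
    have "\<exists>d. pspan I {\<nu>. sum \<nu> I < vdeg p e} d \<and> (\<forall>x. (\<forall>i\<in>I. \<forall>l\<in>I. i \<noteq> l \<longrightarrow> (x i)\<^sup>2 \<noteq> (x l)\<^sup>2) \<longrightarrow> DD r x = d x)"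
      using that
    proof (induction rule: pspan.induct)
      case zero
      show ?case by (rule exI[of _ "\<lambda>_. 0"]) (auto simp: DD_def pspan.zero)
    next
      case (add \<nu> r a)
      then obtain d where d: "pspan I {\<nu>. sum \<nu> I < vdeg p e} d"
        "\<And>x. (\<forall>i\<in>I. \<forall>l\<in>I. i \<noteq> l \<longrightarrow> (x i)\<^sup>2 \<noteq> (x l)\<^sup>2) \<Longrightarrow> DD r x = d x" by blast
      have "sum \<nu> I = vdeg p e" using add(1) by (simp add: C_def dominated_def)
      then have "squeezed i l \<nu> \<subseteq> {\<rho>. sum \<rho> I < vdeg p e}" if "l \<in> I - {i}" for l
        using sum_squeezed[OF fin(1) iI(1), of l _ \<nu>] that by fastforce
      then have 1: "pspan I {\<nu>. sum \<nu> I < vdeg p e} (\<lambda>x. a * (\<Sum>l\<in>I-{i}. divdiff I i l \<nu> x) + d x)"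
        by (intro pspan_add pspan_cmult pspan_sum pspan_subset[OF pspan_divdiff] d) auto
      have "DD (\<lambda>x. a * sqmonom I \<nu> x + r x) x = a * (\<Sum>l\<in>I-{i}. divdiff I i l \<nu> x) + d x"
        if x: "\<forall>i\<in>I. \<forall>l\<in>I. i \<noteq> l \<longrightarrow> (x i)\<^sup>2 \<noteq> (x l)\<^sup>2" for x
      proof -
        have "(a * sqmonom I \<nu> x + r x - (a * sqmonom I \<nu> (x \<circ> swp i l) + r (x \<circ> swp i l))) / ((x i)\<^sup>2 - (x l)\<^sup>2)
           = a * divdiff I i l \<nu> x + (r x - r (x \<circ> swp i l)) / ((x i)\<^sup>2 - (x l)\<^sup>2)" if l: "l \<in> I - {i}" for l
        proof -
          have ne: "(x i)\<^sup>2 - (x l)\<^sup>2 \<noteq> 0" using x l iI by auto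
          have eq: "sqmonom I \<nu> x = sqmonom I \<nu> (x \<circ> swp i l) + ((x i)\<^sup>2 - (x l)\<^sup>2) * divdiff I i l \<nu> x"
            using divdiff[OF fin(1) iI(1), of l \<nu> x] l by simp
          have num: "a * sqmonom I \<nu> x + r x - (a * sqmonom I \<nu> (x \<circ> swp i l) + r (x \<circ> swp i l))
            = ((x i)\<^sup>2 - (x l)\<^sup>2) * (a * divdiff I i l \<nu> x) + (r x - r (x \<circ> swp i l))"
            unfolding eq by (simp add: algebra_simps)
          show ?thesis by (simp only: num add_divide_distrib nonzero_mult_div_cancel_left[OF ne])
        qed
        then show ?thesis using d(2)[OF x] unfolding DD_def
          by (simp add: sum.distrib sum_distrib_left)
      qed
      then show ?case using 1 by blast
    qed
    then obtain d where d: "pspan I {\<nu>. sum \<nu> I < vdeg p e} d"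
      "\<And>x. (\<forall>i\<in>I. \<forall>l\<in>I. i \<noteq> l \<longrightarrow> (x i)\<^sup>2 \<noteq> (x l)\<^sup>2) \<Longrightarrow> DD r x = d x" by blast
    have "wint I c g (\<lambda>x. vand p e x * DD r x) = wint I c g (\<lambda>x. 1 * d x * vand p e x)"
      using d(2) g fin by (intro wint_cong) (auto simp: mult.commute)
    also have "\<dots> = 0" using d(1)
    proof (induction rule: pspan.induct)
      case (add \<nu> r a)
      have "wint I c g (\<lambda>x. 1 * sqmonom I \<nu> x * vand p e x) = 0"
        using wint_low_degree[OF _ sym_one, of \<nu>] add(1) by simp
      then show ?case
        using add wint_lin[OF poly_bounded_const[of I 1] poly_bounded_sqmonom[OF fin(1)] pspan_poly_bounded[OF fin(1) add(2)] f_bounded] by simp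
    qed (simp add: wint_def)
    finally show ?thesis .
  qed
  have fs: "poly_bounded I (\<lambda>x. vand p e (x \<circ> swp i l))" if "l \<in> I" for l
  proof -
    have "\<exists>K. pspan I K (\<lambda>x. vand p e (x \<circ> swp i l))"
      using f_pspan
    proof (induction rule: pspan.induct)
      case zero
      show ?case using pspan.zero by blast
    next
      case (add \<nu> r a)
      then obtain K where K: "pspan I K (\<lambda>x. r (x \<circ> swp i l))" by blast
      have "pspan I (insert (\<nu> \<circ> swp i l) K)
          (\<lambda>x. a * sqmonom I (\<nu> \<circ> swp i l) x + r (x \<circ> swp i l))"
        by (intro pspan.add pspan_subset[OF K]) auto
      then show ?case unfolding sqmonom_swap[OF iI(1) that] by blast
    qed
    then show ?thesis using pspan_poly_bounded[OF fin(1)] by blast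
  qed
  have half: "wint I c g (\<lambda>x. (vand p e x)\<^sup>2 / ((x i)\<^sup>2 - (x l)\<^sup>2)) =
     wint I c g (\<lambda>x. vand p e x * ((vand p e x - vand p e (x \<circ> swp i l)) / ((x i)\<^sup>2 - (x l)\<^sup>2)))"
    if l: "l \<in> I - {i}" for l
  proof -
    have lI: "l \<in> I" "i \<noteq> l" using l by auto
    define F where "F x = vand p e x * vand p e (x \<circ> swp i l)" for x
    have Fb: "poly_bounded I F" unfolding F_def by (intro poly_bounded_mult f_bounded fs lI)
    have "F (x \<circ> swp i l) = F x" for x
      by (simp add: F_def comp_assoc mult.commute)
    then have z: "wint I c g (\<lambda>x. F x / ((x i)\<^sup>2 - (x l)\<^sup>2)) = 0"
      using wint_div_swap[OF fin(1) iI(1) lI(1) Fb, of c g] by simp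
    have "wint I c g (\<lambda>x. vand p e x * ((vand p e x - vand p e (x \<circ> swp i l)) / ((x i)\<^sup>2 - (x l)\<^sup>2)))
      = wint I c g (\<lambda>x. (vand p e x)\<^sup>2 / ((x i)\<^sup>2 - (x l)\<^sup>2) - F x / ((x i)\<^sup>2 - (x l)\<^sup>2))"
      by (simp add: F_def power2_eq_square right_diff_distrib diff_divide_distrib)
    also have "\<dots> = wint I c g (\<lambda>x. (vand p e x)\<^sup>2 / ((x i)\<^sup>2 - (x l)\<^sup>2)) - wint I c g (\<lambda>x. F x / ((x i)\<^sup>2 - (x l)\<^sup>2))"
      unfolding wint_def left_diff_distrib using fin iI lI c g Fb f_bounded
      by (intro Bochner_Integration.integral_diff integrable_wint_div) (auto intro: poly_bounded_power)
    finally show ?thesis using z by simp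
  qed
  have "(\<Sum>l\<in>I-{i}. wint I c g (\<lambda>x. (vand p e x)\<^sup>2 / ((x i)\<^sup>2 - (x l)\<^sup>2))) =
     (\<Sum>l\<in>I-{i}. wint I c g (\<lambda>x. vand p e x * ((vand p e x - vand p e (x \<circ> swp i l)) / ((x i)\<^sup>2 - (x l)\<^sup>2))))"
    by (intro sum.cong refl half)
  also have "\<dots> = wint I c g (\<lambda>x. vand p e x * DD (vand p e) x)"
  proof -
    have "integrable (gauss I) (\<lambda>x. vand p e x * ((vand p e x - vand p e (x \<circ> swp i l)) / ((x i)\<^sup>2 - (x l)\<^sup>2)) * weight I c g x)"
      if l: "l \<in> I - {i}" for l
    proof -
      have "integrable (gauss I) (\<lambda>x. (vand p e x * (vand p e x - vand p e (x \<circ> swp i l))) / ((x i)\<^sup>2 - (x l)\<^sup>2) * weight I c g x)"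
        using fin iI l c g fs f_bounded by (intro integrable_wint_div poly_bounded_mult poly_bounded_diff) auto
      then show ?thesis by simp
    qed
    then show ?thesis unfolding wint_def DD_def sum_distrib_left sum_distrib_right
      by (intro Bochner_Integration.integral_sum[symmetric])
  qed
  also have "\<dots> = 0" by (rule DDz[OF f_pspan])
  finally show ?thesis by (simp add: I_def)
qed

end

section \<open>Evaluation for real parameters\<close>

text \<open>The quotient \<open>q\<close> of \<open>f\<close> and \<open>h\<close> has period 1. The
  bound for \<open>f\<close> from \<open>x\<close> to \<open>x + \<theta>\<close> and that for
  \<open>h\<close> from \<open>x + \<theta>\<close> to \<open>x + 1\<close> give \<open>q (x +
  \<theta>) \<le> q x * (R (x + 1) / R x) powr (1 - \<theta>)\<close>. Moving \<open>x\<close> to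
  infinity along the period removes the last factor, and the step from \<open>c + \<theta>\<close>
  to \<open>c + 1\<close> yields the reverse inequality.\<close>

lemma bohr_mollerup_unique:
  fixes f h R :: "real \<Rightarrow> real"
  assumes pos: "\<And>c. 0 < c \<Longrightarrow> 0 < f c" "\<And>c. 0 < c \<Longrightarrow> 0 < h c" "\<And>c. 0 < c \<Longrightarrow> 0 < R c"
    and shift: "\<And>c. 0 < c \<Longrightarrow> f (c + 1) = R c * f c" "\<And>c. 0 < c \<Longrightarrow> h (c + 1) = R c * h c"
    and conv: "\<And>c \<theta>. 0 < c \<Longrightarrow> 0 \<le> \<theta> \<Longrightarrow> \<theta> \<le> 1 \<Longrightarrow> f (c + \<theta>) \<le> f c * R c powr \<theta>"
      "\<And>c \<theta>. 0 < c \<Longrightarrow> 0 \<le> \<theta> \<Longrightarrow> \<theta> \<le> 1 \<Longrightarrow> h (c + \<theta>) \<le> h c * R c powr \<theta>"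
    and mono: "\<And>c d. 0 < c \<Longrightarrow> c \<le> d \<Longrightarrow> R c \<le> R d"
    and lim: "((\<lambda>c. R (c + 1) / R c) \<longlongrightarrow> 1) at_top"
    and c: "0 < c" "0 < d"
  shows "f c / h c = f d / h d"
proof -
  define q where "q c = f c / h c" for c
  have per: "q (c + real n) = q c" if "0 < c" for c n
  proof (induction n)
    case (Suc n)
    have "q (c + real n + 1) = q (c + real n)"
      using that pos(3)[of "c + real n"] by (simp add: q_def shift add_pos_nonneg)
    then show ?case using Suc by (simp add: add_ac)
  qed simp
  have le: "q (c + \<theta>) \<le> q c" if c: "0 < c" and \<theta>: "0 \<le> \<theta>" "\<theta> \<le> 1" for c \<theta>
  proof -
    have bound: "q (x + \<theta>) \<le> q x * (R (x + 1) / R x) powr (1 - \<theta>)" if x: "0 < x" for x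
    proof -
      have 1: "f (x + \<theta>) \<le> f x * R x powr \<theta>" using conv(1) x \<theta> by auto
      have "h (x + 1) \<le> h (x + \<theta>) * R (x + \<theta>) powr (1 - \<theta>)"
        using conv(2)[of "x + \<theta>" "1 - \<theta>"] x \<theta> by simp
      also have "\<dots> \<le> h (x + \<theta>) * R (x + 1) powr (1 - \<theta>)"
        using x \<theta> pos(2)[of "x + \<theta>"] pos(3)[of "x + \<theta>"] mono[of "x + \<theta>" "x + 1"]
        by (intro mult_left_mono powr_mono2) auto
      finally have 2: "R x * h x / R (x + 1) powr (1 - \<theta>) \<le> h (x + \<theta>)"
        using shift(2)[OF x] pos(3)[of "x + 1"] x by (simp add: pos_divide_le_eq)
      have p: "0 < R x" "0 < h x" "0 < R (x + 1)" "0 < f x" "0 < h (x + \<theta>)" using pos x \<theta> by auto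
      have "q (x + \<theta>) \<le> (f x * R x powr \<theta>) / h (x + \<theta>)"
        unfolding q_def using 1 p by (intro divide_right_mono) auto
      also have "\<dots> \<le> (f x * R x powr \<theta>) / (R x * h x / R (x + 1) powr (1 - \<theta>))"
        using 2 p by (intro divide_left_mono mult_pos_pos) auto
      also have "\<dots> = q x * (R (x + 1) / R x) powr (1 - \<theta>)"
        using p by (simp add: q_def powr_divide powr_diff field_simps)
      finally show ?thesis .
    qed
    have lim': "((\<lambda>x. (R (x + 1) / R x) powr (1 - \<theta>)) \<longlongrightarrow> 1 powr (1 - \<theta>)) at_top"
      by (intro tendsto_powr lim tendsto_const) auto
    have "filterlim (\<lambda>n. c + real n) at_top sequentially"
      by (intro filterlim_tendsto_add_at_top[OF tendsto_const filterlim_real_sequentially])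
    then have "(\<lambda>n. (R (c + real n + 1) / R (c + real n)) powr (1 - \<theta>)) \<longlonglongrightarrow> 1 powr (1 - \<theta>)"
      by (rule filterlim_compose[OF lim'])
    then have "(\<lambda>n. q c * (R (c + real n + 1) / R (c + real n)) powr (1 - \<theta>)) \<longlonglongrightarrow> q c * 1 powr (1 - \<theta>)"
      by (rule tendsto_mult_left)
    moreover have "q (c + \<theta>) \<le> q c * (R (c + real n + 1) / R (c + real n)) powr (1 - \<theta>)" for n
    proof -
      have "q (c + real n + \<theta>) = q (c + \<theta>)" using per[of "c + \<theta>" n] c \<theta> by (simp add: add_ac)
      then show ?thesis using bound[of "c + real n"] per[OF c, of n] c by simp
    qed
    ultimately show ?thesis by (intro LIMSEQ_le_const) auto
  qed
  have eq: "q (c + \<theta>) = q c" if "0 < c" "0 \<le> \<theta>" "\<theta> \<le> 1" for c \<theta>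
    using le[OF that] le[of "c + \<theta>" "1 - \<theta>"] per[of c 1] that by simp
  have main: "q c = q d" if "0 < c" "c \<le> d" for c d
  proof -
    define m where "m = nat \<lfloor>d - c\<rfloor>"
    have m: "real m \<le> d - c" "d - c \<le> real m + 1" using that unfolding m_def by linarith+
    have "q d = q ((c + real m) + (d - c - real m))" by simp
    also have "\<dots> = q (c + real m)" using m that by (intro eq) auto
    also have "\<dots> = q c" using that by (intro per)
    finally show ?thesis by simp
  qed
  show ?thesis using main[of c d] main[of d c] c unfolding q_def by linarith
qed

lemma Gamma_add_le:
  fixes x \<theta> :: real
  assumes "0 < x" "0 \<le> \<theta>" "\<theta> \<le> 1"
  shows "Gamma (x + \<theta>) \<le> Gamma x * x powr \<theta>"
proof -
  have "(ln \<circ> Gamma) ((1 - \<theta>) *\<^sub>R x + \<theta> *\<^sub>R (x + 1)) \<le> (1 - \<theta>) * (ln \<circ> Gamma) x + \<theta> * (ln \<circ> Gamma) (x + 1)"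
    using assms by (intro convex_onD[OF log_convex_Gamma_real]) auto
  moreover have "Gamma (x + 1) = x * Gamma x" using assms by (intro Gamma_plus1) (auto simp: nonpos_Ints_def)
  moreover have "(1 - \<theta>) *\<^sub>R x + \<theta> *\<^sub>R (x + 1) = x + \<theta>" by (simp add: algebra_simps)
  moreover have pos: "Gamma x > 0" "Gamma (x + \<theta>) > 0" using assms by (auto intro!: Gamma_real_pos)
  ultimately have "ln (Gamma (x + \<theta>)) \<le> ln (Gamma x) + \<theta> * ln x"
    using assms less_imp_neq[OF pos(1), symmetric] by (simp add: ln_mult algebra_simps)
  also have "\<dots> = ln (Gamma x * x powr \<theta>)" using assms less_imp_neq[OF pos(1), symmetric] by (simp add: ln_mult ln_powr)
  finally show ?thesis using assms pos by (subst (asm) ln_le_cancel_iff) auto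
qed

definition vand_integral :: "nat \<Rightarrow> nat \<Rightarrow> nat \<Rightarrow> real \<Rightarrow> real \<Rightarrow> real" where
  "vand_integral s p e c g = wint {s..<e} c g (\<lambda>x. (vand p e x)\<^sup>2)"

text \<open>In these terms the \<open>k\<close>-th factor of the shift is
  \<open>1 + 2 * c + 2 * zarg s p g k\<close>. For \<open>k < p\<close> the truncated
  \<open>k - p\<close> is 0.\<close>

definition zarg :: "nat \<Rightarrow> nat \<Rightarrow> real \<Rightarrow> nat \<Rightarrow> real" where
  "zarg s p g k = real (k - p) + g * real (k - s)"

lemma weight_shift:
  assumes "finite I"
  shows "weight I (c + \<theta>) g x = sqprod I x powr \<theta> * weight I c g x"
proof -
  have "\<bar>v\<bar> powr (2 * (c + \<theta>)) = v\<^sup>2 powr \<theta> * \<bar>v\<bar> powr (2 * c)" for v :: real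
  proof (cases "v = 0")
    case False
    then have "v\<^sup>2 = \<bar>v\<bar> powr 2" by simp
    then have "v\<^sup>2 powr \<theta> = \<bar>v\<bar> powr (2 * \<theta>)" by (simp only: powr_powr)
    then show ?thesis by (simp add: distrib_left powr_add mult.commute)
  qed simp
  then show ?thesis by (simp add: weight_def sqprod_def prod_powr_distrib prod.distrib mult_ac)
qed

lemma sqprod_nonneg: "0 \<le> sqprod S x"
  unfolding sqprod_def by (intro prod_nonneg) auto

lemma vand_integral_shift:
  assumes "s \<le> p" "p \<le> e" "0 < c" "1 \<le> g"
  shows "vand_integral s p e (c + 1) g = (\<Prod>k\<in>{s..<e}. 1 + 2 * c + 2 * zarg s p g k) * vand_integral s p e c g"
proof -
  have "vand_integral s p e (c + 1) g = wint {s..<e} c g (\<lambda>x. sqprod {s..<e} x * (vand p e x)\<^sup>2)"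
    unfolding vand_integral_def wint_def weight_shift[OF finite_atLeastLessThan]
    by (simp add: sqprod_nonneg mult_ac)
  then show ?thesis
    using wint_sqprod_vand[OF assms order_refl assms(1)] by (simp add: vand_integral_def zarg_def add_ac mult_ac distrib_left)
qed

lemma vand_integral_pos:
  assumes "s \<le> p" "p \<le> e" "0 < c" "1 \<le> g"
  shows "0 < vand_integral s p e c g"
  using wint_vand_positive[OF assms] by (simp add: vand_integral_def power2_eq_square)

lemma poly_bounded_vand:
  assumes "s \<le> p" "p \<le> e"
  shows "poly_bounded {s..<e} (vand p e)"
  using pspan_poly_bounded[OF _ vand_pspan[OF assms]] by simp

lemma zarg_nonneg: "0 \<le> g \<Longrightarrow> 0 \<le> zarg s p g k"
  by (simp add: zarg_def)

text \<open>Passing from \<open>c\<close> to \<open>c + \<theta>\<close> inserts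
  \<open>sqprod\<close> to the power \<open>\<theta>\<close> under the integral. Young's inequality
  bounds this power by an affine function of \<open>sqprod\<close> touching it at
  \<open>\<kappa>\<close>; by the shift formula \<open>\<kappa>\<close> is the mean of
  \<open>sqprod\<close>, so integrating returns exactly
  \<open>\<kappa> powr \<theta>\<close>.\<close>

lemma vand_integral_log_convex:
  assumes sp: "s \<le> p" "p \<le> e" and c: "0 < c" and g: "1 \<le> g" and \<theta>: "0 \<le> \<theta>" "\<theta> \<le> 1"
  shows "vand_integral s p e (c + \<theta>) g \<le> vand_integral s p e c g * (\<Prod>k\<in>{s..<e}. 1 + 2 * c + 2 * zarg s p g k) powr \<theta>"
proof -
  let ?I = "{s..<e}"
  define \<kappa> where "\<kappa> = (\<Prod>k\<in>?I. 1 + 2 * c + 2 * zarg s p g k)"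
  have \<kappa>: "0 < \<kappa>" unfolding \<kappa>_def using c g zarg_nonneg[of g] by (intro prod_pos ballI add_pos_nonneg) auto
  have vb: "poly_bounded ?I (\<lambda>x. (vand p e x)\<^sup>2)"
    by (intro poly_bounded_power poly_bounded_vand sp)
  have pb: "poly_bounded ?I (sqprod ?I)" by (rule poly_bounded_sqprod) auto
  have young: "X powr \<theta> \<le> \<theta> * \<kappa> powr \<theta> / \<kappa> * X + (1 - \<theta>) * \<kappa> powr \<theta>" if X: "0 \<le> X" for X
  proof (cases "X = 0")
    case False
    then have "(X / \<kappa>) powr \<theta> * 1 powr (1 - \<theta>) \<le> \<theta> * (X / \<kappa>) + (1 - \<theta>) * 1"
      using X \<kappa> \<theta> by (intro Youngs_inequality_0) auto
    then have "X powr \<theta> / \<kappa> powr \<theta> \<le> \<theta> * (X / \<kappa>) + (1 - \<theta>)"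
      using X \<kappa> by (simp add: powr_divide)
    then have "X powr \<theta> \<le> (\<theta> * (X / \<kappa>) + (1 - \<theta>)) * \<kappa> powr \<theta>"
      using \<kappa> by (simp add: pos_divide_le_eq)
    then show ?thesis by (simp add: algebra_simps)
  qed (use \<theta> in simp)
  have int: "integrable (gauss ?I) (\<lambda>x. (\<theta> * \<kappa> powr \<theta> / \<kappa> * (sqprod ?I x * (vand p e x)\<^sup>2) + (1 - \<theta>) * \<kappa> powr \<theta> * (vand p e x)\<^sup>2) * weight ?I c g x)"
    using c g vb pb by (intro integrable_wint poly_bounded_add poly_bounded_cmult poly_bounded_mult) auto
  have "vand_integral s p e (c + \<theta>) g \<le> wint ?I c g (\<lambda>x. \<theta> * \<kappa> powr \<theta> / \<kappa> * (sqprod ?I x * (vand p e x)\<^sup>2) + (1 - \<theta>) * \<kappa> powr \<theta> * (vand p e x)\<^sup>2)"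
    unfolding vand_integral_def wint_def
  proof (rule integral_mono[OF _ int])
    show "integrable (gauss ?I) (\<lambda>x. (vand p e x)\<^sup>2 * weight ?I (c + \<theta>) g x)"
      using c g \<theta> vb by (intro integrable_wint) auto
    fix x
    have "(vand p e x)\<^sup>2 * weight ?I (c + \<theta>) g x = (sqprod ?I x powr \<theta>) * ((vand p e x)\<^sup>2 * weight ?I c g x)"
      by (simp add: weight_shift mult_ac)
    also have "\<dots> \<le> (\<theta> * \<kappa> powr \<theta> / \<kappa> * sqprod ?I x + (1 - \<theta>) * \<kappa> powr \<theta>) * ((vand p e x)\<^sup>2 * weight ?I c g x)"
      by (intro mult_right_mono young sqprod_nonneg mult_nonneg_nonneg weight_nonneg) auto
    also have "\<dots> = (\<theta> * \<kappa> powr \<theta> / \<kappa> * (sqprod ?I x * (vand p e x)\<^sup>2) + (1 - \<theta>) * \<kappa> powr \<theta> * (vand p e x)\<^sup>2) * weight ?I c g x"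
      by (simp add: algebra_simps)
    finally show "(vand p e x)\<^sup>2 * weight ?I (c + \<theta>) g x \<le> \<dots>" .
  qed
  also have "\<dots> = \<theta> * \<kappa> powr \<theta> / \<kappa> * wint ?I c g (\<lambda>x. sqprod ?I x * (vand p e x)\<^sup>2) + (1 - \<theta>) * \<kappa> powr \<theta> * vand_integral s p e c g"
  proof -
    have "wint ?I c g (\<lambda>x. a * (sqprod ?I x * (vand p e x)\<^sup>2) + b * (vand p e x)\<^sup>2)
      = wint ?I c g (\<lambda>x. a * (sqprod ?I x * (vand p e x)\<^sup>2)) + wint ?I c g (\<lambda>x. b * (vand p e x)\<^sup>2)" for a b
      using c g by (intro wint_add poly_bounded_cmult poly_bounded_mult vb pb) auto
    then show ?thesis unfolding vand_integral_def wint_cmult .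
  qed
  also have "wint ?I c g (\<lambda>x. sqprod ?I x * (vand p e x)\<^sup>2) = \<kappa> * vand_integral s p e c g"
    using wint_sqprod_vand[OF sp c g order_refl sp(1)] by (simp add: vand_integral_def zarg_def \<kappa>_def add_ac mult_ac distrib_left)
  also have "\<theta> * \<kappa> powr \<theta> / \<kappa> * (\<kappa> * vand_integral s p e c g) + (1 - \<theta>) * \<kappa> powr \<theta> * vand_integral s p e c g = vand_integral s p e c g * \<kappa> powr \<theta>"
    using \<kappa> by (simp add: left_diff_distrib)
  finally show ?thesis unfolding \<kappa>_def .
qed

text \<open>A log-convex solution of the same recurrence in \<open>c\<close>: the step of the Gamma
  factor together with the 2 from the power gives \<open>2 * (c + 1/2 + zarg s p g k)\<close>, the
  shift factor.\<close>

definition gprod :: "nat \<Rightarrow> nat \<Rightarrow> nat \<Rightarrow> real \<Rightarrow> real \<Rightarrow> real" where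
  "gprod s p e c g = (\<Prod>k\<in>{s..<e}. 2 powr c * Gamma (c + 1 / 2 + zarg s p g k))"

lemma gprod_pos: "0 < c \<Longrightarrow> 1 \<le> g \<Longrightarrow> 0 < gprod s p e c g"
  unfolding gprod_def
  by (intro prod_pos ballI mult_pos_pos Gamma_real_pos add_pos_nonneg zarg_nonneg) auto

lemma gprod_shift:
  assumes "0 < c" "1 \<le> g"
  shows "gprod s p e (c + 1) g = (\<Prod>k\<in>{s..<e}. 1 + 2 * c + 2 * zarg s p g k) * gprod s p e c g"
  unfolding gprod_def prod.distrib[symmetric]
proof (rule prod.cong)
  fix k
  let ?y = "c + 1/2 + zarg s p g k"
  have "0 < ?y" using assms zarg_nonneg[of g s p k] by linarith
  define G where "G = Gamma ?y"
  have "Gamma (?y + 1) = ?y * G"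
    using \<open>0 < ?y\<close> unfolding G_def by (intro Gamma_plus1) (auto simp: nonpos_Ints_def)
  moreover have eq: "c + 1 + 1/2 + zarg s p g k = ?y + 1" by simp
  ultimately have "Gamma (c + 1 + 1/2 + zarg s p g k) = ?y * G" by (simp only:)
  then show "2 powr (c + 1) * Gamma (c + 1 + 1/2 + zarg s p g k) = (1 + 2 * c + 2 * zarg s p g k) * (2 powr c * Gamma ?y)"
    unfolding G_def[symmetric] by (simp add: powr_add algebra_simps)
qed simp

lemma gprod_log_convex:
  assumes "0 < c" "1 \<le> g" and \<theta>: "0 \<le> \<theta>" "\<theta> \<le> 1"
  shows "gprod s p e (c + \<theta>) g \<le> gprod s p e c g * (\<Prod>k\<in>{s..<e}. 1 + 2 * c + 2 * zarg s p g k) powr \<theta>"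
proof -
  have z: "0 \<le> zarg s p g k" for k using assms zarg_nonneg[of g s p k] by simp
  have "gprod s p e (c + \<theta>) g \<le> (\<Prod>k\<in>{s..<e}. (2 powr c * Gamma (c + 1 / 2 + zarg s p g k)) * (1 + 2 * c + 2 * zarg s p g k) powr \<theta>)"
    unfolding gprod_def
  proof (rule prod_mono, intro conjI)
    fix k
    let ?y = "c + 1/2 + zarg s p g k"
    have y: "0 < ?y" using assms z[of k] by linarith
    show "0 \<le> 2 powr (c + \<theta>) * Gamma (c + \<theta> + 1 / 2 + zarg s p g k)"
      using y \<theta> by (intro mult_nonneg_nonneg less_imp_le[OF Gamma_real_pos]) auto
    have "2 powr (c + \<theta>) * Gamma (?y + \<theta>) \<le> 2 powr (c + \<theta>) * (Gamma ?y * ?y powr \<theta>)"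
      using y \<theta> by (intro mult_left_mono Gamma_add_le) auto
    also have "\<dots> = 2 powr c * Gamma ?y * (2 powr \<theta> * ?y powr \<theta>)" by (simp add: powr_add)
    also have "2 powr \<theta> * ?y powr \<theta> = (2 * ?y) powr \<theta>" using y by (subst powr_mult) auto
    also have "2 * ?y = 1 + 2 * c + 2 * zarg s p g k" by (simp add: algebra_simps)
    finally show "2 powr (c + \<theta>) * Gamma (c + \<theta> + 1 / 2 + zarg s p g k) \<le> 2 powr c * Gamma ?y * (1 + 2 * c + 2 * zarg s p g k) powr \<theta>"
      by (simp add: add_ac)
  qed
  also have "\<dots> = gprod s p e c g * (\<Prod>k\<in>{s..<e}. 1 + 2 * c + 2 * zarg s p g k) powr \<theta>"
    unfolding gprod_def prod.distrib using assms z by (subst prod_powr_distrib) (auto intro!: add_nonneg_nonneg)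
  finally show ?thesis .
qed

lemma vand_integral_gprod:
  assumes "s \<le> p" "p \<le> e" "1 \<le> g" "0 < c" "0 < d"
  shows "vand_integral s p e c g / gprod s p e c g = vand_integral s p e d g / gprod s p e d g"
proof (rule bohr_mollerup_unique[where f="\<lambda>c. vand_integral s p e c g" and h="\<lambda>c. gprod s p e c g"
      and R="\<lambda>c. \<Prod>k\<in>{s..<e}. 1 + 2 * c + 2 * zarg s p g k"])
  have z: "0 \<le> zarg s p g k" for k using assms zarg_nonneg[of g s p k] by simp
  show "0 < (\<Prod>k\<in>{s..<e}. 1 + 2 * c + 2 * zarg s p g k)" if "0 < c" for c
    using that z by (intro prod_pos ballI add_pos_nonneg) auto
  show "(\<Prod>k\<in>{s..<e}. 1 + 2 * c + 2 * zarg s p g k) \<le> (\<Prod>k\<in>{s..<e}. 1 + 2 * d + 2 * zarg s p g k)"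
    if "0 < c" "c \<le> d" for c d
    using that z by (intro prod_mono) (auto intro!: add_nonneg_nonneg)
  have "((\<lambda>c. \<Prod>k\<in>{s..<e}. (1 + 2 * (c + 1) + 2 * zarg s p g k) / (1 + 2 * c + 2 * zarg s p g k)) \<longlongrightarrow> (\<Prod>k\<in>{s..<e}. 1)) at_top"
  proof (rule tendsto_prod)
    fix k
    show "((\<lambda>c. (1 + 2 * (c + 1) + 2 * zarg s p g k) / (1 + 2 * c + 2 * zarg s p g k)) \<longlongrightarrow> 1) at_top"
      by real_asymp
  qed
  then show "((\<lambda>c. (\<Prod>k\<in>{s..<e}. 1 + 2 * (c + 1) + 2 * zarg s p g k) / (\<Prod>k\<in>{s..<e}. 1 + 2 * c + 2 * zarg s p g k)) \<longlongrightarrow> 1) at_top"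
    by (simp add: prod_dividef)
qed (use assms vand_integral_pos gprod_pos vand_integral_shift gprod_shift vand_integral_log_convex gprod_log_convex in auto)

text \<open>As \<open>s < p\<close>, the squared Vandermonde product does not involve
  \<open>x s\<close>, and the singular sum of the boundary identity is the one already shown to
  vanish.\<close>

lemma vand_integral_boundary:
  assumes "s < p" "p \<le> e" "1 \<le> g"
  shows "vand_integral s p e (1/2) g = sqrt (2 / pi) * vand_integral (Suc s) p e (2 * g + 1/2) g"
proof -
  have ins: "insert s {Suc s..<e} = {s..<e}" and del: "{s..<e} - {s} = {Suc s..<e}" using assms by auto
  have up: "(vand p e (x(s := u)))\<^sup>2 = (vand p e x)\<^sup>2" for x u
    using vand_cong[of p e "x(s := u)" x] assms by simp
  have "(\<Sum>l\<in>{Suc s..<e}. wint {s..<e} (1/2) g (\<lambda>x. (vand p e x)\<^sup>2 / ((x s)\<^sup>2 - (x l)\<^sup>2))) = 0"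
    using wint_vand_boundary_term[of s p e "1/2" g s] assms del by simp
  then show ?thesis
    unfolding vand_integral_def using wint_boundary[of "{Suc s..<e}" s g "\<lambda>x. (vand p e x)\<^sup>2"] assms up ins
      poly_bounded_power[OF poly_bounded_vand[of s p e]] by simp
qed

text \<open>For \<open>s = p\<close> the squared product runs over all pairs and raises each
  exponent \<open>2 * g\<close> by 2. On the right \<open>vand e e\<close> is the empty
  product.\<close>

lemma vand_integral_top:
  assumes "s \<le> e"
  shows "vand_integral s s e c g = vand_integral s e e c (g + 1)"
proof -
  have "(vand s e x)\<^sup>2 * weight {s..<e} c g x = (vand e e x)\<^sup>2 * weight {s..<e} c (g + 1) x" for x
  proof -
    have "\<bar>v\<bar> powr (2 * (g + 1)) = v\<^sup>2 * \<bar>v\<bar> powr (2 * g)" for v :: real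
      by (cases "v = 0") (auto simp: distrib_left powr_add)
    then have "(\<Prod>(i, j)\<in>pairs {s..<e}. \<bar>(x i)\<^sup>2 - (x j)\<^sup>2\<bar> powr (2 * (g + 1))) =
      (\<Prod>(i, j)\<in>pairs {s..<e}. ((x j)\<^sup>2 - (x i)\<^sup>2)\<^sup>2) * (\<Prod>(i, j)\<in>pairs {s..<e}. \<bar>(x i)\<^sup>2 - (x j)\<^sup>2\<bar> powr (2 * g))"
      by (simp add: prod.distrib[symmetric] case_prod_unfold power2_commute)
    also have "(\<Prod>(i, j)\<in>pairs {s..<e}. ((x j)\<^sup>2 - (x i)\<^sup>2)\<^sup>2) = (vand s e x)\<^sup>2"
      by (simp add: vand_pairs prod_power_distrib case_prod_unfold)
    finally show ?thesis by (simp add: weight_def vand_def mult_ac)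
  qed
  then show ?thesis by (simp add: vand_integral_def wint_def)
qed

lemma vand_integral_empty: "vand_integral e e e c g = 1"
proof -
  interpret prob_space "gauss {}" by (rule prob_space_gauss)
  show ?thesis by (simp add: vand_integral_def wint_def weight_def vand_def pairs_def prob_space)
qed

text \<open>The factor \<open>2 powr (2 * zarg s p g k) / sqrt pi\<close> is what Legendre
  duplication needs in order to turn the Gamma factor of \<open>gprod\<close> into the quotient
  \<open>Gamma (1 + 2 * z) / Gamma (1 + z)\<close> of the closed form, with
  \<open>z = c + zarg s p g k\<close>.\<close>

definition jconst :: "nat \<Rightarrow> nat \<Rightarrow> nat \<Rightarrow> real \<Rightarrow> real" where
  "jconst s p e g = (\<Prod>k\<in>{s..<e}. real (Suc (k - p)) * Gamma (1 + zarg s p g k + g) / Gamma (1 + g)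
     * 2 powr (2 * zarg s p g k) / sqrt pi)"

text \<open>Replacing \<open>s\<close> by \<open>Suc s\<close> lowers \<open>zarg\<close> by
  \<open>g\<close>. At \<open>c = 2 * g + 1/2\<close> the Gamma factors of \<open>jconst\<close> and
  \<open>gprod\<close> are then those at \<open>c = 1/2\<close> for \<open>s\<close>, with their
  roles exchanged. The index \<open>s\<close> has \<open>zarg\<close> equal to 0 and accounts for
  \<open>sqrt (2 / pi)\<close>.\<close>

lemma vand_integral_jconst_step:
  assumes sp: "s < p" "p \<le> e" and g: "1 \<le> g" and c: "0 < c"
    and IH: "\<And>c. 0 < c \<Longrightarrow> vand_integral (Suc s) p e c g = jconst (Suc s) p e g * gprod (Suc s) p e c g"
  shows "vand_integral s p e c g = jconst s p e g * gprod s p e c g"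
proof -
  have se: "{s..<e} = insert s {Suc s..<e}" using sp by auto
  have G: "Gamma (1 + g) \<noteq> 0" using g by (intro less_imp_neq[symmetric] Gamma_real_pos) auto
  have z0: "zarg s p g s = 0" using sp by (simp add: zarg_def)
  have two: "sqrt (2 / pi) = 2 powr (1/2) / sqrt pi" by (simp add: powr_half_sqrt real_sqrt_divide)
  have z: "zarg (Suc s) p g k = zarg s p g k - g" if "k \<in> {Suc s..<e}" for k
  proof -
    have "real (k - s) = real (k - Suc s) + 1" using that by auto
    then show ?thesis by (simp add: zarg_def algebra_simps)
  qed
  have "vand_integral s p e (1/2) g = sqrt (2 / pi) * (jconst (Suc s) p e g * gprod (Suc s) p e (2 * g + 1/2) g)"
    using vand_integral_boundary[OF sp g] IH[of "2 * g + 1/2"] g by simp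
  also have "jconst (Suc s) p e g * gprod (Suc s) p e (2 * g + 1/2) g =
     (\<Prod>k\<in>{Suc s..<e}. (real (Suc (k - p)) * Gamma (1 + zarg s p g k + g) / Gamma (1 + g)
     * 2 powr (2 * zarg s p g k) / sqrt pi) * (2 powr (1/2) * Gamma (1/2 + 1/2 + zarg s p g k)))"
    unfolding jconst_def gprod_def prod.distrib[symmetric]
  proof (rule prod.cong)
    fix k assume k: "k \<in> {Suc s..<e}"
    have e1: "1 + (zarg s p g k - g) + g = 1 + zarg s p g k"
      "2 * g + 1 / 2 + 1 / 2 + (zarg s p g k - g) = 1 + zarg s p g k + g"
      "(1/2::real) + 1/2 + zarg s p g k = 1 + zarg s p g k" by simp_all
    have e2: "2 powr (2 * (zarg s p g k - g)) * 2 powr (2 * g + 1/2) = 2 powr (2 * zarg s p g k) * 2 powr (1/2)"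
      by (simp add: powr_add[symmetric])
    have "real (Suc (k - p)) * Gamma (1 + zarg (Suc s) p g k + g) / Gamma (1 + g) * 2 powr (2 * zarg (Suc s) p g k) / sqrt pi *
        (2 powr (2 * g + 1 / 2) * Gamma (2 * g + 1 / 2 + 1 / 2 + zarg (Suc s) p g k))
      = real (Suc (k - p)) * Gamma (1 + zarg s p g k) / Gamma (1 + g) * (2 powr (2 * (zarg s p g k - g)) * 2 powr (2 * g + 1/2)) / sqrt pi *
         Gamma (1 + zarg s p g k + g)"
      unfolding z[OF k] e1 by (simp add: mult_ac)
    also have "\<dots> = real (Suc (k - p)) * Gamma (1 + zarg s p g k + g) / Gamma (1 + g) * 2 powr (2 * zarg s p g k) / sqrt pi *
        (2 powr (1 / 2) * Gamma (1 / 2 + 1 / 2 + zarg s p g k))"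
      unfolding e1 e2 by (simp add: mult_ac)
    finally show "real (Suc (k - p)) * Gamma (1 + zarg (Suc s) p g k + g) / Gamma (1 + g) * 2 powr (2 * zarg (Suc s) p g k) / sqrt pi *
        (2 powr (2 * g + 1 / 2) * Gamma (2 * g + 1 / 2 + 1 / 2 + zarg (Suc s) p g k)) = \<dots>" .
  qed simp
  also have "sqrt (2 / pi) * \<dots> = jconst s p e g * gprod s p e (1/2) g"
    unfolding jconst_def gprod_def prod.distrib[symmetric] se using sp G
    by (simp add: z0 two)
  finally have "vand_integral s p e (1/2) g = jconst s p e g * gprod s p e (1/2) g" .
  moreover have "vand_integral s p e c g / gprod s p e c g = vand_integral s p e (1/2) g / gprod s p e (1/2) g"
    using sp c g by (intro vand_integral_gprod) auto
  moreover have "gprod s p e (1/2) g \<noteq> 0" "gprod s p e c g \<noteq> 0"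
    using gprod_pos[of "1/2" g s p e] gprod_pos[OF c g, of s p e] g by simp_all
  ultimately show ?thesis by (simp add: field_simps)
qed

lemma vand_integral_jconst_full:
  assumes "s \<le> e" "1 \<le> g" "0 < c"
  shows "vand_integral s e e c g = jconst s e e g * gprod s e e c g"
  using assms(1,3)
proof (induction "e - s" arbitrary: s c)
  case 0
  then show ?case by (simp add: vand_integral_empty jconst_def gprod_def)
next
  case (Suc m)
  show ?case
    by (rule vand_integral_jconst_step[OF _ _ assms(2) Suc(4)]) (use Suc in auto)
qed

text \<open>Both sides have the same \<open>zarg\<close>. Raising \<open>g\<close> by 1 multiplies
  the Gamma numerator by \<open>real (Suc (k - s)) * (1 + g)\<close> and the denominator by
  \<open>1 + g\<close>; the remaining integer is the prefactor on the right.\<close>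

lemma jconst_top:
  assumes "s \<le> e" "1 \<le> g"
  shows "jconst s e e (g + 1) = jconst s s e g"
  unfolding jconst_def
proof (rule prod.cong)
  fix k assume k: "k \<in> {s..<e}"
  have z: "zarg s e (g + 1) k = zarg s s g k" using k by (simp add: zarg_def algebra_simps)
  define y where "y = real (Suc (k - s)) * (1 + g)"
  have y0: "0 < y" using assms by (simp add: y_def)
  have y: "1 + zarg s s g k + g = y" by (simp add: y_def zarg_def algebra_simps)
  have "Gamma (y + 1) = y * Gamma y" using y0 by (intro Gamma_plus1) (auto simp: nonpos_Ints_def)
  moreover have "Gamma ((1 + g) + 1) = (1 + g) * Gamma (1 + g)" using assms by (intro Gamma_plus1) (auto simp: nonpos_Ints_def)
  ultimately have "real (Suc (k - e)) * Gamma (y + 1) / Gamma (1 + g + 1) = real (Suc (k - s)) * Gamma y / Gamma (1 + g)"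
    using k assms by (simp add: y_def)
  moreover have "1 + zarg s s g k + (g + 1) = y + 1" "1 + (g + 1) = 1 + g + 1" using y by simp_all
  ultimately show "real (Suc (k - e)) * Gamma (1 + zarg s e (g + 1) k + (g + 1)) / Gamma (1 + (g + 1)) *
         2 powr (2 * zarg s e (g + 1) k) / sqrt pi =
         real (Suc (k - s)) * Gamma (1 + zarg s s g k + g) / Gamma (1 + g) * 2 powr (2 * zarg s s g k) / sqrt pi"
    unfolding z y by (simp only:)
qed simp

theorem vand_integral_jconst:
  assumes "s \<le> p" "p \<le> e" "1 \<le> g" "0 < c"
  shows "vand_integral s p e c g = jconst s p e g * gprod s p e c g"
  using assms(1,4)
proof (induction "p - s" arbitrary: s c)
  case 0
  then have sp: "s = p" by simp
  have "gprod p e e c (g + 1) = gprod p p e c g"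
    unfolding gprod_def by (intro prod.cong refl) (auto simp: zarg_def algebra_simps)
  then show ?case
    using vand_integral_top[OF assms(2), of c g] vand_integral_jconst_full[OF assms(2), of "g + 1" c] jconst_top[OF assms(2,3)] assms 0 sp by simp
next
  case (Suc m)
  show ?case
    by (rule vand_integral_jconst_step[OF _ assms(2,3) Suc(4)]) (use Suc in auto)
qed

section \<open>Holomorphic dependence of exponential integrals on the parameter\<close>

lemma norm_exp_minus_one_le:
  fixes z :: complex
  shows "norm (exp z - 1) \<le> norm z * exp (norm z)"
proof -
  have "norm (exp z - exp 0) \<le> exp (norm z) * norm (z - 0)"
  proof (rule field_differentiable_bound[of "cball 0 (norm z)" exp exp])
    fix w assume "w \<in> cball (0::complex) (norm z)"
    then have "norm w \<le> norm z" by simp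
    then show "norm (exp w) \<le> exp (norm z)"
      using complex_Re_le_cmod[of w] by (simp add: norm_exp_eq_Re)
    show "(exp has_field_derivative exp w) (at w within cball 0 (norm z))" by (rule DERIV_exp[THEN DERIV_subset]) simp
  qed auto
  then show ?thesis by (simp add: mult.commute)
qed

text \<open>The linear factor is paid for by doubling the exponent, and the two signs replace the
  absolute value, so the bound consists of pure exponentials.\<close>

lemma abs_exp_bound:
  fixes y \<epsilon> :: real
  assumes "0 < \<epsilon>"
  shows "\<bar>y\<bar> * exp (\<epsilon> * \<bar>y\<bar>) \<le> (exp (2 * \<epsilon> * y) + exp (- (2 * \<epsilon> * y))) / \<epsilon>"
proof -
  have "\<epsilon> * \<bar>y\<bar> \<le> exp (\<epsilon> * \<bar>y\<bar>)" using exp_ge_add_one_self[of "\<epsilon> * \<bar>y\<bar>"] by linarith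
  then have "\<epsilon> * \<bar>y\<bar> * exp (\<epsilon> * \<bar>y\<bar>) \<le> exp (\<epsilon> * \<bar>y\<bar>) * exp (\<epsilon> * \<bar>y\<bar>)" by (rule mult_right_mono) simp
  also have "\<dots> = exp (2 * \<epsilon> * \<bar>y\<bar>)" by (simp flip: exp_add)
  also have "\<dots> \<le> exp (2 * \<epsilon> * y) + exp (- (2 * \<epsilon> * y))" by (cases "y \<ge> 0") auto
  finally show ?thesis using assms by (simp add: field_simps)
qed

text \<open>Difference quotients at \<open>z\<close> are dominated by the integrands at real parts
  \<open>Re z + 2 * \<epsilon>\<close> and \<open>Re z - 2 * \<epsilon>\<close>. The choice of
  \<open>\<epsilon>\<close> as a third of the distance to the boundary keeps both inside the
  half-plane, and dominated convergence along sequences gives the derivative.\<close>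

lemma holomorphic_laplace:
  fixes \<phi> :: "'a \<Rightarrow> complex" and h :: "'a \<Rightarrow> real"
  assumes meas: "\<phi> \<in> borel_measurable M" "h \<in> borel_measurable M"
    and int: "\<And>\<sigma>. \<sigma>0 < \<sigma> \<Longrightarrow> integrable M (\<lambda>x. norm (\<phi> x) * exp (\<sigma> * h x))"
  shows "(\<lambda>z. \<integral>x. \<phi> x * exp (z * of_real (h x)) \<partial>M) holomorphic_on {z. \<sigma>0 < Re z}"
  unfolding holomorphic_on_def field_differentiable_def
proof (intro ballI)
  fix z assume "z \<in> {z. \<sigma>0 < Re z}"
  then have z: "\<sigma>0 < Re z" by simp
  define F where "F z = (\<integral>x. \<phi> x * exp (z * of_real (h x)) \<partial>M)" for z
  define \<epsilon> where "\<epsilon> = (Re z - \<sigma>0) / 3"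
  have \<epsilon>: "0 < \<epsilon>" "\<sigma>0 < Re z - 2 * \<epsilon>" using z by (auto simp: \<epsilon>_def field_simps)
  have intz: "integrable M (\<lambda>x. \<phi> x * exp (w * of_real (h x)))" if "\<sigma>0 < Re w" for w
    using int[OF that] by (rule Bochner_Integration.integrable_bound) (use meas in \<open>auto simp: norm_mult norm_exp_eq_Re\<close>)
  define D where "D = (\<integral>x. \<phi> x * of_real (h x) * exp (z * of_real (h x)) \<partial>M)"
  define q where "q w x = \<phi> x * exp (z * of_real (h x)) * ((exp ((w - z) * of_real (h x)) - 1) / (w - z))" for w x
  define b where "b x = norm (\<phi> x) * (exp ((Re z + 2 * \<epsilon>) * h x) + exp ((Re z - 2 * \<epsilon>) * h x)) / \<epsilon>" for x
  have intb: "integrable M b"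
  proof -
    have "integrable M (\<lambda>x. (norm (\<phi> x) * exp ((Re z + 2 * \<epsilon>) * h x) + norm (\<phi> x) * exp ((Re z - 2 * \<epsilon>) * h x)) / \<epsilon>)"
      using \<epsilon> z by (intro integrable_divide_zero Bochner_Integration.integrable_add int) auto
    then show ?thesis by (simp add: b_def[abs_def] distrib_left)
  qed
  have qF: "(F w - F z) / (w - z) = (\<integral>x. q w x \<partial>M)" if w: "\<sigma>0 < Re w" "w \<noteq> z" for w
  proof -
    have "F w - F z = (\<integral>x. \<phi> x * exp (w * of_real (h x)) - \<phi> x * exp (z * of_real (h x)) \<partial>M)"
      unfolding F_def using w z by (intro Bochner_Integration.integral_diff[symmetric] intz)
    also have "\<dots> / (w - z) = (\<integral>x. (\<phi> x * exp (w * of_real (h x)) - \<phi> x * exp (z * of_real (h x))) / (w - z) \<partial>M)"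
      by simp
    also have "\<dots> = (\<integral>x. q w x \<partial>M)"
      by (intro Bochner_Integration.integral_cong refl) (simp add: q_def exp_add[symmetric] algebra_simps diff_divide_distrib)
    finally show ?thesis .
  qed
  have bound: "norm (q w x) \<le> b x" if w: "norm (w - z) \<le> \<epsilon>" "w \<noteq> z" for w x
  proof -
    let ?y = "h x"
    have "norm ((exp ((w - z) * of_real ?y) - 1) / (w - z)) \<le> (norm (w - z) * \<bar>?y\<bar> * exp (norm (w - z) * \<bar>?y\<bar>)) / norm (w - z)"
      unfolding norm_divide using norm_exp_minus_one_le[of "(w - z) * of_real ?y"]
      by (intro divide_right_mono) (auto simp: norm_mult)
    also have "\<dots> = \<bar>?y\<bar> * exp (norm (w - z) * \<bar>?y\<bar>)" using w by simp
    also have "\<dots> \<le> \<bar>?y\<bar> * exp (\<epsilon> * \<bar>?y\<bar>)" using w by (intro mult_left_mono) (auto intro: mult_right_mono)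
    also have "\<dots> \<le> (exp (2 * \<epsilon> * ?y) + exp (- (2 * \<epsilon> * ?y))) / \<epsilon>" by (rule abs_exp_bound[OF \<epsilon>(1)])
    finally have "norm (q w x) \<le> norm (\<phi> x) * exp (Re z * ?y) * ((exp (2 * \<epsilon> * ?y) + exp (- (2 * \<epsilon> * ?y))) / \<epsilon>)"
      unfolding q_def norm_mult by (intro mult_mono) (auto simp: norm_exp_eq_Re norm_mult[symmetric])
    also have "\<dots> = b x" unfolding b_def
      by (simp add: exp_add[symmetric] algebra_simps)
    finally show ?thesis .
  qed
  have "((\<lambda>w. (F w - F z) / (w - z)) \<longlongrightarrow> D) (at z)"
    unfolding tendsto_at_iff_sequentially comp_def
  proof (intro allI impI)
    fix X assume X: "\<forall>i. X i \<in> UNIV - {z}" "X \<longlonglongrightarrow> z"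
    have "eventually (\<lambda>n. dist (X n) z < \<epsilon>) sequentially" using X(2) \<epsilon>(1) by (rule tendstoD)
    then obtain n0 where n0: "\<And>n. n0 \<le> n \<Longrightarrow> dist (X n) z < \<epsilon>" unfolding eventually_sequentially by blast
    define Y where "Y n = X (n + n0)" for n
    have Y: "norm (Y n - z) \<le> \<epsilon>" "Y n \<noteq> z" for n
      using n0[of "n + n0"] X(1) by (auto simp: Y_def dist_norm)
    have Yz: "Y \<longlonglongrightarrow> z" unfolding Y_def using X(2) by (rule LIMSEQ_ignore_initial_segment)
    have "(\<lambda>n. \<integral>x. q (Y n) x \<partial>M) \<longlonglongrightarrow> (\<integral>x. \<phi> x * of_real (h x) * exp (z * of_real (h x)) \<partial>M)"
    proof (rule integral_dominated_convergence[OF _ _ intb])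
      show "(\<lambda>x. \<phi> x * of_real (h x) * exp (z * of_real (h x))) \<in> borel_measurable M" using meas by measurable
      show "q (Y n) \<in> borel_measurable M" for n unfolding q_def[abs_def] using meas by measurable
      show "AE x in M. norm (q (Y n) x) \<le> b x" for n using bound[OF Y] by simp
      show "AE x in M. (\<lambda>n. q (Y n) x) \<longlonglongrightarrow> \<phi> x * of_real (h x) * exp (z * of_real (h x))"
      proof (rule AE_I2)
        fix x
        have "((\<lambda>w. exp (w * of_real (h x))) has_field_derivative exp (z * of_real (h x)) * of_real (h x)) (at z)"
          by (auto intro!: derivative_eq_intros)
        then have "((\<lambda>w. (exp (w * of_real (h x)) - exp (z * of_real (h x))) / (w - z)) \<longlongrightarrow> exp (z * of_real (h x)) * of_real (h x)) (at z)"
          by (simp add: has_field_derivative_iff)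
        then have "(\<lambda>n. (exp (Y n * of_real (h x)) - exp (z * of_real (h x))) / (Y n - z)) \<longlonglongrightarrow> exp (z * of_real (h x)) * of_real (h x)"
          using Yz Y(2) unfolding tendsto_at_iff_sequentially comp_def by auto
        then have "(\<lambda>n. \<phi> x * ((exp (Y n * of_real (h x)) - exp (z * of_real (h x))) / (Y n - z))) \<longlonglongrightarrow> \<phi> x * (exp (z * of_real (h x)) * of_real (h x))"
          by (rule tendsto_mult_left)
        moreover have "\<phi> x * ((exp (w * of_real (h x)) - exp (z * of_real (h x))) / (w - z)) = q w x" for w
          by (simp add: q_def exp_add[symmetric] algebra_simps diff_divide_distrib)
        ultimately show "(\<lambda>n. q (Y n) x) \<longlonglongrightarrow> \<phi> x * of_real (h x) * exp (z * of_real (h x))"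
          by (simp add: mult_ac)
      qed
    qed
    moreover have "(F (Y n) - F z) / (Y n - z) = (\<integral>x. q (Y n) x \<partial>M)" for n
    proof (rule qF)
      have "Re z - Re (Y n) \<le> \<epsilon>" using Y(1)[of n] abs_Re_le_cmod[of "Y n - z"] by simp
      then show "\<sigma>0 < Re (Y n)" using \<epsilon> by linarith
    qed (rule Y)
    ultimately have "(\<lambda>n. (F (X (n + n0)) - F z) / (X (n + n0) - z)) \<longlonglongrightarrow> D"
      by (simp add: D_def Y_def)
    then show "(\<lambda>n. (F (X n) - F z) / (X n - z)) \<longlonglongrightarrow> D" by (rule LIMSEQ_offset)
  qed
  then have "(F has_field_derivative D) (at z)" by (simp add: has_field_derivative_iff)
  then show "\<exists>f'. ((\<lambda>z. \<integral>x. \<phi> x * exp (z * of_real (h x)) \<partial>M) has_field_derivative f') (at z within {z. \<sigma>0 < Re z})"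
    unfolding F_def[abs_def] using has_field_derivative_at_within by blast
qed

section \<open>Complex parameters\<close>

text \<open>On \<open>\<bar>u\<bar> \<le> 1\<close> the density is at most 1 and the power is
  integrable since \<open>r > - 1\<close>; outside, the power is below a polynomial.\<close>

lemma integrable_std_normal_powr:
  assumes "- 1 < r"
  shows "integrable std_normal (\<lambda>u. \<bar>u\<bar> powr r * (1 + u\<^sup>2) ^ k)"
proof -
  define m where "m = nat \<lceil>\<bar>r\<bar>\<rceil>"
  have rm: "r \<le> real (2 * m)" unfolding m_def by linarith
  have I1: "integrable lborel (\<lambda>u. indicator {0<..1} u * u powr r)"
  proof -
    have "(\<lambda>u. u powr r) integrable_on {0..1}" using integrable_on_powr_from_0[of r 1] assms by simp
    then have "(\<lambda>u. u powr r) absolutely_integrable_on {0..1}"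
      by (rule nonnegative_absolutely_integrable_1) simp
    then have "set_integrable lebesgue {0<..1} (\<lambda>u. u powr r)"
      by (rule set_integrable_subset) auto
    then have "integrable lebesgue (\<lambda>u. indicator {0<..1} u * u powr r)" by (simp add: set_integrable_def)
    then show ?thesis by (subst (asm) integrable_completion) auto
  qed
  have I2: "integrable lborel (\<lambda>u. indicator {0<..1} (-u) * (-u) powr r)"
    using lborel_integrable_real_affine[OF I1, of "-1" 0] by simp
  have I3: "integrable std_normal (\<lambda>u. (1 + u\<^sup>2) ^ (m + k))" by (rule integrable_std_normal_even_power)
  then have I3': "integrable lborel (\<lambda>u. std_normal_density u * (1 + u\<^sup>2) ^ (m + k))"
    unfolding std_normal_def by (subst (asm) integrable_density) auto
  have "integrable lborel (\<lambda>u. 2 ^ k * (indicator {0<..1} u * u powr r + indicator {0<..1} (-u) * (-u) powr r) + std_normal_density u * (1 + u\<^sup>2) ^ (m + k))"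
    by (intro Bochner_Integration.integrable_add integrable_mult_right I1 I2 I3')
  then have "integrable lborel (\<lambda>u. std_normal_density u * (\<bar>u\<bar> powr r * (1 + u\<^sup>2) ^ k))"
  proof (rule Bochner_Integration.integrable_bound, goal_cases)
    case 2
    show ?case
    proof (rule AE_I2)
      fix u :: real
      have d1: "std_normal_density u \<le> 1"
      proof -
        have "1 \<le> sqrt (2 * pi)" using pi_ge_two by (simp add: real_le_rsqrt)
        moreover have "exp (- u\<^sup>2 / 2) \<le> 1" by simp
        ultimately have "1 / sqrt (2 * pi) * exp (- u\<^sup>2 / 2) \<le> 1 * 1" by (intro mult_mono) auto
        then show ?thesis by (simp add: std_normal_density_def)
      qed
      let ?A = "2 ^ k * (indicator {0<..1} u * u powr r + indicator {0<..1} (-u) * (-u) powr r)"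
      let ?B = "std_normal_density u * (1 + u\<^sup>2) ^ (m + k)"
      have AB: "0 \<le> ?A" "0 \<le> ?B" by (auto intro!: mult_nonneg_nonneg add_nonneg_nonneg)
      have "std_normal_density u * (\<bar>u\<bar> powr r * (1 + u\<^sup>2) ^ k) \<le> ?A + ?B"
      proof (cases "\<bar>u\<bar> \<le> 1")
        case True
        have "u\<^sup>2 \<le> 1" using True by (simp add: abs_square_le_1)
        then have "(1 + u\<^sup>2) ^ k \<le> 2 ^ k" by (intro power_mono) auto
        then have "std_normal_density u * (\<bar>u\<bar> powr r * (1 + u\<^sup>2) ^ k) \<le> 1 * (\<bar>u\<bar> powr r * 2 ^ k)"
          using d1 by (intro mult_mono) auto
        also have "\<dots> = ?A" using True by (auto simp: indicator_def abs_if)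
        finally show ?thesis using AB by linarith
      next
        case False
        then have "\<bar>u\<bar> powr r \<le> \<bar>u\<bar> powr real (2 * m)" using rm by (intro powr_mono) auto
        also have "\<dots> = (u\<^sup>2) ^ m" using False by (subst powr_realpow) (auto simp: power_mult)
        also have "\<dots> \<le> (1 + u\<^sup>2) ^ m" by (intro power_mono) auto
        finally have "std_normal_density u * (\<bar>u\<bar> powr r * (1 + u\<^sup>2) ^ k) \<le> std_normal_density u * ((1 + u\<^sup>2) ^ m * (1 + u\<^sup>2) ^ k)"
          by (intro mult_left_mono mult_right_mono) auto
        also have "\<dots> = ?B" by (simp add: power_add)
        finally show ?thesis using AB(1) by linarith
      qed
      moreover have "0 \<le> std_normal_density u * (\<bar>u\<bar> powr r * (1 + u\<^sup>2) ^ k)" by simp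
      ultimately show "norm (std_normal_density u * (\<bar>u\<bar> powr r * (1 + u\<^sup>2) ^ k)) \<le> norm (?A + ?B)"
        by (simp only: real_norm_def)
    qed
  qed simp
  then show ?thesis unfolding std_normal_def by (subst integrable_density) auto
qed

lemma measurable_weight [measurable]: "weight I c g \<in> borel_measurable (gauss I)"
  unfolding weight_def[abs_def]
  by (intro borel_measurable_times borel_measurable_prod) (auto simp: pairs_def)

text \<open>For negative \<open>c\<close> polynomial growth fails, so only the factors with exponent
  \<open>2 * g\<close> are bounded polynomially, and the powers of the coordinates are kept in a
  majorant that still factorizes.\<close>

lemma integrable_weight:
  assumes I: "finite I" and c: "- 1 / 2 < c" and g: "0 \<le> g" and h: "poly_bounded I h"
  shows "integrable (gauss I) (\<lambda>x. h x * weight I c g x)"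
proof -
  have w0: "poly_bounded I (weight I 0 g)" by (rule poly_bounded_weight) (use I g in auto)
  have "poly_bounded I (\<lambda>x. h x * weight I 0 g x)" by (rule poly_bounded_mult[OF h w0])
  then obtain C k where b: "\<And>x. \<bar>h x * weight I 0 g x\<bar> \<le> C * (\<Prod>i\<in>I. 1 + (x i)\<^sup>2) ^ k"
    unfolding poly_bounded_def by blast
  have "integrable (gauss I) (\<lambda>x. \<Prod>i\<in>I. \<bar>x i\<bar> powr (2 * c) * (1 + (x i)\<^sup>2) ^ k)"
    unfolding gauss_def
    by (rule gaussS.product_integrable_prod[OF I integrable_std_normal_powr]) (use c in auto)
  then have "integrable (gauss I) (\<lambda>x. C * (\<Prod>i\<in>I. \<bar>x i\<bar> powr (2 * c) * (1 + (x i)\<^sup>2) ^ k))"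
    by (rule integrable_mult_right)
  then show ?thesis
  proof (rule Bochner_Integration.integrable_bound, goal_cases)
    case 1 show ?case using measurable_poly_bounded[OF h] by measurable
  next
    case 2
    show ?case
    proof (rule AE_I2)
      fix x
      have "norm (h x * weight I c g x) = (\<Prod>i\<in>I. \<bar>x i\<bar> powr (2 * c)) * \<bar>h x * (\<Prod>(i, j)\<in>pairs I. \<bar>(x i)\<^sup>2 - (x j)\<^sup>2\<bar> powr (2 * g))\<bar>"
        by (simp add: weight_def abs_mult abs_prod mult_ac)
      also have "\<dots> \<le> C * (\<Prod>i\<in>I. \<bar>x i\<bar> powr (2 * c) * (1 + (x i)\<^sup>2) ^ k)"
      \<comment> \<open>Because \<open>0 powr 0 = 0\<close>, \<open>weight I 0 g\<close> vanishes on
        the coordinate hyperplanes instead of dropping its first product. There the powers with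
        exponent \<open>2 * c\<close> are 0 as well.\<close>
      proof (cases "\<exists>i\<in>I. x i = 0")
        case True
        then have z: "(\<Prod>i\<in>I. \<bar>x i\<bar> powr (2 * c)) = 0" using I by (auto intro!: prod_zero)
        then show ?thesis by (simp add: prod.distrib)
      next
        case False
        then have "weight I 0 g x = (\<Prod>(i, j)\<in>pairs I. \<bar>(x i)\<^sup>2 - (x j)\<^sup>2\<bar> powr (2 * g))"
          by (auto simp: weight_def intro!: prod.neutral)
        then have "(\<Prod>i\<in>I. \<bar>x i\<bar> powr (2 * c)) * \<bar>h x * (\<Prod>(i, j)\<in>pairs I. \<bar>(x i)\<^sup>2 - (x j)\<^sup>2\<bar> powr (2 * g))\<bar>
           \<le> (\<Prod>i\<in>I. \<bar>x i\<bar> powr (2 * c)) * (C * (\<Prod>i\<in>I. 1 + (x i)\<^sup>2) ^ k)"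
          using b[of x] by (intro mult_left_mono prod_nonneg) auto
        then show ?thesis by (simp add: prod.distrib prod_power_distrib mult_ac)
      qed
      also have "\<dots> \<le> norm (C * (\<Prod>i\<in>I. \<bar>x i\<bar> powr (2 * c) * (1 + (x i)\<^sup>2) ^ k))" by simp
      finally show "norm (h x * weight I c g x) \<le> norm (C * (\<Prod>i\<in>I. \<bar>x i\<bar> powr (2 * c) * (1 + (x i)\<^sup>2) ^ k))" .
    qed
  qed
qed

definition cweight :: "nat set \<Rightarrow> complex \<Rightarrow> complex \<Rightarrow> (nat \<Rightarrow> real) \<Rightarrow> complex" where
  "cweight I c g x = (\<Prod>i\<in>I. complex_of_real \<bar>x i\<bar> powr (2 * c)) *
     (\<Prod>(i, j)\<in>pairs I. complex_of_real \<bar>(x i)\<^sup>2 - (x j)\<^sup>2\<bar> powr (2 * g))"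

lemma cweight_of_real: "cweight I (of_real c) (of_real g) x = of_real (weight I c g x)"
  unfolding cweight_def weight_def of_real_mult of_real_prod
  by (intro arg_cong2[where f="(*)"] prod.cong refl)
    (auto simp: powr_of_real[symmetric] simp del: powr_of_real)

lemma norm_cweight: "norm (cweight I c g x) = weight I (Re c) (Re g) x"
  unfolding cweight_def weight_def norm_mult prod_norm[symmetric]
  by (intro arg_cong2[where f="(*)"] prod.cong refl) (auto simp: norm_powr_real_powr)

definition generic :: "nat set \<Rightarrow> (nat \<Rightarrow> real) set" where
  "generic I = {x. (\<forall>i\<in>I. x i \<noteq> 0) \<and> (\<forall>(i, j)\<in>pairs I. (x i)\<^sup>2 \<noteq> (x j)\<^sup>2)}"

definition log_abs :: "nat set \<Rightarrow> (nat \<Rightarrow> real) \<Rightarrow> real" where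
  "log_abs I x = (\<Sum>i\<in>I. 2 * ln \<bar>x i\<bar>)"

definition log_disc :: "nat set \<Rightarrow> (nat \<Rightarrow> real) \<Rightarrow> real" where
  "log_disc I x = (\<Sum>(i, j)\<in>pairs I. 2 * ln \<bar>(x i)\<^sup>2 - (x j)\<^sup>2\<bar>)"

text \<open>The form required by \<open>holomorphic_laplace\<close>: an exponential linear in each
  parameter on generic points. Elsewhere some base is 0, and the corresponding complex power is 0
  too.\<close>

lemma cweight_exp:
  assumes "finite I"
  shows "cweight I c g x = (if x \<in> generic I then exp (c * of_real (log_abs I x)) * exp (g * of_real (log_disc I x)) else 0)"
proof (cases "x \<in> generic I")
  case True
  have "(\<Prod>i\<in>I. complex_of_real \<bar>x i\<bar> powr (2 * c)) = exp (c * of_real (log_abs I x))"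
  proof -
    have "(\<Prod>i\<in>I. complex_of_real \<bar>x i\<bar> powr (2 * c)) = (\<Prod>i\<in>I. exp (c * of_real (2 * ln \<bar>x i\<bar>)))"
      using True by (intro prod.cong refl) (auto simp: generic_def powr_def Ln_of_real mult_ac)
    then show ?thesis by (simp add: log_abs_def exp_sum assms sum_distrib_left)
  qed
  moreover have "(\<Prod>(i, j)\<in>pairs I. complex_of_real \<bar>(x i)\<^sup>2 - (x j)\<^sup>2\<bar> powr (2 * g)) = exp (g * of_real (log_disc I x))"
  proof -
    have "(\<Prod>(i, j)\<in>pairs I. complex_of_real \<bar>(x i)\<^sup>2 - (x j)\<^sup>2\<bar> powr (2 * g)) =
       (\<Prod>ij\<in>pairs I. exp (case ij of (i, j) \<Rightarrow> g * of_real (2 * ln \<bar>(x i)\<^sup>2 - (x j)\<^sup>2\<bar>)))"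
    proof (rule prod.cong[OF refl])
      fix ij assume "ij \<in> pairs I"
      then obtain i j where ij: "ij = (i, j)" "(x i)\<^sup>2 - (x j)\<^sup>2 \<noteq> 0" using True by (auto simp: generic_def)
      then show "(case ij of (i, j) \<Rightarrow> complex_of_real \<bar>(x i)\<^sup>2 - (x j)\<^sup>2\<bar> powr (2 * g)) =
         exp (case ij of (i, j) \<Rightarrow> g * of_real (2 * ln \<bar>(x i)\<^sup>2 - (x j)\<^sup>2\<bar>))"
        by (simp only: case_prod_conv) (simp add: powr_def Ln_of_real mult_ac del: of_real_diff of_real_power)
    qed
    also have "\<dots> = exp (\<Sum>ij\<in>pairs I. case ij of (i, j) \<Rightarrow> g * of_real (2 * ln \<bar>(x i)\<^sup>2 - (x j)\<^sup>2\<bar>))"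
      by (rule exp_sum[symmetric]) (simp add: assms)
    finally show ?thesis by (simp add: log_disc_def sum_distrib_left case_prod_unfold)
  qed
  ultimately show ?thesis using True by (simp add: cweight_def)
next
  case False
  then consider i where "i \<in> I" "x i = 0" | i j where "(i, j) \<in> pairs I" "(x i)\<^sup>2 = (x j)\<^sup>2"
    by (auto simp: generic_def)
  then have "cweight I c g x = 0"
  proof cases
    case 1
    then have "(\<Prod>i\<in>I. complex_of_real \<bar>x i\<bar> powr (2 * c)) = 0" using assms by (intro prod_zero) auto
    then show ?thesis by (simp add: cweight_def)
  next
    case 2
    then have "(case (i, j) of (i, j) \<Rightarrow> complex_of_real \<bar>(x i)\<^sup>2 - (x j)\<^sup>2\<bar> powr (2 * g)) = 0" by simp
    then have "(\<Prod>(i, j)\<in>pairs I. complex_of_real \<bar>(x i)\<^sup>2 - (x j)\<^sup>2\<bar> powr (2 * g)) = 0"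
      using 2(1) assms by (intro prod_zero finite_pairs bexI)
    then show ?thesis by (simp add: cweight_def)
  qed
  then show ?thesis using False by simp
qed

lemma measurable_generic:
  assumes "finite I"
  shows "(\<lambda>x. indicator (generic I) x :: real) \<in> borel_measurable (gauss I)"
proof -
  have "indicator (generic I) x = (\<Prod>i\<in>I. if x i = 0 then 0 else 1) * (\<Prod>(i, j)\<in>pairs I. if (x i)\<^sup>2 - (x j)\<^sup>2 = 0 then 0 else (1::real))" for x
  proof (cases "x \<in> generic I")
    case True
    have "(\<Prod>i\<in>I. if x i = 0 then 0 else 1) = (1::real)" "(\<Prod>(i, j)\<in>pairs I. if (x i)\<^sup>2 - (x j)\<^sup>2 = 0 then 0 else (1::real)) = 1"
      using True by (auto simp: generic_def intro!: prod.neutral)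
    then show ?thesis using True by simp
  next
    case False
    then consider i where "i \<in> I" "x i = 0" | i j where "(i, j) \<in> pairs I" "(x i)\<^sup>2 = (x j)\<^sup>2"
      by (auto simp: generic_def)
    then show ?thesis
    proof cases
      case 1
      then have "(\<Prod>i\<in>I. if x i = 0 then 0 else (1::real)) = 0" using assms by (intro prod_zero) auto
      then show ?thesis using False by simp
    next
      case 2
      then have "(case (i, j) of (i, j) \<Rightarrow> if (x i)\<^sup>2 - (x j)\<^sup>2 = 0 then 0 else (1::real)) = 0" by simp
      then have "(\<Prod>(i, j)\<in>pairs I. if (x i)\<^sup>2 - (x j)\<^sup>2 = 0 then 0 else (1::real)) = 0"
        using 2(1) assms by (intro prod_zero finite_pairs bexI)
      then show ?thesis using False by simp
    qed
  qed
  moreover have "(\<lambda>x. (\<Prod>i\<in>I. if x i = 0 then 0 else 1) * (\<Prod>(i, j)\<in>pairs I. if (x i)\<^sup>2 - (x j)\<^sup>2 = 0 then 0 else (1::real))) \<in> borel_measurable (gauss I)"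
    by (intro borel_measurable_times borel_measurable_prod) (auto simp: pairs_def)
  ultimately show ?thesis by simp
qed

lemma measurable_logs:
  assumes "finite I"
  shows "log_abs I \<in> borel_measurable (gauss I)" "log_disc I \<in> borel_measurable (gauss I)"
  unfolding log_abs_def[abs_def] log_disc_def[abs_def]
  by (intro borel_measurable_sum; auto simp: pairs_def)+

text \<open>The identity theorem is applied twice, each time with one parameter frozen. For real
  \<open>c > 0\<close> the real values \<open>g > 1\<close> accumulate at 2; once all
  \<open>g\<close> with positive real part are reached, the real values \<open>c > 0\<close>
  accumulate at 1. This order explains why \<open>hol_g\<close> concerns \<open>0 < Re c\<close>
  while \<open>hol_c\<close> covers the larger half-plane.\<close>

theorem cweight_continuation:
  fixes \<Phi> :: "(nat \<Rightarrow> real) \<Rightarrow> real" and F :: "complex \<Rightarrow> complex \<Rightarrow> complex"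
  assumes I: "finite I" and \<Phi>: "poly_bounded I \<Phi>"
    and real: "\<And>c g. 0 < c \<Longrightarrow> 1 \<le> g \<Longrightarrow> of_real (wint I c g \<Phi>) = F (of_real c) (of_real g)"
    and hol_g: "\<And>c. 0 < Re c \<Longrightarrow> F c holomorphic_on {g. 0 < Re g}"
    and hol_c: "\<And>g. 0 < Re g \<Longrightarrow> (\<lambda>c. F c g) holomorphic_on {c. - 1 / 2 < Re c}"
    and cont: "\<And>c. - 1 / 2 < Re c \<Longrightarrow> continuous_on {g. 0 \<le> Re g} (F c)"
    and c: "- 1 / 2 < Re c" and g: "0 \<le> Re g"
  shows "has_bochner_integral (gauss I) (\<lambda>x. of_real (\<Phi> x) * cweight I c g x) (F c g)"
proof -
  define X where "X c g = (\<integral>x. of_real (\<Phi> x) * cweight I c g x \<partial>gauss I)" for c g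
  define \<phi> where "\<phi> x = complex_of_real (indicator (generic I) x * \<Phi> x)" for x
  have \<phi>m: "\<phi> \<in> borel_measurable (gauss I)"
    unfolding \<phi>_def[abs_def] using measurable_generic[OF I] measurable_poly_bounded[OF \<Phi>] by measurable
  note [measurable] = \<phi>m measurable_logs[OF I]
  have ex: "of_real (\<Phi> x) * cweight I c g x = \<phi> x * exp (c * of_real (log_abs I x)) * exp (g * of_real (log_disc I x))" for c g x
    by (simp add: cweight_exp[OF I] \<phi>_def)
  have nm: "norm (\<phi> x * exp (c * of_real (log_abs I x)) * exp (g * of_real (log_disc I x))) = \<bar>\<Phi> x * weight I (Re c) (Re g) x\<bar>" for c g x
    unfolding ex[symmetric] by (simp add: norm_mult norm_cweight abs_mult weight_nonneg)
  have int: "integrable (gauss I) (\<lambda>x. of_real (\<Phi> x) * cweight I c g x)" if "- 1 / 2 < Re c" "0 \<le> Re g" for c g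
  proof -
    have "integrable (gauss I) (\<lambda>x. \<Phi> x * weight I (Re c) (Re g) x)" using that by (intro integrable_weight I \<Phi>)
    then show ?thesis unfolding ex
      by (rule Bochner_Integration.integrable_bound) (auto simp: nm)
  qed
  have absint: "integrable (gauss I) (\<lambda>x. norm (\<phi> x * exp (c * of_real (log_abs I x)) * exp (g * of_real (log_disc I x))))" 
    if "- 1 / 2 < Re c" "0 \<le> Re g" for c g
    using integrable_norm[OF int[OF that]] unfolding ex .
  have Xg: "X c holomorphic_on {g. 0 < Re g}" if c: "- 1 / 2 < Re c" for c
  proof -
    have "(\<lambda>g. \<integral>x. (\<phi> x * exp (c * of_real (log_abs I x))) * exp (g * of_real (log_disc I x)) \<partial>gauss I) holomorphic_on {g. 0 < Re g}"
    proof (rule holomorphic_laplace)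
      show "integrable (gauss I) (\<lambda>x. norm (\<phi> x * exp (c * of_real (log_abs I x))) * exp (\<sigma> * log_disc I x))" if "0 < \<sigma>" for \<sigma>
        using absint[of c "of_real \<sigma>"] c that by (simp add: norm_mult norm_exp_eq_Re)
    qed measurable
    then show ?thesis by (simp add: X_def[abs_def] ex mult_ac)
  qed
  have Xc: "(\<lambda>c. X c g) holomorphic_on {c. - 1 / 2 < Re c}" if g: "0 \<le> Re g" for g
  proof -
    have "(\<lambda>c. \<integral>x. (\<phi> x * exp (g * of_real (log_disc I x))) * exp (c * of_real (log_abs I x)) \<partial>gauss I) holomorphic_on {c. - 1 / 2 < Re c}"
    proof (rule holomorphic_laplace)
      show "integrable (gauss I) (\<lambda>x. norm (\<phi> x * exp (g * of_real (log_disc I x))) * exp (\<sigma> * log_abs I x))" if "- 1 / 2 < \<sigma>" for \<sigma>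
        using absint[of "of_real \<sigma>" g] g that by (simp add: norm_mult norm_exp_eq_Re mult_ac)
    qed measurable
    then show ?thesis by (simp add: X_def[abs_def] ex mult_ac)
  qed
  have conn: "open {z. r < Re z}" "connected {z. r < Re z}" for r
    by (auto intro!: open_halfspace_Re_gt convex_connected convex_halfspace_Re_gt)
  have islim: "of_real b islimpt complex_of_real ` {a<..}" if "a < b" for a b :: real
    unfolding islimpt_approachable
  proof (intro allI impI)
    fix \<epsilon> :: real assume "0 < \<epsilon>"
    then have "complex_of_real (b + \<epsilon> / 2) \<in> complex_of_real ` {a<..}" using that by (intro imageI) auto
    moreover have "complex_of_real (b + \<epsilon> / 2) \<noteq> of_real b" unfolding of_real_eq_iff using \<open>0 < \<epsilon>\<close> by simp
    moreover have "dist (complex_of_real (b + \<epsilon> / 2)) (of_real b) < \<epsilon>"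
      unfolding dist_of_real using \<open>0 < \<epsilon>\<close> by (simp add: dist_real_def)
    ultimately show "\<exists>x'\<in>complex_of_real ` {a<..}. x' \<noteq> of_real b \<and> dist x' (of_real b) < \<epsilon>"
      by blast
  qed
  have Xreal: "X (of_real c) (of_real g) = F (of_real c) (of_real g)" if "0 < c" "1 \<le> g" for c g
  proof -
    have "X (of_real c) (of_real g) = (\<integral>x. of_real (\<Phi> x * weight I c g x) \<partial>gauss I)"
      by (simp add: X_def cweight_of_real)
    also have "\<dots> = of_real (wint I c g \<Phi>)" unfolding wint_def by (rule integral_complex_of_real)
    finally show ?thesis using real[OF that] by simp
  qed
  have step1: "X (of_real c) g = F (of_real c) g" if "0 < c" "0 < Re g" for c g
  proof -
    have "X (of_real c) g - F (of_real c) g = 0"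
    proof (rule analytic_continuation[of "\<lambda>g. X (of_real c) g - F (of_real c) g" "{g. 0 < Re g}" "complex_of_real ` {1<..}" "of_real 2"])
      show "(\<lambda>g. X (of_real c) g - F (of_real c) g) holomorphic_on {g. 0 < Re g}"
        using that by (intro holomorphic_on_diff Xg hol_g) auto
    qed (use that conn islim[of 1 2] Xreal in auto)
    then show ?thesis by simp
  qed
  have step2: "X c g = F c g" if "- 1 / 2 < Re c" "0 < Re g" for c g
  proof -
    have "X c g - F c g = 0"
    proof (rule analytic_continuation[of "\<lambda>c. X c g - F c g" "{c. - 1 / 2 < Re c}" "complex_of_real ` {0<..}" "of_real 1"])
      show "(\<lambda>c. X c g - F c g) holomorphic_on {c. - 1 / 2 < Re c}"
        using that by (intro holomorphic_on_diff Xc hol_c) auto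
    qed (use that conn islim[of 0 1] step1 in auto)
    then show ?thesis by simp
  qed
  have "X c g = F c g"
  proof (cases "Re g = 0")
    case True
    define G where "G n = g + of_real (inverse (real (Suc n)))" for n
    have G: "0 < Re (G n)" "Re (G n) \<le> 1" for n
      using True by (auto simp: G_def field_simps)
    have Glim: "G \<longlonglongrightarrow> g"
    proof -
      have "(\<lambda>n. g + complex_of_real (inverse (real (Suc n)))) \<longlonglongrightarrow> g + of_real 0"
        by (intro tendsto_add tendsto_const tendsto_of_real LIMSEQ_inverse_real_of_nat)
      then show ?thesis by (simp add: G_def[abs_def])
    qed
    have "(\<lambda>n. \<integral>x. \<phi> x * exp (c * of_real (log_abs I x)) * exp (G n * of_real (log_disc I x)) \<partial>gauss I)
       \<longlonglongrightarrow> (\<integral>x. \<phi> x * exp (c * of_real (log_abs I x)) * exp (g * of_real (log_disc I x)) \<partial>gauss I)"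
    proof (rule integral_dominated_convergence)
      \<comment> \<open>The parameters \<open>G n\<close> have real part in (0, 1], so the
        integrands at the two exponents 0 and 1 together dominate the sequence.\<close>
      show "integrable (gauss I) (\<lambda>x. norm (\<phi> x * exp (c * of_real (log_abs I x)) * exp (0 * of_real (log_disc I x)))
          + norm (\<phi> x * exp (c * of_real (log_abs I x)) * exp (1 * of_real (log_disc I x))))"
        using c by (intro Bochner_Integration.integrable_add absint) auto
      show "AE x in gauss I. (\<lambda>n. \<phi> x * exp (c * of_real (log_abs I x)) * exp (G n * of_real (log_disc I x)))
         \<longlonglongrightarrow> \<phi> x * exp (c * of_real (log_abs I x)) * exp (g * of_real (log_disc I x))"
        by (intro AE_I2 tendsto_mult tendsto_const tendsto_exp Glim)
      show "AE x in gauss I. norm (\<phi> x * exp (c * of_real (log_abs I x)) * exp (G n * of_real (log_disc I x)))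
         \<le> norm (\<phi> x * exp (c * of_real (log_abs I x)) * exp (0 * of_real (log_disc I x)))
          + norm (\<phi> x * exp (c * of_real (log_abs I x)) * exp (1 * of_real (log_disc I x)))" for n
      proof (rule AE_I2)
        fix x
        have "exp (Re (G n) * log_disc I x) \<le> 1 + exp (log_disc I x)"
        proof (cases "0 \<le> log_disc I x")
          case True
          then have "Re (G n) * log_disc I x \<le> 1 * log_disc I x" using G[of n] by (intro mult_right_mono) auto
          then have "exp (Re (G n) * log_disc I x) \<le> exp (log_disc I x)" by simp
          then show ?thesis by linarith
        next
          case False
          then have "Re (G n) * log_disc I x \<le> 0" using G[of n] by (intro mult_nonneg_nonpos) auto
          then have "exp (Re (G n) * log_disc I x) \<le> 1" by simp
          then show ?thesis by (smt (verit) exp_ge_zero)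
        qed
        then have "norm (\<phi> x * exp (c * of_real (log_abs I x))) * exp (Re (G n) * log_disc I x) \<le>
           norm (\<phi> x * exp (c * of_real (log_abs I x))) * (1 + exp (log_disc I x))" by (intro mult_left_mono) auto
        then show "norm (\<phi> x * exp (c * of_real (log_abs I x)) * exp (G n * of_real (log_disc I x)))
         \<le> norm (\<phi> x * exp (c * of_real (log_abs I x)) * exp (0 * of_real (log_disc I x)))
          + norm (\<phi> x * exp (c * of_real (log_abs I x)) * exp (1 * of_real (log_disc I x)))"
          by (simp add: norm_mult norm_exp_eq_Re distrib_left)
      qed
    qed measurable
    then have "(\<lambda>n. X c (G n)) \<longlonglongrightarrow> X c g" by (simp add: X_def ex)
    moreover have "X c (G n) = F c (G n)" for n by (rule step2[OF c G(1)])
    ultimately have 1: "(\<lambda>n. F c (G n)) \<longlonglongrightarrow> X c g" by simp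
    have "(\<lambda>n. F c (G n)) \<longlonglongrightarrow> F c g"
      using cont[OF c] Glim g G less_imp_le[OF G(1)]
      by (intro continuous_on_tendsto_compose[OF cont[OF c] Glim]) auto
    then show ?thesis using 1 LIMSEQ_unique by blast
  next
    case False
    then show ?thesis using step2[OF c] g by simp
  qed
  then show ?thesis using int[OF c g] by (simp add: has_bochner_integral_iff X_def)
qed

section \<open>The closed form in Gamma functions\<close>

definition zval :: "nat \<Rightarrow> nat \<Rightarrow> complex \<Rightarrow> complex \<Rightarrow> nat \<Rightarrow> complex" where
  "zval s p c \<gamma> k = c + of_nat (k - p) + \<gamma> * of_nat (k - s)"

text \<open>
  Both products of the closed form at once: for \<open>k < p\<close> the truncated \<open>k - p\<close> vanishes, which gives the
  factors with index \<open>i = k - s + 1\<close> of the first product; \<open>k = p + j - 1\<close> gives those of the second.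
\<close>

definition jform :: "nat \<Rightarrow> nat \<Rightarrow> nat \<Rightarrow> complex \<Rightarrow> complex \<Rightarrow> complex" where
  "jform s p e c \<gamma> = (\<Prod>k\<in>{s..<e}. 2 powr (- c) *
     (of_nat (Suc (k - p)) * Gamma (1 + zval s p 0 \<gamma> k + \<gamma>) / Gamma (1 + \<gamma>)) *
     (Gamma (1 + 2 * zval s p c \<gamma> k) / Gamma (1 + zval s p c \<gamma> k)))"

lemma Re_pos_not_nonpos_Int: "0 < Re z \<Longrightarrow> z \<notin> \<int>\<^sub>\<le>\<^sub>0"
  by (auto elim!: nonpos_Ints_cases)

lemma Gamma_ne_0: "0 < Re z \<Longrightarrow> Gamma z \<noteq> 0" for z :: complex
  using Re_pos_not_nonpos_Int[of z] by (simp add: Gamma_eq_zero_iff)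

lemma Re_zval: "Re (zval s p c \<gamma> k) = Re c + real (k - p) + Re \<gamma> * real (k - s)"
  by (simp add: zval_def)

lemma Re_zval_ge: "0 \<le> Re \<gamma> \<Longrightarrow> Re c \<le> Re (zval s p c \<gamma> k)"
  by (simp add: Re_zval)

text \<open>Legendre's duplication formula at \<open>z + 1/2\<close>. It removes the half-integer
  arguments and \<open>sqrt pi\<close> of the real evaluation.\<close>

lemma duplication_real:
  fixes z :: real
  assumes "0 < z"
  shows "Gamma (1 + 2 * complex_of_real z) / Gamma (1 + of_real z) = of_real (2 powr (2 * z) * Gamma (z + 1 / 2) / sqrt pi)"
proof -
  define w where "w = complex_of_real z + 1 / 2"
  have "Gamma w * Gamma (w + 1/2) = exp ((1 - 2 * w) * of_real (ln 2)) * of_real (sqrt pi) * Gamma (2 * w)"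
    using assms by (intro Gamma_legendre_duplication Re_pos_not_nonpos_Int) (auto simp: w_def)
  moreover have "w + 1/2 = 1 + of_real z" "2 * w = 1 + 2 * of_real z" "1 - 2 * w = - 2 * of_real z"
    by (simp_all add: w_def)
  ultimately have d: "Gamma w * Gamma (1 + of_real z) = exp (- 2 * of_real z * of_real (ln 2)) * of_real (sqrt pi) * Gamma (1 + 2 * of_real z)"
    by simp
  have "Gamma w = of_real (Gamma (z + 1/2))"
  proof -
    have "w = complex_of_real (z + 1/2)" by (simp add: w_def)
    then show ?thesis by (simp only: Gamma_complex_of_real)
  qed
  moreover have "exp (- 2 * of_real z * of_real (ln 2)) = inverse (complex_of_real (2 powr (2 * z)))"
    by (simp add: powr_def exp_minus exp_of_real[symmetric])
  ultimately have d': "complex_of_real (Gamma (z + 1/2)) * Gamma (1 + of_real z) =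
      inverse (complex_of_real (2 powr (2 * z))) * of_real (sqrt pi) * Gamma (1 + 2 * of_real z)"
    using d by (simp only:)
  have ne: "Gamma (1 + complex_of_real z) \<noteq> 0" "complex_of_real (2 powr (2 * z)) \<noteq> 0" "complex_of_real (sqrt pi) \<noteq> 0"
    using assms by (auto intro!: Gamma_ne_0 simp del: Gamma_eq_zero_iff)
  have solve: "C / B = T * A / S" if "A * B = inverse T * S * C" "B \<noteq> 0" "T \<noteq> 0" "S \<noteq> 0" for A B C S T :: complex
    using that by (simp add: field_simps)
  show ?thesis unfolding of_real_mult of_real_divide by (rule solve[OF d' ne])
qed

lemma jform_real:
  assumes "s \<le> p" "p \<le> e" "1 \<le> g" "0 < c"
  shows "of_real (vand_integral s p e c g) = jform s p e (of_real c) (of_real g)"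
  unfolding vand_integral_jconst[OF assms] jconst_def gprod_def jform_def prod.distrib[symmetric] of_real_prod
proof (rule prod.cong)
  fix k
  let ?z = "zarg s p g k"
  have z: "0 \<le> ?z" using assms zarg_nonneg[of g s p k] by simp
  have e: "zval s p (of_real c) (of_real g) k = of_real (c + ?z)" "zval s p 0 (of_real g) k = of_real ?z"
    by (simp_all add: zval_def zarg_def)
  have G: "Gamma (1 + complex_of_real ?z + of_real g) = of_real (Gamma (1 + ?z + g))"
    "Gamma (1 + complex_of_real g) = of_real (Gamma (1 + g))"
    using Gamma_complex_of_real[of "1 + ?z + g"] Gamma_complex_of_real[of "1 + g"] by simp_all
  have D: "Gamma (1 + 2 * complex_of_real (c + ?z)) / Gamma (1 + of_real (c + ?z)) = of_real (2 powr (2 * (c + ?z)) * Gamma (c + ?z + 1 / 2) / sqrt pi)"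
    by (rule duplication_real) (use assms z in linarith)
  have P: "2 powr (- complex_of_real c) = of_real (2 powr (- c))"
    using powr_of_real[of 2 "- c"] by simp
  have Q: "2 powr (- c) * 2 powr (2 * (c + ?z)) = 2 powr (2 * ?z) * 2 powr c"
    by (simp add: powr_add[symmetric] add.commute)
  have "2 powr (- complex_of_real c) *
     (of_nat (Suc (k - p)) * Gamma (1 + zval s p 0 (of_real g) k + of_real g) / Gamma (1 + of_real g)) *
     (Gamma (1 + 2 * zval s p (of_real c) (of_real g) k) / Gamma (1 + zval s p (of_real c) (of_real g) k))
    = of_real (2 powr (- c) * (real (Suc (k - p)) * Gamma (1 + ?z + g) / Gamma (1 + g)) * (2 powr (2 * (c + ?z)) * Gamma (c + ?z + 1 / 2) / sqrt pi))"
    unfolding e G D P by simp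
  also have "2 powr (- c) * (real (Suc (k - p)) * Gamma (1 + ?z + g) / Gamma (1 + g)) * (2 powr (2 * (c + ?z)) * Gamma (c + ?z + 1 / 2) / sqrt pi)
    = (2 powr (- c) * 2 powr (2 * (c + ?z))) * (real (Suc (k - p)) * Gamma (1 + ?z + g) / Gamma (1 + g)) * (Gamma (c + ?z + 1 / 2) / sqrt pi)"
    by (simp add: mult_ac)
  also have "\<dots> = real (Suc (k - p)) * Gamma (1 + ?z + g) / Gamma (1 + g) * 2 powr (2 * ?z) / sqrt pi * (2 powr c * Gamma (c + 1 / 2 + ?z))"
    unfolding Q by (simp add: mult_ac add_ac)
  finally show "of_real (real (Suc (k - p)) * Gamma (1 + ?z + g) / Gamma (1 + g) * 2 powr (2 * ?z) / sqrt pi * (2 powr c * Gamma (c + 1 / 2 + ?z)))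
    = 2 powr (- complex_of_real c) *
     (of_nat (Suc (k - p)) * Gamma (1 + zval s p 0 (of_real g) k + of_real g) / Gamma (1 + of_real g)) *
     (Gamma (1 + 2 * zval s p (of_real c) (of_real g) k) / Gamma (1 + zval s p (of_real c) (of_real g) k))"
    by simp
qed simp

text \<open>Every Gamma argument of \<open>jform\<close> has positive real part, so there are
  neither poles nor zeros up to and including \<open>Re \<gamma> = 0\<close>. The bound
  \<open>Re c > - 1/2\<close> is exactly what \<open>1 + 2 * zval s p c \<gamma> k\<close> requires
  when \<open>k = s\<close>.\<close>

lemma jform_args:
  assumes "0 \<le> Re \<gamma>"
  shows "0 < Re (1 + zval s p 0 \<gamma> k + \<gamma>)" "0 < Re (1 + \<gamma>)"
    "- 1 / 2 < Re c \<Longrightarrow> 0 < Re (1 + 2 * zval s p c \<gamma> k)" "- 1 / 2 < Re c \<Longrightarrow> 0 < Re (1 + zval s p c \<gamma> k)"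
  using assms Re_zval_ge[OF assms, of 0 s p k] Re_zval_ge[OF assms, of c s p k] by auto

lemma zval_holomorphic:
  "(\<lambda>\<gamma>. zval s p c \<gamma> k) holomorphic_on A" "(\<lambda>c. zval s p c \<gamma> k) holomorphic_on A"
  unfolding zval_def by (intro holomorphic_intros)+

lemma zval_continuous: "continuous_on A (\<lambda>\<gamma>. zval s p c \<gamma> k)"
  unfolding zval_def by (intro continuous_intros)

lemma continuous_on_Gamma_halfplane:
  fixes f :: "complex \<Rightarrow> complex"
  assumes "continuous_on A f" "\<And>x. x \<in> A \<Longrightarrow> 0 < Re (f x)"
  shows "continuous_on A (\<lambda>x. Gamma (f x))"
proof (rule continuous_on_compose2[OF holomorphic_on_imp_continuous_on assms(1)])
  show "Gamma holomorphic_on {z. 0 < Re z}"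
    using Re_pos_not_nonpos_Int by (intro holomorphic_Gamma) auto
qed (use assms(2) in auto)

lemma jform_holomorphic_g:
  assumes "- 1 / 2 < Re c"
  shows "jform s p e c holomorphic_on {\<gamma>. 0 < Re \<gamma>}"
  unfolding jform_def[abs_def]
  by (intro holomorphic_intros zval_holomorphic Re_pos_not_nonpos_Int Gamma_ne_0 jform_args) (use assms in auto)

lemma jform_holomorphic_c:
  assumes "0 \<le> Re \<gamma>"
  shows "(\<lambda>c. jform s p e c \<gamma>) holomorphic_on {c. - 1 / 2 < Re c}"
  unfolding jform_def[abs_def]
  by (intro holomorphic_intros zval_holomorphic Re_pos_not_nonpos_Int Gamma_ne_0 jform_args) (use assms in auto)

lemma jform_continuous:
  assumes "- 1 / 2 < Re c"
  shows "continuous_on {\<gamma>. 0 \<le> Re \<gamma>} (jform s p e c)"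
  unfolding jform_def[abs_def]
  by (intro continuous_on_Gamma_halfplane continuous_intros zval_continuous ballI Gamma_ne_0 jform_args) (use assms in auto)

lemma selberg_vand:
  assumes "s \<le> p" "p \<le> e" "- 1 / 2 < Re c" "0 \<le> Re \<gamma>"
  shows "has_bochner_integral (gauss {s..<e}) (\<lambda>x. of_real ((vand p e x)\<^sup>2) * cweight {s..<e} c \<gamma> x) (jform s p e c \<gamma>)"
proof (rule cweight_continuation[where F="jform s p e"])
  show "poly_bounded {s..<e} (\<lambda>x. (vand p e x)\<^sup>2)"
    by (intro poly_bounded_power poly_bounded_vand assms)
  show "of_real (wint {s..<e} c g (\<lambda>x. (vand p e x)\<^sup>2)) = jform s p e (of_real c) (of_real g)" if "0 < c" "1 \<le> g" for c g
    using jform_real[OF assms(1,2) that(2,1)] by (simp add: vand_integral_def)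
qed (use assms jform_holomorphic_g jform_holomorphic_c jform_continuous in auto)

text \<open>The shift identity with \<open>k0 = p\<close> multiplies the evaluation by the factors
  \<open>1 + 2 * zval s p c \<gamma> k\<close>. These are polynomial in both parameters, so the same
  continuation applies.\<close>

lemma selberg_sqprod_vand:
  assumes "s \<le> p" "p \<le> e" "- 1 / 2 < Re c" "0 \<le> Re \<gamma>"
  shows "has_bochner_integral (gauss {s..<e})
    (\<lambda>x. of_real (sqprod {p..<e} x * (vand p e x)\<^sup>2) * cweight {s..<e} c \<gamma> x)
    (jform s p e c \<gamma> * (\<Prod>k\<in>{p..<e}. 1 + 2 * zval s p c \<gamma> k))"
proof (rule cweight_continuation[where F="\<lambda>c \<gamma>. jform s p e c \<gamma> * (\<Prod>k\<in>{p..<e}. 1 + 2 * zval s p c \<gamma> k)"])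
  show "poly_bounded {s..<e} (\<lambda>x. sqprod {p..<e} x * (vand p e x)\<^sup>2)"
    using assms by (intro poly_bounded_mult poly_bounded_power poly_bounded_vand poly_bounded_sqprod) auto
  show "of_real (wint {s..<e} c g (\<lambda>x. sqprod {p..<e} x * (vand p e x)\<^sup>2)) =
    jform s p e (of_real c) (of_real g) * (\<Prod>k\<in>{p..<e}. 1 + 2 * zval s p (of_real c) (of_real g) k)" if "0 < c" "1 \<le> g" for c g
    unfolding wint_sqprod_vand[OF assms(1,2) that assms(1) order_refl] jform_real[OF assms(1,2) that(2,1), symmetric]
    by (simp add: vand_integral_def zval_def mult_ac distrib_left add_ac)
  show "(\<lambda>\<gamma>. jform s p e c \<gamma> * (\<Prod>k\<in>{p..<e}. 1 + 2 * zval s p c \<gamma> k)) holomorphic_on {g. 0 < Re g}" if "0 < Re c" for c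
    using that by (intro holomorphic_intros zval_holomorphic jform_holomorphic_g) auto
  show "(\<lambda>c. jform s p e c \<gamma> * (\<Prod>k\<in>{p..<e}. 1 + 2 * zval s p c \<gamma> k)) holomorphic_on {c. - 1 / 2 < Re c}" if "0 < Re \<gamma>" for \<gamma>
    using that by (intro holomorphic_intros zval_holomorphic jform_holomorphic_c) auto
  show "continuous_on {\<gamma>. 0 \<le> Re \<gamma>} (\<lambda>\<gamma>. jform s p e c \<gamma> * (\<Prod>k\<in>{p..<e}. 1 + 2 * zval s p c \<gamma> k))" if "- 1 / 2 < Re c" for c
    using that by (intro continuous_intros zval_continuous jform_continuous) auto
qed (use assms in auto)

lemma powr_two_power: "(2 powr (- c)) ^ n = (2 powr (- c * of_nat n) :: complex)"
  by (simp add: powr_def exp_of_nat_mult[symmetric] mult_ac)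

lemma jform_eq:
  fixes c \<gamma> :: complex
  assumes n: "n = n0 + n1" and g: "0 \<le> Re \<gamma>"
  shows "jform 1 (Suc n0) (Suc n) c \<gamma> = 2 powr (- c * of_nat n)
          * (\<Prod>i=1..n0.
               (Gamma (1 + of_nat i * \<gamma>) * Gamma (1 + 2 * c + 2 * (of_nat i - 1) * \<gamma>))
               / (Gamma (1 + \<gamma>) * Gamma (1 + c + (of_nat i - 1) * \<gamma>)))
          * (\<Prod>j=1..n1.
               (of_nat j * (1 + \<gamma>) * Gamma (of_nat j + (of_nat n0 + of_nat j) * \<gamma>)
                  * Gamma (1 + 2 * c + 2 * (of_nat j - 1) + 2 * (of_nat n0 + of_nat j - 1) * \<gamma>))
               / (Gamma (2 + \<gamma>)
                  * Gamma (c + of_nat j + (of_nat n0 + of_nat j - 1) * \<gamma>)))"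
proof -
  let ?f = "\<lambda>k. (of_nat (Suc (k - Suc n0)) * Gamma (1 + zval 1 (Suc n0) 0 \<gamma> k + \<gamma>) / Gamma (1 + \<gamma>)) *
     (Gamma (1 + 2 * zval 1 (Suc n0) c \<gamma> k) / Gamma (1 + zval 1 (Suc n0) c \<gamma> k))"
  \<comment> \<open>This reduces the stated quotient of \<open>1 + \<gamma>\<close> by
    \<open>Gamma (2 + \<gamma>)\<close> to the reciprocal of \<open>Gamma (1 + \<gamma>)\<close> in
    \<open>jform\<close>.\<close>
  have G2: "Gamma (2 + \<gamma>) = (1 + \<gamma>) * Gamma (1 + \<gamma>)"
    using Gamma_plus1[of "1 + \<gamma>"] g Re_pos_not_nonpos_Int[of "1 + \<gamma>"] by (simp add: add_ac)
  have g1: "1 + \<gamma> \<noteq> 0" using g by (auto simp: complex_eq_iff)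
  have "jform 1 (Suc n0) (Suc n) c \<gamma> = (2 powr (- c)) ^ n * (\<Prod>k\<in>{1..<Suc n}. ?f k)"
    by (simp only: jform_def prod.distrib prod_constant mult.assoc card_atLeastLessThan diff_Suc_1)
  also have "{1..<Suc n} = {1..n0} \<union> {Suc n0..n0 + n1}" using n by auto
  also have "(\<Prod>k\<in>{1..n0} \<union> {Suc n0..n0 + n1}. ?f k) = (\<Prod>k\<in>{1..n0}. ?f k) * (\<Prod>k\<in>{Suc n0..n0 + n1}. ?f k)"
    by (rule prod.union_disjoint) auto
  also have "(\<Prod>k\<in>{Suc n0..n0 + n1}. ?f k) = (\<Prod>j=1..n1. ?f (n0 + j))"
    by (rule prod.reindex_bij_witness[of _ "\<lambda>j. n0 + j" "\<lambda>k. k - n0"]) auto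
  also have "(\<Prod>j=1..n1. ?f (n0 + j)) = (\<Prod>j=1..n1.
               (of_nat j * (1 + \<gamma>) * Gamma (of_nat j + (of_nat n0 + of_nat j) * \<gamma>)
                  * Gamma (1 + 2 * c + 2 * (of_nat j - 1) + 2 * (of_nat n0 + of_nat j - 1) * \<gamma>))
               / (Gamma (2 + \<gamma>)
                  * Gamma (c + of_nat j + (of_nat n0 + of_nat j - 1) * \<gamma>)))"
  proof (rule prod.cong[OF refl])
    fix j assume "j \<in> {1..n1}"
    then obtain m where j: "j = Suc m" by (cases j) auto
    have z: "zval 1 (Suc n0) d \<gamma> (n0 + j) = d + of_nat m + \<gamma> * of_nat (n0 + m)" for d
      by (simp add: zval_def j)
    have a: "1 + zval 1 (Suc n0) 0 \<gamma> (n0 + j) + \<gamma> = of_nat j + (of_nat n0 + of_nat j) * \<gamma>"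
      "1 + 2 * zval 1 (Suc n0) c \<gamma> (n0 + j) = 1 + 2 * c + 2 * (of_nat j - 1) + 2 * (of_nat n0 + of_nat j - 1) * \<gamma>"
      "1 + zval 1 (Suc n0) c \<gamma> (n0 + j) = c + of_nat j + (of_nat n0 + of_nat j - 1) * \<gamma>"
      "Suc (n0 + j - Suc n0) = j"
      unfolding z by (simp_all add: j algebra_simps)
    show "?f (n0 + j) = (of_nat j * (1 + \<gamma>) * Gamma (of_nat j + (of_nat n0 + of_nat j) * \<gamma>)
                  * Gamma (1 + 2 * c + 2 * (of_nat j - 1) + 2 * (of_nat n0 + of_nat j - 1) * \<gamma>))
               / (Gamma (2 + \<gamma>)
                  * Gamma (c + of_nat j + (of_nat n0 + of_nat j - 1) * \<gamma>))"
      unfolding a G2 using g1 by simp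
  qed
  also have "(\<Prod>k\<in>{1..n0}. ?f k) = (\<Prod>i=1..n0.
               (Gamma (1 + of_nat i * \<gamma>) * Gamma (1 + 2 * c + 2 * (of_nat i - 1) * \<gamma>))
               / (Gamma (1 + \<gamma>) * Gamma (1 + c + (of_nat i - 1) * \<gamma>)))"
  proof (rule prod.cong[OF refl])
    fix k assume k: "k \<in> {1..n0}"
    then obtain m where m: "k = Suc m" by (cases k) auto
    have a: "1 + zval 1 (Suc n0) 0 \<gamma> k + \<gamma> = 1 + of_nat k * \<gamma>"
      "1 + 2 * zval 1 (Suc n0) c \<gamma> k = 1 + 2 * c + 2 * (of_nat k - 1) * \<gamma>"
      "1 + zval 1 (Suc n0) c \<gamma> k = 1 + c + (of_nat k - 1) * \<gamma>"
      "Suc (k - Suc n0) = 1"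
      using k by (simp_all add: zval_def m algebra_simps)
    show "?f k = (Gamma (1 + of_nat k * \<gamma>) * Gamma (1 + 2 * c + 2 * (of_nat k - 1) * \<gamma>))
               / (Gamma (1 + \<gamma>) * Gamma (1 + c + (of_nat k - 1) * \<gamma>))"
      unfolding a by simp
  qed
  finally show ?thesis by (simp add: powr_two_power mult.assoc)
qed

text \<open>The functional equation absorbs the additional factors: \<open>Gamma (3 + 2 * z) = 2 *
  (1 + z) * (1 + 2 * z) * Gamma (1 + 2 * z)\<close> and
  \<open>Gamma (2 + z) = (1 + z) * Gamma (1 + z)\<close>. So each quotient grows by
  \<open>2 * (1 + 2 * z)\<close>, and the surplus factors 2 account for the
  \<open>- of_nat n1\<close> in the power of 2.\<close>

lemma jform_sqprod_eq:
  fixes c \<gamma> :: complex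
  assumes n: "n = n0 + n1" and g: "0 \<le> Re \<gamma>" and c: "- 1 / 2 < Re c"
  shows "jform 1 (Suc n0) (Suc n) c \<gamma> * (\<Prod>k\<in>{Suc n0..<Suc n}. 1 + 2 * zval 1 (Suc n0) c \<gamma> k) =
      2 powr (- of_nat n1 - c * of_nat n)
          * (\<Prod>i=1..n0.
               (Gamma (1 + of_nat i * \<gamma>) * Gamma (1 + 2 * c + 2 * (of_nat i - 1) * \<gamma>))
               / (Gamma (1 + \<gamma>) * Gamma (1 + c + (of_nat i - 1) * \<gamma>)))
          * (\<Prod>j=1..n1.
               (of_nat j * (1 + \<gamma>) * Gamma (of_nat j + (of_nat n0 + of_nat j) * \<gamma>)
                  * Gamma (1 + 2 * c + 2 * of_nat j + 2 * (of_nat n0 + of_nat j - 1) * \<gamma>))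
               / (Gamma (2 + \<gamma>)
                  * Gamma (1 + c + of_nat j + (of_nat n0 + of_nat j - 1) * \<gamma>)))"
    (is "?L = _ * ?P * (\<Prod>j=1..n1. ?B j)")
proof -
  let ?A = "\<lambda>j. (of_nat j * (1 + \<gamma>) * Gamma (of_nat j + (of_nat n0 + of_nat j) * \<gamma>)
                  * Gamma (1 + 2 * c + 2 * (of_nat j - 1) + 2 * (of_nat n0 + of_nat j - 1) * \<gamma>))
               / (Gamma (2 + \<gamma>)
                  * Gamma (c + of_nat j + (of_nat n0 + of_nat j - 1) * \<gamma>))"
  have "(\<Prod>k\<in>{Suc n0..<Suc n}. 1 + 2 * zval 1 (Suc n0) c \<gamma> k) = (\<Prod>j=1..n1. 1 + 2 * zval 1 (Suc n0) c \<gamma> (n0 + j))"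
    unfolding n by (rule prod.reindex_bij_witness[of _ "\<lambda>j. n0 + j" "\<lambda>k. k - n0"]) auto
  then have "?L = 2 powr (- c * of_nat n) * ?P * (\<Prod>j=1..n1. ?A j * (1 + 2 * zval 1 (Suc n0) c \<gamma> (n0 + j)))"
    by (simp only: jform_eq[OF n g] prod.distrib mult.assoc)
  also have "(\<Prod>j=1..n1. ?A j * (1 + 2 * zval 1 (Suc n0) c \<gamma> (n0 + j))) = (\<Prod>j=1..n1. ?B j / 2)"
  proof (rule prod.cong[OF refl])
    fix j assume "j \<in> {1..n1}"
    then obtain m where j: "j = Suc m" by (cases j) auto
    define z where "z = zval 1 (Suc n0) c \<gamma> (n0 + j)"
    have z: "z = c + of_nat m + \<gamma> * of_nat (n0 + m)" by (simp add: z_def zval_def j)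
    have pos: "0 < Re (1 + 2 * z)" "0 < Re (1 + z)" unfolding z_def using jform_args[OF g] c by auto
    have a: "1 + 2 * c + 2 * (of_nat j - 1) + 2 * (of_nat n0 + of_nat j - 1) * \<gamma> = 1 + 2 * z"
      "c + of_nat j + (of_nat n0 + of_nat j - 1) * \<gamma> = 1 + z"
      "1 + 2 * c + 2 * of_nat j + 2 * (of_nat n0 + of_nat j - 1) * \<gamma> = 1 + 2 * z + 1 + 1"
      "1 + c + of_nat j + (of_nat n0 + of_nat j - 1) * \<gamma> = 1 + z + 1"
      unfolding z by (simp_all add: j algebra_simps)
    have G1: "Gamma (1 + z + 1) = (1 + z) * Gamma (1 + z)"
      by (rule Gamma_plus1[OF Re_pos_not_nonpos_Int[OF pos(2)]])
    have "Gamma (1 + 2 * z + 1) = (1 + 2 * z) * Gamma (1 + 2 * z)"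
      by (rule Gamma_plus1[OF Re_pos_not_nonpos_Int[OF pos(1)]])
    moreover have "Gamma (1 + 2 * z + 1 + 1) = (1 + 2 * z + 1) * Gamma (1 + 2 * z + 1)"
      using pos by (intro Gamma_plus1 Re_pos_not_nonpos_Int) auto
    ultimately have G2: "Gamma (1 + 2 * z + 1 + 1) = 2 * (1 + z) * ((1 + 2 * z) * Gamma (1 + 2 * z))"
      by (simp add: algebra_simps)
    have "1 + z \<noteq> 0" using pos(2) by (metis less_irrefl zero_complex.sel(1))
    moreover have "a * X / (H * K) * d = a * (2 * u * (d * X)) / (H * (u * K)) / 2" if "u \<noteq> 0" for a u d X H K :: complex
      using that by (cases "H = 0 \<or> K = 0") (auto simp: field_simps)
    ultimately show "?A j * (1 + 2 * zval 1 (Suc n0) c \<gamma> (n0 + j)) = ?B j / 2"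
      unfolding a G1 G2 z_def[symmetric] by blast
  qed
  also have "(\<Prod>j=1..n1. ?B j / 2) = (\<Prod>j=1..n1. ?B j) / 2 ^ n1"
    by (simp only: prod_dividef prod_constant card_atLeastAtMost diff_Suc_1)
  also have "2 powr (- c * of_nat n) * ?P * ((\<Prod>j=1..n1. ?B j) / 2 ^ n1) =
     2 powr (- of_nat n1 - c * of_nat n) * ?P * (\<Prod>j=1..n1. ?B j)"
  proof -
    have "2 powr (- of_nat n1 - c * of_nat n) = 2 powr (- c * of_nat n) / (2 ^ n1 :: complex)"
      by (simp add: powr_diff powr_minus field_simps)
    then show ?thesis by simp
  qed
  finally show ?thesis .
qed

lemma index_pairs_eq: "index_pairs a b = pairs {a..<Suc b}"
  by (auto simp: index_pairs_def pairs_def)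

lemma vand_sq_index_pairs: "(vand a (Suc b) x)\<^sup>2 = (\<Prod>(i, j)\<in>index_pairs a b. ((x i)\<^sup>2 - (x j)\<^sup>2)\<^sup>2)"
  unfolding vand_pairs index_pairs_eq prod_power_distrib
  by (intro prod.cong refl) (auto simp: power2_commute)

theorem corollary7p11:
  fixes n n0 n1 :: nat and c \<gamma> :: complex
  assumes "n = n0 + n1" and "n1 \<ge> 2"
    and "Re c > - 1 / 2" and "Re \<gamma> \<ge> 0"
  shows
    "has_bochner_integral (gaussian_measure n)
       (\<lambda>x. complex_of_real (\<Prod>i=n0+1..n. (x i)\<^sup>2)
          * complex_of_real (\<Prod>(i, j)\<in>index_pairs (n0 + 1) n. ((x i)\<^sup>2 - (x j)\<^sup>2)\<^sup>2)
          * (\<Prod>i=1..n. complex_of_real \<bar>x i\<bar> powr (2 * c))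
          * (\<Prod>(i, j)\<in>index_pairs 1 n. complex_of_real \<bar>(x i)\<^sup>2 - (x j)\<^sup>2\<bar> powr (2 * \<gamma>)))
       (2 powr (- of_nat n1 - c * of_nat n)
          * (\<Prod>i=1..n0.
               (Gamma (1 + of_nat i * \<gamma>) * Gamma (1 + 2 * c + 2 * (of_nat i - 1) * \<gamma>))
               / (Gamma (1 + \<gamma>) * Gamma (1 + c + (of_nat i - 1) * \<gamma>)))
          * (\<Prod>j=1..n1.
               (of_nat j * (1 + \<gamma>) * Gamma (of_nat j + (of_nat n0 + of_nat j) * \<gamma>)
                  * Gamma (1 + 2 * c + 2 * of_nat j + 2 * (of_nat n0 + of_nat j - 1) * \<gamma>))
               / (Gamma (2 + \<gamma>)
                  * Gamma (1 + c + of_nat j + (of_nat n0 + of_nat j - 1) * \<gamma>))))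
     \<and>
     has_bochner_integral (gaussian_measure n)
       (\<lambda>x. complex_of_real (\<Prod>(i, j)\<in>index_pairs (n0 + 1) n. ((x i)\<^sup>2 - (x j)\<^sup>2)\<^sup>2)
          * (\<Prod>i=1..n. complex_of_real \<bar>x i\<bar> powr (2 * c))
          * (\<Prod>(i, j)\<in>index_pairs 1 n. complex_of_real \<bar>(x i)\<^sup>2 - (x j)\<^sup>2\<bar> powr (2 * \<gamma>)))
       (2 powr (- c * of_nat n)
          * (\<Prod>i=1..n0.
               (Gamma (1 + of_nat i * \<gamma>) * Gamma (1 + 2 * c + 2 * (of_nat i - 1) * \<gamma>))
               / (Gamma (1 + \<gamma>) * Gamma (1 + c + (of_nat i - 1) * \<gamma>)))
          * (\<Prod>j=1..n1.
               (of_nat j * (1 + \<gamma>) * Gamma (of_nat j + (of_nat n0 + of_nat j) * \<gamma>)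
                  * Gamma (1 + 2 * c + 2 * (of_nat j - 1) + 2 * (of_nat n0 + of_nat j - 1) * \<gamma>))
               / (Gamma (2 + \<gamma>)
                  * Gamma (c + of_nat j + (of_nat n0 + of_nat j - 1) * \<gamma>))))"
proof -
  \<comment> \<open>The closed ranges of the statement become half-open ones with
    \<open>s = 1\<close>, \<open>p = n0 + 1\<close> and \<open>e = n + 1\<close>.\<close>
  let ?A = "Suc n0" and ?E = "Suc n"
  have le: "1 \<le> ?A" "?A \<le> ?E" using assms(1) by auto
  have I: "{1..<?E} = {1..n}" "{?A..<?E} = {n0+1..n}" by auto
  have sq: "sqprod {?A..<?E} x = (\<Prod>i=n0+1..n. (x i)\<^sup>2)" for x by (simp only: sqprod_def I)
  have w: "cweight {1..<?E} c \<gamma> x = (\<Prod>i=1..n. complex_of_real \<bar>x i\<bar> powr (2 * c))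
          * (\<Prod>(i, j)\<in>index_pairs 1 n. complex_of_real \<bar>(x i)\<^sup>2 - (x j)\<^sup>2\<bar> powr (2 * \<gamma>))" for x
    unfolding cweight_def index_pairs_eq I(1) ..
  have v: "(vand ?A ?E x)\<^sup>2 = (\<Prod>(i, j)\<in>index_pairs (n0 + 1) n. ((x i)\<^sup>2 - (x j)\<^sup>2)\<^sup>2)" for x
    using vand_sq_index_pairs[of "n0 + 1" n x] by simp
  note 1 = selberg_sqprod_vand[OF le assms(3,4), unfolded jform_sqprod_eq[OF assms(1,4,3)] w v sq of_real_mult]
  note 2 = selberg_vand[OF le assms(3,4), unfolded jform_eq[OF assms(1,4)] w v]
  show ?thesis
    using 1 2 unfolding gaussian_measure_eq I(1) mult.assoc by (intro conjI)
qed

end
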